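(* Let $\Sigma$ be a finite signed alphabet and let $\lambda,\mu,\nu$ be partitions with $\mathcal{Y}(\lambda)\subseteq\mathcal{Y}(\nu)$. Define the super Littlewood--Richardson coefficient $c^{\nu}_{\lambda,\mu}$ as the number of pairs $(t',t'')$ with $t'$ a super tableau of shape $\lambda$ and $t''$ a super tableau of shape $\mu$ over $\Sigma$ such that $t'\star t''=t$, where $t$ is any fixed super tableau of shape $\nu$ over $\Sigma$ (this number does not depend on the choice of $t$). Then the identities $$S_\lambda S_\mu=\sum_{\nu}c^{\nu}_{\lambda,\mu}S_\nu\qquad\text{and}\qquad S_{\nu/\lambda}=\sum_{\mu}c^{\nu}_{\lambda,\mu}S_\mu$$ hold in $R_\Sigma$, where the first sum runs over partitions $\nu$ with $\mathcal{Y}(\lambda)\subseteq\mathcal{Y}(\nu)$ and the second over all partitions $\mu$ (terms with no super tableau of the relevant shape vanish).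
   Context: A signed alphabet is a totally ordered set $\Sigma$ with a map $\|\cdot\|:\Sigma\to\{0,1\}$; $\Sigma_0,\Sigma_1$ are the preimages of $0,1$. For partitions $\mu\subseteq\lambda$ (i.e. $\mu_i\le\lambda_i$ for all $i$), $\mathcal{Y}(\lambda/\mu)=\{(i,j):\mu_i<j\le\lambda_i\}$, and $\mathcal{Y}(\lambda)=\mathcal{Y}(\lambda/0)$. A super (skew) tableau of shape $\lambda/\mu$ over $\Sigma$ is a map $F:\mathcal{Y}(\lambda/\mu)\to\Sigma$ with $F(i,j)\le F(i,j+1)$, equality only if $\|F(i,j)\|=0$, and $F(i,j)\le F(i+1,j)$, equality only if $\|F(i,j)\|=1$ (whenever both cells lie in the diagram). Its column reading $\mathbf{R}(S)$ is the word obtained by reading columns from left to right, each from bottom to top. The super plactic monoid $\mathbf{P}(\Sigma)$ is the quotient of the free monoid $\Sigma^*$ by the congruence generated by $xzy=zxy$ for $x\le y\le z$ with $x=y$ only if $\|y\|=0$ and $y=z$ only if $\|y\|=1$, and $yxz=yzx$ for $x\le y\le z$ with $x=y$ only if $\|y\|=1$ and $y=z$ only if $\|y\|=0$. Each class contains the reading of exactly one super tableau (a known fact), so elements of $\mathbf{P}(\Sigma)$ are identified with super tableaux; the product of super tableaux $t\star t'$ is the super tableau whose reading is equivalent to $\mathbf{R}(t)\mathbf{R}(t')$ (equivalently, obtained by row-inserting the letters of $\mathbf{R}(t')$ successively into $t$). $R_\Sigma$ is the monoid $\mathbb{Z}$-algebra $\mathbb{Z}[\mathbf{P}(\Sigma)]$.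 $S_\lambda\in R_\Sigma$ is the sum of all super tableaux of shape $\lambda$ over $\Sigma$, and $S_{\nu/\lambda}$ is the sum, over all super skew tableaux $S$ of shape $\nu/\lambda$ over $\Sigma$, of the class of $\mathbf{R}(S)$.
   Formalization: The second identity is stated only when some super tableau of shape ν over Σ exists; otherwise its coefficient is undefined, and reading it as 0 makes the identity false (Σ={a}, a even, ν=(1,1), λ=(1)). *)

theory Defs
  imports "HOL-Library.Poly_Mapping" "HOL-Library.FuncSet" "HOL-Algebra.Ring"
begin

section \<open>Partitions, diagrams and super tableaux\<close>

text \<open>
  A signed alphabet is a subset \<open>A\<close> of a linearly ordered type with a sign map \<open>sg\<close>;
  up to order isomorphism every finite totally ordered set, the empty one included, arises this way.
\<close>

definition finite_signed_alphabet :: "'a::linorder set \<Rightarrow> ('a \<Rightarrow> nat) \<Rightarrow> bool" where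
  "finite_signed_alphabet A sg \<longleftrightarrow> finite A \<and> sg \<in> A \<rightarrow> {0, 1}"

text \<open>
  Rows and columns are numbered from 0, so \<open>lam i\<close> is the usual part with index \<open>i + 1\<close>, and
  a partition is padded with zeros.
\<close>

definition partitions :: "(nat \<Rightarrow> nat) set" where
  "partitions = {lam. antimono lam \<and> finite {i. lam i \<noteq> 0}}"

definition skew_diagram :: "(nat \<Rightarrow> nat) \<Rightarrow> (nat \<Rightarrow> nat) \<Rightarrow> (nat \<times> nat) set" where
  "skew_diagram lam mu = {(i, j). mu i \<le> j \<and> j < lam i}"

definition diagram :: "(nat \<Rightarrow> nat) \<Rightarrow> (nat \<times> nat) set" where
  "diagram lam = skew_diagram lam (\<lambda>_. 0)"

text \<open>Fillings are partial maps, so that a filling determines its set of cells.\<close>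

type_synonym 'a filling = "(nat \<times> nat) \<Rightarrow> 'a option"

definition super_skew_tableaux ::
    "'a::linorder set \<Rightarrow> ('a \<Rightarrow> nat) \<Rightarrow> (nat \<Rightarrow> nat) \<Rightarrow> (nat \<Rightarrow> nat) \<Rightarrow> 'a filling set" where
  "super_skew_tableaux A sg lam mu = {F.
     dom F = skew_diagram lam mu \<and> ran F \<subseteq> A \<and>
     (\<forall>i j x y. F (i, j) = Some x \<longrightarrow> F (i, j + 1) = Some y \<longrightarrow> x \<le> y \<and> (x = y \<longrightarrow> sg x = 0)) \<and>
     (\<forall>i j x y. F (i, j) = Some x \<longrightarrow> F (i + 1, j) = Some y \<longrightarrow> x \<le> y \<and> (x = y \<longrightarrow> sg x = 1))}"

definition super_tableaux ::
    "'a::linorder set \<Rightarrow> ('a \<Rightarrow> nat) \<Rightarrow> (nat \<Rightarrow> nat) \<Rightarrow> 'a filling set" where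
  "super_tableaux A sg lam = super_skew_tableaux A sg lam (\<lambda>_. 0)"

definition column_word :: "'a filling \<Rightarrow> nat \<Rightarrow> 'a list" where
  "column_word F j = map (\<lambda>i. the (F (i, j))) (rev (sorted_list_of_set {i. (i, j) \<in> dom F}))"

definition column_reading :: "'a filling \<Rightarrow> 'a list" where
  "column_reading F = concat (map (column_word F) (sorted_list_of_set (snd ` dom F)))"


section \<open>The super plactic monoid and its monoid algebra\<close>

inductive_set plactic_cong :: "'a::linorder set \<Rightarrow> ('a \<Rightarrow> nat) \<Rightarrow> ('a list \<times> 'a list) set"
  for A :: "'a set" and sg :: "'a \<Rightarrow> nat" where
  refl: "w \<in> lists A \<Longrightarrow> (w, w) \<in> plactic_cong A sg"
| sym: "(v, w) \<in> plactic_cong A sg \<Longrightarrow> (w, v) \<in> plactic_cong A sg"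
| trans: "(u, v) \<in> plactic_cong A sg \<Longrightarrow> (v, w) \<in> plactic_cong A sg \<Longrightarrow> (u, w) \<in> plactic_cong A sg"
| append: "(u, u') \<in> plactic_cong A sg \<Longrightarrow> (v, v') \<in> plactic_cong A sg \<Longrightarrow>
    (u @ v, u' @ v') \<in> plactic_cong A sg"
| xzy: "x \<in> A \<Longrightarrow> y \<in> A \<Longrightarrow> z \<in> A \<Longrightarrow> x \<le> y \<Longrightarrow> y \<le> z \<Longrightarrow>
    (x = y \<longrightarrow> sg y = 0) \<Longrightarrow> (y = z \<longrightarrow> sg y = 1) \<Longrightarrow>
    ([x, z, y], [z, x, y]) \<in> plactic_cong A sg"
| yxz: "x \<in> A \<Longrightarrow> y \<in> A \<Longrightarrow> z \<in> A \<Longrightarrow> x \<le> y \<Longrightarrow> y \<le> z \<Longrightarrow>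
    (x = y \<longrightarrow> sg y = 1) \<Longrightarrow> (y = z \<longrightarrow> sg y = 0) \<Longrightarrow>
    ([y, x, z], [y, z, x]) \<in> plactic_cong A sg"

definition plactic_class :: "'a::linorder set \<Rightarrow> ('a \<Rightarrow> nat) \<Rightarrow> 'a list \<Rightarrow> 'a list set" where
  "plactic_class A sg w = plactic_cong A sg `` {w}"

definition super_plactic_monoid :: "'a::linorder set \<Rightarrow> ('a \<Rightarrow> nat) \<Rightarrow> 'a list set monoid" where
  "super_plactic_monoid A sg =
    \<lparr>carrier = lists A // plactic_cong A sg,
     mult = (\<lambda>X Y. \<Union>x\<in>X. \<Union>y\<in>Y. plactic_class A sg (x @ y)),
     one = plactic_class A sg []\<rparr>"

text \<open>
  The integral monoid algebra of \<open>G\<close>: the free abelian group on \<open>carrier G\<close> with the bilinear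
  extension of the product of \<open>G\<close>.
\<close>

definition monoid_algebra :: "('g, 'm) monoid_scheme \<Rightarrow> ('g \<Rightarrow>\<^sub>0 int) ring" where
  "monoid_algebra G =
    \<lparr>carrier = {f. Poly_Mapping.keys f \<subseteq> carrier G},
     mult = (\<lambda>f g. frag_extend (\<lambda>u. frag_extend (\<lambda>v. frag_of (u \<otimes>\<^bsub>G\<^esub> v)) g) f),
     one = frag_of \<one>\<^bsub>G\<^esub>,
     zero = 0,
     add = (+)\<rparr>"

definition super_plactic_ring ::
    "'a::linorder set \<Rightarrow> ('a \<Rightarrow> nat) \<Rightarrow> ('a list set \<Rightarrow>\<^sub>0 int) ring" where
  "super_plactic_ring A sg = monoid_algebra (super_plactic_monoid A sg)"

definition S_skew ::
    "'a::linorder set \<Rightarrow> ('a \<Rightarrow> nat) \<Rightarrow> (nat \<Rightarrow> nat) \<Rightarrow> (nat \<Rightarrow> nat) \<Rightarrow> ('a list set \<Rightarrow>\<^sub>0 int)" where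
  "S_skew A sg nu lam =
    (\<Sum>F\<in>super_skew_tableaux A sg nu lam. frag_of (plactic_class A sg (column_reading F)))"

definition S_straight ::
    "'a::linorder set \<Rightarrow> ('a \<Rightarrow> nat) \<Rightarrow> (nat \<Rightarrow> nat) \<Rightarrow> ('a list set \<Rightarrow>\<^sub>0 int)" where
  "S_straight A sg lam =
    (\<Sum>t\<in>super_tableaux A sg lam. frag_of (plactic_class A sg (column_reading t)))"


section \<open>Products of tableaux and Littlewood-Richardson coefficients\<close>

definition tableau_product ::
    "'a::linorder set \<Rightarrow> ('a \<Rightarrow> nat) \<Rightarrow> 'a filling \<Rightarrow> 'a filling \<Rightarrow> 'a filling" where
  "tableau_product A sg t t' = (THE s. s \<in> (\<Union>lam\<in>partitions. super_tableaux A sg lam) \<and>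
     (column_reading s, column_reading t @ column_reading t') \<in> plactic_cong A sg)"

definition factorizations ::
    "'a::linorder set \<Rightarrow> ('a \<Rightarrow> nat) \<Rightarrow> (nat \<Rightarrow> nat) \<Rightarrow> (nat \<Rightarrow> nat) \<Rightarrow> 'a filling \<Rightarrow>
     ('a filling \<times> 'a filling) set" where
  "factorizations A sg lam mu t =
    {(t', t''). t' \<in> super_tableaux A sg lam \<and> t'' \<in> super_tableaux A sg mu \<and>
       tableau_product A sg t' t'' = t}"

text \<open>
  The value \<open>LR_coeff A sg lam mu nu\<close> has no meaning when there is no super tableau of shape \<open>nu\<close>
  over \<open>A\<close>.
\<close>

definition LR_coeff ::
    "'a::linorder set \<Rightarrow> ('a \<Rightarrow> nat) \<Rightarrow> (nat \<Rightarrow> nat) \<Rightarrow> (nat \<Rightarrow> nat) \<Rightarrow> (nat \<Rightarrow> nat) \<Rightarrow> nat" where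
  "LR_coeff A sg lam mu nu =
    card (factorizations A sg lam mu (SOME t. t \<in> super_tableaux A sg nu))"


section \<open>Well-definedness of the algebraic structures\<close>

lemma plactic_cong_in_lists: "(v, w) \<in> plactic_cong A sg \<Longrightarrow> v \<in> lists A \<and> w \<in> lists A"
  by (induction rule: plactic_cong.induct) auto

lemma equiv_plactic_cong: "equiv (lists A) (plactic_cong A sg)"
proof (rule equivI)
  show "plactic_cong A sg \<subseteq> lists A \<times> lists A"
    using plactic_cong_in_lists by fast
  show "refl_on (lists A) (plactic_cong A sg)"
    by (intro refl_onI plactic_cong.refl)
  show "sym (plactic_cong A sg)"
    using plactic_cong.sym by (rule symI)
  show "trans (plactic_cong A sg)"
    using plactic_cong.trans by (rule transI)
qed

lemma plactic_class_eq_iff: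
  assumes "v \<in> lists A" "w \<in> lists A"
  shows "plactic_class A sg v = plactic_class A sg w \<longleftrightarrow> (v, w) \<in> plactic_cong A sg"
  unfolding plactic_class_def by (rule eq_equiv_class_iff[OF equiv_plactic_cong assms])

lemma mult_plactic_class:
  assumes "v \<in> lists A" "w \<in> lists A"
  shows "plactic_class A sg v \<otimes>\<^bsub>super_plactic_monoid A sg\<^esub> plactic_class A sg w
    = plactic_class A sg (v @ w)"
proof -
  have "plactic_class A sg (x @ y) = plactic_class A sg (v @ w)"
    if "x \<in> plactic_class A sg v" "y \<in> plactic_class A sg w" for x y
  proof -
    have xy: "(v, x) \<in> plactic_cong A sg" "(w, y) \<in> plactic_cong A sg"
      using that by (auto simp: plactic_class_def)
    have "(v @ w, x @ y) \<in> plactic_cong A sg"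
      using xy by (rule plactic_cong.append)
    then show ?thesis
      unfolding plactic_class_def by (metis equiv_class_eq equiv_plactic_cong)
  qed
  moreover have "v \<in> plactic_class A sg v" "w \<in> plactic_class A sg w"
    using assms unfolding plactic_class_def by (simp_all only: Image_singleton_iff plactic_cong.refl)
  ultimately show ?thesis
    unfolding super_plactic_monoid_def monoid.simps by blast
qed

lemma carrier_super_plactic_monoid:
  "carrier (super_plactic_monoid A sg) = plactic_class A sg ` lists A"
  by (auto simp: super_plactic_monoid_def plactic_class_def quotient_def)

lemma one_super_plactic_monoid: "\<one>\<^bsub>super_plactic_monoid A sg\<^esub> = plactic_class A sg []"
  by (simp add: super_plactic_monoid_def)

lemma monoid_super_plactic_monoid: "Group.monoid (super_plactic_monoid A sg)"
proof (rule Group.monoidI)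
  let ?M = "super_plactic_monoid A sg"
  show "\<one>\<^bsub>?M\<^esub> \<in> carrier ?M"
    unfolding carrier_super_plactic_monoid one_super_plactic_monoid by (rule imageI) simp
  fix X assume "X \<in> carrier ?M"
  then obtain u where u: "u \<in> lists A" "X = plactic_class A sg u"
    unfolding carrier_super_plactic_monoid by blast
  have nil: "[] \<in> lists A" by (rule lists.Nil)
  show "\<one>\<^bsub>?M\<^esub> \<otimes>\<^bsub>?M\<^esub> X = X" "X \<otimes>\<^bsub>?M\<^esub> \<one>\<^bsub>?M\<^esub> = X"
    using mult_plactic_class[OF nil u(1), of sg] mult_plactic_class[OF u(1) nil, of sg]
    unfolding u(2) one_super_plactic_monoid by simp_all
  fix Y assume "Y \<in> carrier ?M"
  then obtain v where v: "v \<in> lists A" "Y = plactic_class A sg v"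
    unfolding carrier_super_plactic_monoid by blast
  have uv: "u @ v \<in> lists A" using u v by (simp only: append_in_lists_conv)
  show "X \<otimes>\<^bsub>?M\<^esub> Y \<in> carrier ?M"
    unfolding u(2) v(2) mult_plactic_class[OF u(1) v(1)] carrier_super_plactic_monoid
    using uv by (rule imageI)
  fix Z assume "Z \<in> carrier ?M"
  then obtain w where w: "w \<in> lists A" "Z = plactic_class A sg w"
    unfolding carrier_super_plactic_monoid by blast
  have vw: "v @ w \<in> lists A" using v w by (simp only: append_in_lists_conv)
  show "X \<otimes>\<^bsub>?M\<^esub> Y \<otimes>\<^bsub>?M\<^esub> Z = X \<otimes>\<^bsub>?M\<^esub> (Y \<otimes>\<^bsub>?M\<^esub> Z)"
    unfolding u(2) v(2) w(2) mult_plactic_class[OF u(1) v(1)] mult_plactic_class[OF v(1) w(1)]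
      mult_plactic_class[OF uv w(1)] mult_plactic_class[OF u(1) vw] by (simp only: append_assoc)
qed

lemma frag_extend_add_fun:
  "frag_extend (\<lambda>u. f u + g u) x = frag_extend f x + frag_extend g x"
  by (simp add: frag_extend_def frag_cmul_distrib2 sum.distrib)

lemma keys_frag_extend_subset:
  assumes "\<And>u. u \<in> Poly_Mapping.keys f \<Longrightarrow> Poly_Mapping.keys (b u) \<subseteq> K"
  shows "Poly_Mapping.keys (frag_extend b f) \<subseteq> K"
  using keys_frag_extend[of b f] assms by blast

lemma frag_extend_cong:
  assumes "\<And>u. u \<in> Poly_Mapping.keys f \<Longrightarrow> b u = c u"
  shows "frag_extend b f = frag_extend c f"
  using assms by (simp add: frag_extend_def)

lemma frag_extend_frag_extend:
  "frag_extend b (frag_extend c f) = frag_extend (\<lambda>u. frag_extend b (c u)) f"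
  by (simp add: frag_extend_def[of c] frag_extend_def[of "\<lambda>u. frag_extend b (c u)"]
      frag_extend_sum frag_extend_cmul)

lemma ring_monoid_algebra:
  assumes "Group.monoid G"
  shows "Ring.ring (monoid_algebra G)"
proof -
  interpret Group.monoid G by fact
  let ?R = "monoid_algebra G"
  have mult: "f \<otimes>\<^bsub>?R\<^esub> g = frag_extend (\<lambda>u. frag_extend (\<lambda>v. frag_of (u \<otimes>\<^bsub>G\<^esub> v)) g) f" for f g
    by (simp add: monoid_algebra_def)
  have carrier: "f \<in> carrier ?R \<longleftrightarrow> Poly_Mapping.keys f \<subseteq> carrier G" for f
    by (simp add: monoid_algebra_def)
  have add: "f \<oplus>\<^bsub>?R\<^esub> g = f + g" for f g by (simp add: monoid_algebra_def)
  have zero: "\<zero>\<^bsub>?R\<^esub> = 0" by (simp add: monoid_algebra_def)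
  have one: "\<one>\<^bsub>?R\<^esub> = frag_of \<one>\<^bsub>G\<^esub>" by (simp add: monoid_algebra_def)
  show ?thesis
  proof (rule Ring.ringI)
    show "abelian_group ?R"
    proof (rule abelian_groupI)
      fix f g assume "f \<in> carrier ?R" "g \<in> carrier ?R"
      then show "f \<oplus>\<^bsub>?R\<^esub> g \<in> carrier ?R"
        unfolding carrier add using Poly_Mapping.keys_add[of f g] by blast
    next
      fix f assume "f \<in> carrier ?R"
      then have "- f \<in> carrier ?R" "- f \<oplus>\<^bsub>?R\<^esub> f = \<zero>\<^bsub>?R\<^esub>"
        by (simp_all add: carrier add zero)
      then show "\<exists>g\<in>carrier ?R. g \<oplus>\<^bsub>?R\<^esub> f = \<zero>\<^bsub>?R\<^esub>" by blast
    qed (simp_all add: carrier add zero ac_simps)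
    show "Group.monoid ?R"
    proof (rule Group.monoidI)
      show "\<one>\<^bsub>?R\<^esub> \<in> carrier ?R" by (simp add: carrier one)
    next
      fix f g assume fg: "f \<in> carrier ?R" "g \<in> carrier ?R"
      show "f \<otimes>\<^bsub>?R\<^esub> g \<in> carrier ?R"
        unfolding carrier mult
      proof (intro keys_frag_extend_subset)
        fix u v assume "u \<in> Poly_Mapping.keys f" "v \<in> Poly_Mapping.keys g"
        then show "Poly_Mapping.keys (frag_of (u \<otimes>\<^bsub>G\<^esub> v)) \<subseteq> carrier G"
          using fg by (auto simp: carrier)
      qed
    next
      fix f assume f: "f \<in> carrier ?R"
      have "frag_extend (\<lambda>v. frag_of (\<one>\<^bsub>G\<^esub> \<otimes>\<^bsub>G\<^esub> v)) f = frag_extend frag_of f"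
        using f by (intro frag_extend_cong) (auto simp: carrier)
      then show "\<one>\<^bsub>?R\<^esub> \<otimes>\<^bsub>?R\<^esub> f = f"
        by (simp add: mult one frag_expansion[symmetric])
      have "frag_extend (\<lambda>v. frag_of (v \<otimes>\<^bsub>G\<^esub> \<one>\<^bsub>G\<^esub>)) f = frag_extend frag_of f"
        using f by (intro frag_extend_cong) (auto simp: carrier)
      then show "f \<otimes>\<^bsub>?R\<^esub> \<one>\<^bsub>?R\<^esub> = f"
        by (simp add: mult one frag_expansion[symmetric])
    next
      fix f g h assume fgh: "f \<in> carrier ?R" "g \<in> carrier ?R" "h \<in> carrier ?R"
      show "f \<otimes>\<^bsub>?R\<^esub> g \<otimes>\<^bsub>?R\<^esub> h = f \<otimes>\<^bsub>?R\<^esub> (g \<otimes>\<^bsub>?R\<^esub> h)"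
        unfolding mult frag_extend_frag_extend frag_extend_of
        using fgh by (intro frag_extend_cong arg_cong[where f = frag_of])
          (auto simp: carrier intro!: m_assoc)
    qed
  next
    fix f g h
    show "(f \<oplus>\<^bsub>?R\<^esub> g) \<otimes>\<^bsub>?R\<^esub> h = f \<otimes>\<^bsub>?R\<^esub> h \<oplus>\<^bsub>?R\<^esub> g \<otimes>\<^bsub>?R\<^esub> h"
      by (simp add: mult add frag_extend_add)
    show "h \<otimes>\<^bsub>?R\<^esub> (f \<oplus>\<^bsub>?R\<^esub> g) = h \<otimes>\<^bsub>?R\<^esub> f \<oplus>\<^bsub>?R\<^esub> h \<otimes>\<^bsub>?R\<^esub> g"
      by (simp add: mult add frag_extend_add frag_extend_add_fun)
  qed
qed

lemma ring_super_plactic_ring: "Ring.ring (super_plactic_ring A sg)"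
  unfolding super_plactic_ring_def by (intro ring_monoid_algebra monoid_super_plactic_monoid)

end

theory Submission
  imports Defs "HOL-Library.Multiset"
begin

text \<open>
  Numbering equal letters turns super words, tableaux and plactic relations into words with distinct
  letters, standard tableaux and Knuth relations. By Robinson--Schensted, a word in the plactic class
  of a standard tableau of shape \<open>nu\<close> amounts to a recording tableau \<open>Q\<close> of shape \<open>nu\<close>. Cut the word
  as \<open>u v\<close> after \<open>m\<close> letters: the entries of \<open>Q\<close> below \<open>m\<close> form the recording tableau of \<open>u\<close>, and by the
  symmetry of insertion and recording tableaux the remaining entries form a skew tableau that
  rectifies to the recording tableau of \<open>v\<close>. Prescribing these two recording tableaux, of shapes
  \<open>lam\<close> and \<open>mu\<close>, one sees that the factorizations of any tableau of shape \<open>nu\<close> are in bijection with the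
  standard skew tableaux of shape \<open>nu / lam\<close> that rectify to one fixed, but arbitrary, standard tableau
  of shape \<open>mu\<close>. This number depends only on the shapes, and by standardization it also counts the
  super skew tableaux of shape \<open>nu / lam\<close> that rectify to a given super tableau of shape \<open>mu\<close>.
\<close>

section \<open>Knuth equivalence and row insertion\<close>

inductive knuth :: "nat list \<Rightarrow> nat list \<Rightarrow> bool" where
  knuth_refl: "knuth w w"
| knuth_sym: "knuth v w \<Longrightarrow> knuth w v"
| knuth_trans: "knuth u v \<Longrightarrow> knuth v w \<Longrightarrow> knuth u w"
| knuth_append: "knuth u u' \<Longrightarrow> knuth v v' \<Longrightarrow> knuth (u @ v) (u' @ v')"
| knuth_xzy: "x < y \<Longrightarrow> y < z \<Longrightarrow> knuth [x, z, y] [z, x, y]"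
| knuth_yxz: "x < y \<Longrightarrow> y < z \<Longrightarrow> knuth [y, x, z] [y, z, x]"

declare knuth_refl [simp, intro]

lemma knuth_mset: "knuth v w \<Longrightarrow> mset v = mset w"
  by (induction rule: knuth.induct) auto

lemma knuth_set: "knuth v w \<Longrightarrow> set v = set w"
  using knuth_mset mset_eq_setD by blast

lemma knuth_distinct: "knuth v w \<Longrightarrow> distinct v \<longleftrightarrow> distinct w"
  using knuth_mset mset_eq_imp_distinct_iff by blast

lemma knuth_length: "knuth v w \<Longrightarrow> length v = length w"
  using knuth_mset mset_eq_length by blast

lemma knuth_appendL: "knuth v v' \<Longrightarrow> knuth (u @ v) (u @ v')"
  by (intro knuth_append) auto

lemma knuth_appendR: "knuth u u' \<Longrightarrow> knuth (u @ v) (u' @ v)"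
  by (intro knuth_append) auto

lemma knuth_Cons: "knuth v v' \<Longrightarrow> knuth (x # v) (x # v')"
  using knuth_appendL[of v v' "[x]"] by simp

lemma knuth_filter_ge: "knuth v w \<Longrightarrow> knuth (filter (\<lambda>x. m \<le> x) v) (filter (\<lambda>x. m \<le> x) w)"
proof (induction rule: knuth.induct)
  case (knuth_xzy x y z)
  then show ?case by (auto intro: knuth.intros)
next
  case (knuth_yxz x y z)
  then show ?case by (auto intro: knuth.intros)
qed (auto intro: knuth.intros)

lemma knuth_smaller_past_increasing:
  assumes "x < a" "sorted_wrt (<) (a # r)"
  shows "knuth (a # r @ [x]) (a # x # r)"
  using assms
proof (induction r arbitrary: a)
  case (Cons b r)
  then have "knuth (b # r @ [x]) (b # x # r)" by auto
  then have "knuth (a # (b # r @ [x])) (a # b # x # r)" by (rule knuth_Cons)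
  moreover have "knuth ([a, b, x] @ r) ([a, x, b] @ r)"
    using Cons.prems by (intro knuth_appendR knuth_sym[OF knuth_yxz]) auto
  ultimately show ?case by (auto intro: knuth_trans)
qed simp

lemma knuth_larger_past_increasing:
  assumes "sorted_wrt (<) (l @ [x])" "x < y"
  shows "knuth (l @ [y, x]) (y # l @ [x])"
  using assms
proof (induction l arbitrary: x rule: rev_induct)
  case Nil
  then show ?case by simp
next
  case (snoc b l)
  have "knuth (l @ [y, b]) (y # l @ [b])" using snoc by (auto simp: sorted_wrt_append)
  from knuth_appendR[OF this, of "[x]"] have "knuth (l @ [y, b, x]) (y # l @ [b, x])" by simp
  moreover have "knuth (l @ [b, y, x]) (l @ [y, b, x])"
    using snoc.prems by (intro knuth_appendL knuth_xzy) (auto simp: sorted_wrt_append)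
  ultimately show ?case by (auto intro: knuth_trans)
qed

definition next_above :: "nat set \<Rightarrow> nat \<Rightarrow> nat" where
  "next_above C x = (LEAST y. y \<in> C \<and> x < y)"

lemma next_above_props:
  assumes "\<exists>y\<in>C. x < y"
  shows "next_above C x \<in> C" "x < next_above C x" "\<And>y. y \<in> C \<Longrightarrow> x < y \<Longrightarrow> next_above C x \<le> y"
proof -
  obtain y where "y \<in> C \<and> x < y" using assms by blast
  from LeastI[of "\<lambda>y. y \<in> C \<and> x < y", OF this]
  show "next_above C x \<in> C" "x < next_above C x" unfolding next_above_def by auto
  show "next_above C x \<le> y" if "y \<in> C" "x < y" for y
    unfolding next_above_def using that by (intro Least_le) auto
qed

lemma next_above_eqI:
  assumes "y \<in> C" "x < y" "\<And>z. z \<in> C \<Longrightarrow> x < z \<Longrightarrow> y \<le> z"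
  shows "next_above C x = y"
  unfolding next_above_def using assms by (intro Least_equality) auto

definition bumped :: "nat set \<Rightarrow> nat \<Rightarrow> nat list" where
  "bumped C x = (if \<exists>y\<in>C. x < y then [next_above C x] else [])"

definition row_step :: "nat set \<Rightarrow> nat \<Rightarrow> nat set" where
  "row_step C x = insert x (C - set (bumped C x))"

fun row_insert :: "nat set \<Rightarrow> nat list \<Rightarrow> nat set" where
  "row_insert C [] = C"
| "row_insert C (x # w) = row_insert (row_step C x) w"

fun row_bumped :: "nat set \<Rightarrow> nat list \<Rightarrow> nat list" where
  "row_bumped C [] = []"
| "row_bumped C (x # w) = bumped C x @ row_bumped (row_step C x) w"

lemma row_append: "row_insert C (u @ v) = row_insert (row_insert C u) v"
  by (induction C u rule: row_insert.induct) auto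

lemma out_append: "row_bumped C (u @ v) = row_bumped C u @ row_bumped (row_insert C u) v"
  by (induction C u rule: row_insert.induct) auto

lemma finite_row_step [simp]: "finite C \<Longrightarrow> finite (row_step C x)"
  by (simp add: row_step_def)

lemma finite_row: "finite C \<Longrightarrow> finite (row_insert C w)"
  by (induction C w rule: row_insert.induct) auto

lemma step_bumped_mset:
  assumes "finite C" "x \<notin> C"
  shows "mset_set (row_step C x) + mset (bumped C x) = add_mset x (mset_set C)"
proof (cases "\<exists>y\<in>C. x < y")
  case True
  note n = next_above_props[OF True]
  have "mset_set C = add_mset (next_above C x) (mset_set (C - {next_above C x}))"
    using n(1) assms(1) by (rule mset_set.remove[rotated])
  moreover have "mset_set (row_step C x) = add_mset x (mset_set (C - {next_above C x}))"
    using True assms by (simp add: row_step_def bumped_def)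
  ultimately show ?thesis using True by (simp add: bumped_def)
next
  case False
  then show ?thesis using assms by (simp add: row_step_def bumped_def)
qed

lemma set_bumped_subset: "set (bumped C x) \<subseteq> C"
proof (cases "\<exists>y\<in>C. x < y")
  case True
  then show ?thesis using next_above_props(1)[OF True] by (simp add: bumped_def)
qed (simp add: bumped_def)

lemma row_out_mset:
  assumes "finite C" "distinct w" "C \<inter> set w = {}"
  shows "mset_set (row_insert C w) + mset (row_bumped C w) = mset_set C + mset w"
  using assms
proof (induction w arbitrary: C)
  case (Cons x w)
  have "row_step C x \<inter> set w = {}" using Cons.prems by (auto simp: row_step_def)
  then have "mset_set (row_insert (row_step C x) w) + mset (row_bumped (row_step C x) w) = mset_set (row_step C x) + mset w"
    using Cons by simp
  then have "mset_set (row_insert C (x # w)) + mset (row_bumped C (x # w))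
      = (mset_set (row_step C x) + mset (bumped C x)) + mset w" by (simp add: ac_simps)
  also have "mset_set (row_step C x) + mset (bumped C x) = add_mset x (mset_set C)"
    using Cons.prems by (intro step_bumped_mset) auto
  finally show ?case by simp
qed simp

lemma row_out_sets:
  assumes "finite C" "distinct w" "C \<inter> set w = {}"
  shows "row_insert C w \<union> set (row_bumped C w) = C \<union> set w" "row_insert C w \<inter> set (row_bumped C w) = {}"
    "distinct (row_bumped C w)"
proof -
  note m = row_out_mset[OF assms]
  have f: "finite (row_insert C w)" using assms finite_row by auto
  have "set_mset (mset_set (row_insert C w) + mset (row_bumped C w)) = set_mset (mset_set C + mset w)"
    using m by simp
  then show U: "row_insert C w \<union> set (row_bumped C w) = C \<union> set w" using assms f by simp
  have "size (mset_set (row_insert C w) + mset (row_bumped C w)) = size (mset_set C + mset w)"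
    using m by simp
  then have sz: "card (row_insert C w) + length (row_bumped C w) = card C + length w" by simp
  have "card (C \<union> set w) = card C + length w"
    using assms by (simp add: card_Un_disjoint distinct_card)
  moreover have "card (row_insert C w \<union> set (row_bumped C w)) + card (row_insert C w \<inter> set (row_bumped C w))
      = card (row_insert C w) + card (set (row_bumped C w))"
    using f card_Un_Int[of "row_insert C w" "set (row_bumped C w)"] by simp
  moreover have "card (set (row_bumped C w)) \<le> length (row_bumped C w)" by (rule card_length)
  ultimately have "card (row_insert C w \<inter> set (row_bumped C w)) = 0 \<and> card (set (row_bumped C w)) = length (row_bumped C w)"
    unfolding U using sz by linarith
  then show "row_insert C w \<inter> set (row_bumped C w) = {}" "distinct (row_bumped C w)"
    using f card_distinct[of "row_bumped C w"] card_0_eq[of "row_insert C w \<inter> set (row_bumped C w)"] by blast+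
qed

lemma sorted_list_of_set_eqI:
  fixes l :: "nat list"
  assumes "sorted_wrt (<) l" "set l = S"
  shows "sorted_list_of_set S = l"
  using assms by (metis sorted_list_of_set.idem_if_sorted_distinct strict_sorted_iff)

lemma knuth_row_out_step:
  assumes "finite C" "x \<notin> C"
  shows "knuth (sorted_list_of_set C @ [x]) (bumped C x @ sorted_list_of_set (row_step C x))"
proof (cases "\<exists>y\<in>C. x < y")
  case True
  define y where "y = next_above C x"
  note n = next_above_props[OF True, folded y_def]
  define L where "L = {c \<in> C. c < x}"
  define R where "R = {c \<in> C. y < c}"
  have fin: "finite L" "finite R" using assms by (auto simp: L_def R_def)
  have "c \<in> L \<or> c = y \<or> c \<in> R" if "c \<in> C" for c
  proof (cases "c < x")
    case False
    then have "x < c" using that assms(2) by (metis linorder_neqE_nat)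
    then have "y \<le> c" using n(3) that by blast
    then show ?thesis using that unfolding R_def by auto
  qed (auto simp: L_def that)
  then have C: "C = L \<union> {y} \<union> R" using n(1) by (auto simp: L_def R_def)
  let ?l = "sorted_list_of_set L" and ?r = "sorted_list_of_set R"
  have LR: "\<And>c. c \<in> L \<Longrightarrow> c < x" "\<And>c. c \<in> R \<Longrightarrow> y < c" by (auto simp: L_def R_def)
  have lr: "set ?l = L" "set ?r = R" "sorted_wrt (<) ?l" "sorted_wrt (<) ?r" using fin by auto
  have ord: "c < y" "c < d" "x < d" "c < x" "y < d" if "c \<in> L" "d \<in> R" for c d
    using LR(1)[OF that(1)] LR(2)[OF that(2)] n(2) by auto
  have 1: "sorted_list_of_set C = ?l @ y # ?r"
    using lr LR n(2) C by (intro sorted_list_of_set_eqI) (fastforce simp: sorted_wrt_append)+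
  have "C - {y} = L \<union> R" using C LR n(2) by fastforce
  then have st: "row_step C x = L \<union> {x} \<union> R"
    using True unfolding row_step_def bumped_def y_def[symmetric] by auto
  have 2: "sorted_list_of_set (row_step C x) = ?l @ x # ?r"
    unfolding st using lr LR n(2) by (intro sorted_list_of_set_eqI) (fastforce simp: sorted_wrt_append)+
  have "knuth (y # ?r @ [x]) (y # x # ?r)"
    using lr LR n(2) by (intro knuth_smaller_past_increasing) auto
  then have A: "knuth (?l @ y # ?r @ [x]) (?l @ y # x # ?r)" by (rule knuth_appendL)
  have "knuth (?l @ [y, x]) (y # ?l @ [x])"
    using lr LR n(2) by (intro knuth_larger_past_increasing) (auto simp: sorted_wrt_append)
  from knuth_trans[OF A] knuth_appendR[OF this, of ?r]
  have "knuth (?l @ y # ?r @ [x]) (y # ?l @ x # ?r)" by simp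
  then show ?thesis using True unfolding 1 2 by (simp add: bumped_def y_def)
next
  case False
  have "sorted_list_of_set (insert x C) = sorted_list_of_set C @ [x]"
    using False assms by (intro sorted_list_of_set_eqI)
      (auto simp: sorted_wrt_append not_less intro!: le_neq_implies_less)
  then show ?thesis using False by (simp add: bumped_def row_step_def)
qed

lemma knuth_row_out:
  assumes "finite C" "distinct w" "C \<inter> set w = {}"
  shows "knuth (sorted_list_of_set C @ w) (row_bumped C w @ sorted_list_of_set (row_insert C w))"
  using assms
proof (induction w arbitrary: C)
  case (Cons x w)
  have "row_step C x \<inter> set w = {}" using Cons.prems by (auto simp: row_step_def)
  then have "knuth (sorted_list_of_set (row_step C x) @ w) (row_bumped (row_step C x) w @ sorted_list_of_set (row_insert (row_step C x) w))"
    using Cons by simp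
  then have "knuth ((bumped C x @ sorted_list_of_set (row_step C x)) @ w)
     (bumped C x @ row_bumped (row_step C x) w @ sorted_list_of_set (row_insert (row_step C x) w))"
    by (simp add: knuth_appendL)
  moreover have "knuth ((sorted_list_of_set C @ [x]) @ w) ((bumped C x @ sorted_list_of_set (row_step C x)) @ w)"
    using Cons.prems by (intro knuth_appendR knuth_row_out_step) auto
  ultimately show ?case by (auto intro: knuth_trans)
qed simp

lemma bump_at:
  assumes "y \<in> C" "x < y" "\<And>z. z \<in> C \<Longrightarrow> x < z \<Longrightarrow> y \<le> z"
  shows "bumped C x = [y]" "row_step C x = insert x (C - {y})"
proof -
  have "next_above C x = y" using assms by (rule next_above_eqI)
  moreover have "\<exists>y\<in>C. x < y" using assms(1,2) by blast
  ultimately show "bumped C x = [y]" "row_step C x = insert x (C - {y})"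
    by (simp_all add: bumped_def row_step_def)
qed

lemma bump_none:
  assumes "\<And>z. z \<in> C \<Longrightarrow> z \<le> x"
  shows "bumped C x = []" "row_step C x = insert x C"
  using assms by (auto simp: bumped_def row_step_def not_less[symmetric])

lemma bumped_cases:
  obtains "\<And>z. z \<in> C \<Longrightarrow> z \<le> x" "bumped C x = []" "row_step C x = insert x C"
  | y where "y \<in> C" "x < y" "\<And>z. z \<in> C \<Longrightarrow> x < z \<Longrightarrow> y \<le> z" "bumped C x = [y]"
      "row_step C x = insert x (C - {y})"
proof (cases "\<exists>y\<in>C. x < y")
  case True
  show ?thesis
    using that(2)[OF next_above_props[OF True]] True by (simp add: bumped_def row_step_def)
next
  case False
  then have *: "\<And>z. z \<in> C \<Longrightarrow> z \<le> x" by auto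
  show ?thesis using that(1)[OF * bump_none] * by blast
qed

lemma bumped_some:
  assumes "y \<in> C" "x < y"
  obtains y' where "y' \<in> C" "x < y'" "y' \<le> y" "\<And>z. z \<in> C \<Longrightarrow> x < z \<Longrightarrow> y' \<le> z"
    "bumped C x = [y']" "row_step C x = insert x (C - {y'})"
proof (cases rule: bumped_cases[of C x])
  case 1
  then show ?thesis using assms by force
next
  case (2 y')
  then show ?thesis using that[of y'] assms by blast
qed

lemma knuth_triple_row_out_yxz:
  assumes "x < y" "y < z" "C \<inter> {x, y, z} = {}"
  shows "row_insert C [y, x, z] = row_insert C [y, z, x] \<and> knuth (row_bumped C [y, x, z]) (row_bumped C [y, z, x])"
proof -
  define D where "D = row_step C y"
  have yD: "y \<in> D" "x \<notin> D" "z \<notin> D"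
    using assms set_bumped_subset[of C y] by (auto simp: D_def row_step_def)
  obtain x' where x': "x' \<in> D" "x < x'" "\<And>c. c \<in> D \<Longrightarrow> x < c \<Longrightarrow> x' \<le> c"
     "bumped D x = [x']" "row_step D x = insert x (D - {x'})"
    and x'y: "x' \<le> y"
    using bumped_some[OF yD(1) assms(1)] by metis
  show ?thesis
  proof (cases rule: bumped_cases[of D z])
    case 1
    have b1: "bumped (row_step D x) z = []" "row_step (row_step D x) z = insert z (row_step D x)"
      using 1(1) assms by (intro bump_none; auto simp: x'(5))+
    have b2: "bumped (row_step D z) x = [x']" "row_step (row_step D z) x = insert x (row_step D z - {x'})"
      using x'(1-3) 1(3) assms x'y by (intro bump_at; force)+
    have "row_step (row_step D x) z = row_step (row_step D z) x"
      using b1 b2 x'y x'(5) 1(3) assms by auto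
    then show ?thesis using b1 b2 1 x' by (simp add: D_def[symmetric])
  next
    case (2 z')
    have ne: "x' < z'" "x' < z" using 2 assms x'y by auto
    have b1: "bumped (row_step D x) z = [z']" "row_step (row_step D x) z = insert z (row_step D x - {z'})"
      using 2(1-3) assms ne by (intro bump_at; force simp: x'(5))+
    have b2: "bumped (row_step D z) x = [x']" "row_step (row_step D z) x = insert x (row_step D z - {x'})"
      using x'(1-3) assms ne by (intro bump_at; force simp: 2(5))+
    have s: "row_step (row_step D x) z = row_step (row_step D z) x"
      using b1 b2 x'(5) 2(5) 2(2) ne assms by auto
    have z'C: "z' \<in> C" using 2 assms unfolding D_def row_step_def by auto
    obtain y' where y': "y' \<in> C" "y < y'" "\<And>c. c \<in> C \<Longrightarrow> y < c \<Longrightarrow> y' \<le> c" "bumped C y = [y']"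
      "row_step C y = insert y (C - {y'})"
        and "y' \<le> z'"
      using bumped_some[OF z'C less_trans[OF assms(2) 2(2)]] by metis
    have "y' \<noteq> z'" using 2(1) y' 2(2) assms(2) unfolding D_def row_step_def by auto
    then have "knuth [y', x', z'] [y', z', x']"
      using y' x'y \<open>y' \<le> z'\<close> by (intro knuth_yxz) auto
    then show ?thesis using b1 b2 s 2 x' y' by (simp add: D_def[symmetric])
  qed
qed

lemma knuth_triple_row_out_xzy:
  assumes "x < y" "y < z" "C \<inter> {x, y, z} = {}"
  shows "row_insert C [x, z, y] = row_insert C [z, x, y] \<and> knuth (row_bumped C [x, z, y]) (row_bumped C [z, x, y])"
proof (cases rule: bumped_cases[of C x])
  case 1
  have C: "c < x" if "c \<in> C" for c using 1(1)[OF that] assms(3) that by (cases "c = x") auto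
  have a1: "bumped (insert x C) z = []" "row_step (insert x C) z = insert z (insert x C)"
    using C assms by (intro bump_none; force)+
  have a2: "bumped (insert z (insert x C)) y = [z]"
     "row_step (insert z (insert x C)) y = insert y (insert z (insert x C) - {z})"
    using C assms by (intro bump_at; force)+
  have b1: "bumped C z = []" "row_step C z = insert z C"
    using C assms by (intro bump_none; force)+
  have b2: "bumped (insert z C) x = [z]" "row_step (insert z C) x = insert x (insert z C - {z})"
    using C assms by (intro bump_at; force)+
  have z: "insert z C - {z} = C" using assms by auto
  have b3: "bumped (insert x C) y = []" "row_step (insert x C) y = insert y (insert x C)"
    using C assms by (intro bump_none; force)+
  show ?thesis
    using assms by (auto simp: 1(2,3) a1 a2 b1 b2 b3 z)
next
  case (2 x')
  have ne: "x' \<noteq> z" "x' \<noteq> y" using 2 assms by auto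
  show ?thesis
  proof (cases "x' < z")
    case True
    have b2: "bumped (row_step C z) x = [x']" "row_step (row_step C z) x = insert x (row_step C z - {x'})"
    proof -
      have "z = c \<or> c \<in> C" if "c \<in> row_step C z" for c using that by (auto simp: row_step_def)
      then have *: "\<And>c. c \<in> row_step C z \<Longrightarrow> x < c \<Longrightarrow> x' \<le> c" using 2(3) True by force
      have "x' \<in> row_step C z" using 2(1) True
        by (cases rule: bumped_cases[of C z]) auto
      then show "bumped (row_step C z) x = [x']" "row_step (row_step C z) x = insert x (row_step C z - {x'})"
        using 2(2) * by (intro bump_at; force)+
    qed
    show ?thesis
    proof (cases rule: bumped_cases[of C z])
      case z: 1
      have b1: "bumped (row_step C x) z = []" "row_step (row_step C x) z = insert z (row_step C x)"
        using z(1) assms by (intro bump_none; auto simp: 2(5))+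
      have "row_step (row_step C x) z = row_step (row_step C z) x" using b1 b2 2(5) z(3) True by auto
      then show ?thesis using b1 b2 2(4) z(2) by simp
    next
      case z: (2 z')
      have lt: "x' < z'" using z True by auto
      have b1: "bumped (row_step C x) z = [z']" "row_step (row_step C x) z = insert z (row_step C x - {z'})"
        using z(1-3) assms True by (intro bump_at; force simp: 2(5))+
      have s: "row_step (row_step C x) z = row_step (row_step C z) x"
        using b1 b2 2(5) z(5) True lt z(2) assms by auto
      define D where "D = row_step (row_step C x) z"
      have D: "c = z \<or> c = x \<or> c \<in> C \<and> c \<noteq> x' \<and> c \<noteq> z'" if "c \<in> D" for c
        using that b1(2) 2(5) unfolding D_def by auto
      have "z \<in> D" by (simp add: D_def row_step_def)
      then obtain y' where y': "y' \<in> D" "y < y'" "y' \<le> z" "bumped D y = [y']"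
        using bumped_some[of z D y] assms(2) by metis
      have "x' < y'" using D[OF y'(1)] y'(2) 2(3)[of y'] True assms(1) by force
      then have "knuth [x', z', y'] [z', x', y']" using y' z(2) by (intro knuth_xzy) auto
      then show ?thesis using b1 b2 2(4) z(4) y'(4) s by (simp add: D_def)
    qed
  next
    case False
    then have gt: "z < x'" using ne by auto
    define C1 where "C1 = C - {x'}"
    have C1: "c < x \<or> x' < c" if "c \<in> C1" for c
    proof -
      have "c \<noteq> x" "c \<noteq> x'" "c \<in> C" using that assms(3) unfolding C1_def by auto
      then show ?thesis using 2(3)[of c] by linarith
    qed
    have zC: "bumped C z = [x']" "row_step C z = insert z C1"
      unfolding C1_def using 2(1-3) gt assms(1,2) by (intro bump_at; force)+
    have zC1: "z \<notin> C1" using assms unfolding C1_def by auto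
    then have C1z: "insert z C1 - {z} = C1" by simp
    have xz: "bumped (insert z C1) x = [z]" "row_step (insert z C1) x = insert x (insert z C1 - {z})"
      using C1 gt assms by (intro bump_at; force)+
    show ?thesis
    proof (cases rule: bumped_cases[of "insert x C1" z])
      case v: 1
      have le: "c \<le> x" if "c \<in> insert x C1" for c
        using v(1)[OF that] C1[of c] that gt by auto
      have le3: "c \<le> y" if "c \<in> insert x C1" for c
        using le[OF that] assms(1) by simp
      have le2: "z \<le> c" if "c \<in> insert z (insert x C1)" "y < c" for c
        using that le[of c] assms(1) by auto
      have a: "bumped (insert z (insert x C1)) y = [z]"
         "row_step (insert z (insert x C1)) y = insert y (insert z (insert x C1) - {z})"
        using assms(2) le2 by (intro bump_at; blast)+
      have b: "bumped (insert x C1) y = []" "row_step (insert x C1) y = insert y (insert x C1)"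
        by (rule bump_none, erule le3)+
      have "insert z (insert x C1) - {z} = insert x C1" using zC1 assms by auto
      then show ?thesis
        by (simp add: 2(4,5) C1_def[symmetric] zC xz v(2,3) a b C1z)
    next
      case v: (2 v)
      have vC1: "v \<in> C1" "x' < v" using v(1,2) C1[of v] assms by auto
      have a: "bumped (insert z (insert x C1 - {v})) y = [z]"
         "row_step (insert z (insert x C1 - {v})) y = insert y (insert z (insert x C1 - {v}) - {z})"
        using v(1-3) assms C1 gt by (intro bump_at; force)+
      have b: "bumped (insert x C1) y = [v]" "row_step (insert x C1) y = insert y (insert x C1 - {v})"
        using v(1-3) assms C1 gt by (intro bump_at; force)+
      have "knuth [x', v, z] [x', z, v]" using gt vC1 by (intro knuth_sym[OF knuth_yxz])
      moreover have "insert z (insert x C1 - {v}) - {z} = insert x C1 - {v}" using zC1 assms by auto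
      ultimately show ?thesis
        by (simp add: 2(4,5) C1_def[symmetric] zC xz v(4,5) a b C1z)
    qed
  qed
qed

lemma knuth_row_out_cong:
  assumes "knuth v w" "finite C" "distinct v" "C \<inter> set v = {}"
  shows "row_insert C v = row_insert C w \<and> knuth (row_bumped C v) (row_bumped C w)"
  using assms
proof (induction arbitrary: C rule: knuth.induct)
  case (knuth_sym v w)
  then show ?case using knuth_distinct knuth_set by (metis knuth.knuth_sym)
next
  case (knuth_trans u v w)
  then show ?case using knuth_distinct knuth_set by (metis knuth.knuth_trans)
next
  case (knuth_append u u' v v')
  have "row_insert C u \<inter> set v = {}"
    using row_out_sets(1)[of C u] knuth_append.prems by auto
  then have "row_insert (row_insert C u) v = row_insert (row_insert C u) v' \<and> knuth (row_bumped (row_insert C u) v) (row_bumped (row_insert C u) v')"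
    using knuth_append.prems finite_row by (intro knuth_append.IH) auto
  moreover have "row_insert C u = row_insert C u' \<and> knuth (row_bumped C u) (row_bumped C u')"
    using knuth_append.prems by (intro knuth_append.IH) auto
  ultimately show ?case by (simp add: row_append out_append knuth.knuth_append)
next
  case (knuth_xzy x y z)
  then show ?case by (intro knuth_triple_row_out_xzy) auto
next
  case (knuth_yxz x y z)
  then show ?case by (intro knuth_triple_row_out_yxz) auto
qed simp


section \<open>Insertion and recording tableaux\<close>

fun bumped_pairs :: "nat set \<Rightarrow> (nat \<times> nat) list \<Rightarrow> (nat \<times> nat) list" where
  "bumped_pairs C [] = []"
| "bumped_pairs C (b # w) = map (Pair (fst b)) (bumped C (snd b)) @ bumped_pairs (row_step C (snd b)) w"

fun new_labels :: "nat set \<Rightarrow> (nat \<times> nat) list \<Rightarrow> nat set" where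
  "new_labels C [] = {}"
| "new_labels C (b # w) = (if bumped C (snd b) = [] then {fst b} else {}) \<union> new_labels (row_step C (snd b)) w"

text \<open>A biword lists pairs of a label (the time of insertion) and an inserted letter.\<close>

definition biword :: "(nat \<times> nat) list \<Rightarrow> bool" where
  "biword b \<longleftrightarrow> sorted_wrt (<) (map fst b) \<and> distinct (map snd b)"

lemma map_snd_bumped_pairs: "map snd (bumped_pairs C w) = row_bumped C (map snd w)"
  by (induction C w rule: bumped_pairs.induct) (auto simp: comp_def)

lemma bumped_pairs_append: "bumped_pairs C (u @ v) = bumped_pairs C u @ bumped_pairs (row_insert C (map snd u)) v"
  by (induction C u rule: bumped_pairs.induct) auto

lemma new_labels_append: "new_labels C (u @ v) = new_labels C u \<union> new_labels (row_insert C (map snd u)) v"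
  by (induction C u rule: bumped_pairs.induct) auto

lemma fst_bumped_pairs: "fst ` set (bumped_pairs C w) \<subseteq> fst ` set w"
  by (induction C w rule: bumped_pairs.induct) auto

lemma new_labels_subset: "new_labels C w \<subseteq> fst ` set w"
  by (induction C w rule: bumped_pairs.induct) auto

lemma fst_bumped_pairs_new_labels: "fst ` set (bumped_pairs C w) \<union> new_labels C w = fst ` set w"
proof (induction C w rule: bumped_pairs.induct)
  case (2 C b w)
  have "fst ` set (map (Pair (fst b)) (bumped C (snd b))) = (if bumped C (snd b) = [] then {} else {fst b})"
    by (auto simp: bumped_def)
  then show ?case using 2 by (auto simp: image_Un simp del: set_map)
qed simp

lemma finite_new_labels [simp]: "finite (new_labels C w)"
  by (induction C w rule: bumped_pairs.induct) auto

lemma sorted_fst_bumped_pairs: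
  assumes "sorted_wrt (<) (map fst w)"
  shows "sorted_wrt (<) (map fst (bumped_pairs C w))"
  using assms
proof (induction C w rule: bumped_pairs.induct)
  case (2 C b w)
  have l: "fst b < p" if "p \<in> fst ` set (bumped_pairs (row_step C (snd b)) w)" for p
    using subsetD[OF fst_bumped_pairs that] 2(2) by auto
  have "sorted_wrt (<) (map fst (bumped_pairs (row_step C (snd b)) w))" using 2 by simp
  moreover have "bumped C (snd b) = [] \<or> (\<exists>y. bumped C (snd b) = [y])" by (simp add: bumped_def)
  ultimately show ?case using l by auto
qed simp

lemma biword_distinct_fst: "biword b \<Longrightarrow> distinct (map fst b)"
  by (auto simp: biword_def strict_sorted_iff)

lemma biword_bumped_pairs: "biword b \<Longrightarrow> biword (bumped_pairs {} b)"
  unfolding biword_def map_snd_bumped_pairs by (auto intro: sorted_fst_bumped_pairs row_out_sets(3))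

lemma card_row_step:
  assumes "finite C" "x \<notin> C"
  shows "card (row_step C x) = card C + (if bumped C x = [] then 1 else 0)"
proof -
  have "card (row_step C x) + length (bumped C x) = Suc (card C)"
    using arg_cong[OF step_bumped_mset[OF assms], of size] assms by simp
  moreover have "length (bumped C x) = (if bumped C x = [] then 0 else 1)"
    by (simp add: bumped_def)
  ultimately show ?thesis by (auto split: if_splits)
qed

lemma card_row_new_labels:
  assumes "finite C" "distinct (map snd w)" "C \<inter> snd ` set w = {}" "distinct (map fst w)"
  shows "card (row_insert C (map snd w)) = card C + card (new_labels C w)"
  using assms
proof (induction C w rule: bumped_pairs.induct)
  case (2 C b w)
  have "row_step C (snd b) \<inter> snd ` set w = {}" using 2(2-) by (auto simp: row_step_def)
  then have IH: "card (row_insert (row_step C (snd b)) (map snd w)) = card (row_step C (snd b)) + card (new_labels (row_step C (snd b)) w)"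
    using 2 by simp
  have "fst b \<notin> new_labels (row_step C (snd b)) w" using 2(5) new_labels_subset[of "row_step C (snd b)" w] by auto
  then show ?case using IH card_row_step[of C "snd b"] 2(2-) by auto
qed simp

lemma bumped_insert_max:
  assumes "x < M" "\<And>c. c \<in> C \<Longrightarrow> c < M"
  shows "bumped (insert M C) x = (if bumped C x = [] then [M] else bumped C x)"
    "row_step (insert M C) x = (if bumped C x = [] then row_step C x else insert M (row_step C x))"
proof -
  have "bumped (insert M C) x = (if bumped C x = [] then [M] else bumped C x) \<and>
    row_step (insert M C) x = (if bumped C x = [] then row_step C x else insert M (row_step C x))"
  proof (cases rule: bumped_cases[of C x])
    case 1
    have "M \<notin> C" using assms(2) by blast
    have *: "M \<le> z" if "z \<in> insert M C" "x < z" for z using that 1(1)[of z] by auto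
    have "bumped (insert M C) x = [M]" "row_step (insert M C) x = insert x (insert M C - {M})"
      using assms(1) * by (intro bump_at; blast)+
    then show ?thesis using 1 \<open>M \<notin> C\<close> by simp
  next
    case (2 y)
    have *: "y \<le> z" if "z \<in> insert M C" "x < z" for z using that 2(3)[of z] assms(2)[OF 2(1)] by auto
    have "bumped (insert M C) x = [y]" "row_step (insert M C) x = insert x (insert M C - {y})"
      using 2(1,2) * by (intro bump_at; blast)+
    then show ?thesis using 2(4,5) assms(2)[OF 2(1)] by auto
  qed
  then show "bumped (insert M C) x = (if bumped C x = [] then [M] else bumped C x)"
    "row_step (insert M C) x = (if bumped C x = [] then row_step C x else insert M (row_step C x))" by auto
qed

lemma insert_max_bumped_pairs_new_labels:
  assumes "\<And>c. c \<in> C \<union> snd ` set w \<Longrightarrow> c < M" "sorted_wrt (<) (map fst w)"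
    "\<And>q. q \<in> fst ` set w \<Longrightarrow> p < q"
  shows "new_labels (insert M C) w = new_labels C w - set (bumped (new_labels C w) p) \<and>
    set (bumped_pairs (insert M C) w) = set (bumped_pairs C w) \<union> (\<lambda>q. (q, M)) ` set (bumped (new_labels C w) p)"
  using assms
proof (induction w arbitrary: C)
  case (Cons b w)
  define x where "x = snd b"
  have xM: "x < M" "\<And>c. c \<in> C \<Longrightarrow> c < M" using Cons.prems(1) by (auto simp: x_def)
  note ins = bumped_insert_max[OF xM]
  have lt: "fst b < q" if "q \<in> new_labels (row_step C x) w" for q
    using that Cons.prems(2) new_labels_subset[of "row_step C x" w] by auto
  have "\<And>c. c \<in> row_step C x \<union> snd ` set w \<Longrightarrow> c < M"
    using Cons.prems(1) unfolding x_def row_step_def by auto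
  note IH = Cons.IH[OF this]
  show ?case
  proof (cases "bumped C x = []")
    case True
    then have bqC: "new_labels C (b # w) = insert (fst b) (new_labels (row_step C x) w)" by (simp add: x_def)
    have "bumped (new_labels C (b # w)) p = [fst b]"
      using lt Cons.prems(3) unfolding bqC by (intro bump_at(1)) (auto simp: less_imp_le)
    moreover have "fst b \<notin> new_labels (row_step C x) w" using lt by blast
    ultimately show ?thesis using True ins bqC by (auto simp: x_def)
  next
    case False
    then have "new_labels C (b # w) = new_labels (row_step C x) w" by (simp add: x_def)
    moreover have "new_labels (insert M (row_step C x)) w = new_labels (row_step C x) w - set (bumped (new_labels (row_step C x) w) p) \<and>
    set (bumped_pairs (insert M (row_step C x)) w) =
      set (bumped_pairs (row_step C x) w) \<union> (\<lambda>q. (q, M)) ` set (bumped (new_labels (row_step C x) w) p)"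
      using Cons.prems by (intro IH) auto
    ultimately show ?thesis using False ins by (auto simp: x_def)
  qed
qed (simp add: bumped_def)

lemma bumped_Un_smaller:
  assumes "\<And>c. c \<in> A \<Longrightarrow> c < p"
  shows "bumped (A \<union> B) p = bumped B p"
proof (cases rule: bumped_cases[of B p])
  case 1
  have "c \<le> p" if "c \<in> A \<union> B" for c using that assms[of c] 1(1)[of c] by auto
  then show ?thesis using 1(2) bump_none(1) by metis
next
  case (2 y)
  then show ?thesis using assms by (auto intro!: bump_at(1) dest: less_asym)
qed

text \<open>A largest letter sits at the end of the row until the next letter that would have extended the row
bumps it. So adding a largest letter with label \<open>p\<close> row-inserts \<open>p\<close> into the set of labels of the row.
Hence inverting the biword interchanges insertion and recording tableaux.\<close>

lemma insert_max_letter: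
  assumes "biword (u @ (p, M) # v)" "\<And>c. c \<in> snd ` set (u @ v) \<Longrightarrow> c < M"
  shows "new_labels {} (u @ (p, M) # v) = row_step (new_labels {} (u @ v)) p"
    "set (bumped_pairs {} (u @ (p, M) # v)) =
      set (bumped_pairs {} (u @ v)) \<union> (\<lambda>q. (q, M)) ` set (bumped (new_labels {} (u @ v)) p)"
proof -
  define C where "C = row_insert {} (map snd u)"
  have "distinct (map snd u)" using assms by (simp add: biword_def)
  then have CU: "C \<subseteq> snd ` set u" using row_out_sets(1)[of "{}" "map snd u"] unfolding C_def by auto
  have CM: "\<And>c. c \<in> C \<Longrightarrow> c < M" using CU assms(2) by auto
  have b: "bumped C M = []" "row_step C M = insert M C"
    using CM by (intro bump_none; simp add: less_imp_le)+
  have s: "sorted_wrt (<) (map fst v)" "\<And>q. q \<in> fst ` set v \<Longrightarrow> p < q" "\<And>q. q \<in> fst ` set u \<Longrightarrow> q < p"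
    using assms(1) by (auto simp: biword_def sorted_wrt_append)
  have "\<And>c. c \<in> C \<union> snd ` set v \<Longrightarrow> c < M" using CM assms(2) by auto
  note main = insert_max_bumped_pairs_new_labels[OF this s(1,2)]
  have bu: "bumped (new_labels {} (u @ v)) p = bumped (new_labels C v) p"
    unfolding new_labels_append C_def[symmetric]
    by (rule bumped_Un_smaller) (rule s(3)[OF subsetD[OF new_labels_subset]])
  have "q \<notin> new_labels {} u" if "q \<in> set (bumped (new_labels C v) p)" for q
  proof -
    have "q \<in> new_labels C v" using that set_bumped_subset by blast
    then have "p < q" by (rule s(2)[OF subsetD[OF new_labels_subset]])
    then show ?thesis using s(3)[OF subsetD[OF new_labels_subset]] less_asym by metis
  qed
  then show "new_labels {} (u @ (p, M) # v) = row_step (new_labels {} (u @ v)) p"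
    using main b bu by (auto simp: new_labels_append C_def[symmetric] row_step_def)
  show "set (bumped_pairs {} (u @ (p, M) # v)) =
      set (bumped_pairs {} (u @ v)) \<union> (\<lambda>q. (q, M)) ` set (bumped (new_labels {} (u @ v)) p)"
    using main b bu by (auto simp: bumped_pairs_append C_def[symmetric])
qed

definition inverse_biwords :: "(nat \<times> nat) list \<Rightarrow> (nat \<times> nat) list \<Rightarrow> bool" where
  "inverse_biwords b c \<longleftrightarrow> biword b \<and> biword c \<and> set c = prod.swap ` set b"

lemma inverse_row_stage:
  assumes "inverse_biwords b c"
  shows "new_labels {} b = row_insert {} (map snd c) \<and> inverse_biwords (bumped_pairs {} b) (bumped_pairs {} c)"
proof -
  have "new_labels {} b = row_insert {} (map snd c) \<and> set (bumped_pairs {} c) = prod.swap ` set (bumped_pairs {} b)"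
    if "biword b" "biword c" "set c = prod.swap ` set b" for b c
    using that
  proof (induction c arbitrary: b rule: rev_induct)
    case (snoc m c)
    obtain M p where m: "m = (M, p)" by (cases m)
    have "(p, M) \<in> set b" using snoc.prems(3) m by (force simp: image_iff)
    then obtain u v where b: "b = u @ (p, M) # v" by (meson split_list)
    have "p \<notin> fst ` set (u @ v)"
      using biword_distinct_fst[OF snoc.prems(1)] unfolding b by auto
    then have d: "(p, M) \<notin> set (u @ v)" by (metis fst_conv imageI)
    have "fst m \<notin> fst ` set c" using biword_distinct_fst[OF snoc.prems(2)] by auto
    then have mc: "m \<notin> set c" by blast
    have c: "set c = prod.swap ` set (u @ v)"
    proof -
      have "set c = insert m (set c) - {m}" using mc by auto
      also have "insert m (set c) = insert m (prod.swap ` set (u @ v))"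
        using snoc.prems(3) m b by simp
      also have "\<dots> - {m} = prod.swap ` set (u @ v)" using d m by force
      finally show ?thesis .
    qed
    have "c' < M" if "c' \<in> snd ` set (u @ v)" for c'
    proof -
      from that have "c' \<in> fst ` set c" unfolding c by (auto simp: image_iff)
      then show ?thesis using snoc.prems(2) m by (auto simp: biword_def sorted_wrt_append)
    qed
    note M = insert_max_letter[OF snoc.prems(1)[unfolded b] this]
    have "biword (u @ v)" "biword c" using snoc.prems(1,2) b
      by (auto simp: biword_def sorted_wrt_append)
    from snoc.IH[OF this c] M
    show ?case unfolding b m
      by (auto simp: row_append bumped_pairs_append image_Un image_image)
  qed simp
  then show ?thesis using assms biword_bumped_pairs unfolding inverse_biwords_def by blast
qed

lemma inverse_biword_exists:
  assumes "biword b"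
  obtains c where "inverse_biwords b c"
proof
  let ?c = "sort_key fst (map prod.swap b)"
  have "mset (map fst ?c) = mset (map snd b)" "mset (map snd ?c) = mset (map fst b)"
    by (simp_all add: image_mset.compositionality comp_def)
  then have d: "distinct (map fst ?c)" "distinct (map snd ?c)"
    using assms biword_distinct_fst[OF assms] mset_eq_imp_distinct_iff unfolding biword_def by metis+
  then have "sorted_wrt (<) (map fst ?c)" using d by (simp add: strict_sorted_iff)
  then show "inverse_biwords b ?c" using assms d by (simp add: inverse_biwords_def biword_def)
qed

lemma inverse_biwords_append_filter:
  assumes "inverse_biwords (u @ v) c" "\<And>p. p \<in> fst ` set u \<Longrightarrow> p < m" "\<And>p. p \<in> fst ` set v \<Longrightarrow> m \<le> p"
  shows "inverse_biwords v (filter (\<lambda>e. m \<le> snd e) c)"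
proof -
  have "biword v" using assms(1) by (auto simp: inverse_biwords_def biword_def sorted_wrt_append)
  moreover have "biword (filter (\<lambda>e. m \<le> snd e) c)"
    using assms(1) by (auto simp: inverse_biwords_def biword_def distinct_map_filter sorted_wrt_map
      intro: sorted_wrt_filter)
  moreover have "set (filter (\<lambda>e. m \<le> snd e) c) = prod.swap ` set v"
  proof -
    have "set c = prod.swap ` set u \<union> prod.swap ` set v"
      using assms(1) by (auto simp: inverse_biwords_def)
    then show ?thesis using assms(2,3) by (force simp: image_iff)
  qed
  ultimately show ?thesis by (simp add: inverse_biwords_def)
qed

fun ins_rows :: "nat list \<Rightarrow> nat \<Rightarrow> nat set" where
  "ins_rows w 0 = row_insert {} w"
| "ins_rows w (Suc i) = ins_rows (row_bumped {} w) i"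

fun rec_rows :: "(nat \<times> nat) list \<Rightarrow> nat \<Rightarrow> nat set" where
  "rec_rows b 0 = new_labels {} b"
| "rec_rows b (Suc i) = rec_rows (bumped_pairs {} b) i"

lemma rec_rows_eq_ins_rows_inverse:
  assumes "inverse_biwords b c"
  shows "rec_rows b = ins_rows (map snd c)"
proof
  fix i show "rec_rows b i = ins_rows (map snd c) i"
    using assms
  proof (induction i arbitrary: b c)
    case (Suc i)
    from Suc.IH[of "bumped_pairs {} b" "bumped_pairs {} c"] inverse_row_stage[OF Suc.prems]
    show ?case by (simp add: map_snd_bumped_pairs)
  qed (simp add: inverse_row_stage)
qed

lemma ins_rows_knuth:
  assumes "knuth v w" "distinct v"
  shows "ins_rows v = ins_rows w"
proof
  fix i show "ins_rows v i = ins_rows w i"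
    using assms
  proof (induction i arbitrary: v w)
    case 0
    then show ?case using knuth_row_out_cong[of v w "{}"] by simp
  next
    case (Suc i)
    from knuth_row_out_cong[of v w "{}"] Suc.prems row_out_sets(3)[of "{}" v]
    show ?case using Suc.IH[of "row_bumped {} v" "row_bumped {} w"] by simp
  qed
qed

lemma card_rec_rows:
  assumes "biword b"
  shows "card (rec_rows b i) = card (ins_rows (map snd b) i)"
  using assms
proof (induction i arbitrary: b)
  case 0
  then show ?case using card_row_new_labels[of "{}" b] biword_distinct_fst[of b] by (simp add: biword_def)
next
  case (Suc i)
  then show ?case using biword_bumped_pairs[of b] by (simp add: map_snd_bumped_pairs[symmetric] del: map_snd_bumped_pairs)
qed

lemma rec_rows_append:
  assumes "\<And>p. p \<in> fst ` set u \<Longrightarrow> p < m" "\<And>p. p \<in> fst ` set v \<Longrightarrow> m \<le> p"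
  shows "rec_rows (u @ v) i \<inter> {..<m} = rec_rows u i"
proof -
  have "rec_rows (bumped_pairs {} u @ v) i \<inter> {..<m} = rec_rows (bumped_pairs {} u) i \<Longrightarrow> True" for i by simp
  show ?thesis using assms
  proof (induction i arbitrary: u v)
    case 0
    have "new_labels {} u \<subseteq> {..<m}" "new_labels (row_insert {} (map snd u)) v \<inter> {..<m} = {}"
      using 0 new_labels_subset[of "{}" u] new_labels_subset[of "row_insert {} (map snd u)" v] by fastforce+
    then show ?case by (auto simp: new_labels_append)
  next
    case (Suc i)
    have "rec_rows (bumped_pairs {} u @ bumped_pairs (row_insert {} (map snd u)) v) i \<inter> {..<m} = rec_rows (bumped_pairs {} u) i"
      by (rule Suc.IH) (rule Suc.prems, erule subsetD[OF fst_bumped_pairs])+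
    then show ?case by (simp add: bumped_pairs_append)
  qed
qed


section \<open>Reverse bumping\<close>

definition count_below :: "nat set \<Rightarrow> nat \<Rightarrow> nat" where
  "count_below S a = card {c \<in> S. c < a}"

text \<open>A standard tableau is represented by the sets of its row entries. For disjoint rows, the counting
condition says that the columns increase.\<close>

definition tableau :: "(nat \<Rightarrow> nat set) \<Rightarrow> bool" where
  "tableau R \<longleftrightarrow> (\<forall>i. finite (R i)) \<and> (\<forall>i j. i \<noteq> j \<longrightarrow> R i \<inter> R j = {}) \<and>
     (\<forall>i a. count_below (R (Suc i)) a \<le> count_below (R i) a)"

lemma count_below_mono: "finite S \<Longrightarrow> T \<subseteq> S \<Longrightarrow> count_below T a \<le> count_below S a"
  unfolding count_below_def by (intro card_mono) auto

lemma count_below_insert: "finite S \<Longrightarrow> x \<notin> S \<Longrightarrow> count_below (insert x S) a = count_below S a + (if x < a then 1 else 0)"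
proof -
  assume a: "finite S" "x \<notin> S"
  have "{c \<in> insert x S. c < a} = (if x < a then insert x {c \<in> S. c < a} else {c \<in> S. c < a})" by auto
  then show ?thesis using a by (simp add: count_below_def)
qed

lemma count_below_remove_eq: "finite S \<Longrightarrow> x \<in> S \<Longrightarrow> count_below S a = count_below (S - {x}) a + (if x < a then 1 else 0)"
  using count_below_insert[of "S - {x}" x a] by (simp add: insert_absorb)

lemma count_below_le_card: "finite S \<Longrightarrow> count_below S a \<le> card S"
  unfolding count_below_def by (intro card_mono) auto

lemma count_below_eq_card: "(\<And>c. c \<in> S \<Longrightarrow> c < a) \<Longrightarrow> count_below S a = card S"
  unfolding count_below_def by (intro arg_cong[of _ _ card]) auto

lemma count_below_gap: "(\<And>c. c \<in> S \<Longrightarrow> a \<le> c \<Longrightarrow> c < b \<Longrightarrow> False) \<Longrightarrow> a \<le> b \<Longrightarrow> count_below S b = count_below S a"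
  unfolding count_below_def by (intro arg_cong[of _ _ card]) (auto simp: not_le[symmetric])

lemma row_dominates:
  assumes "distinct w"
  shows "count_below (row_insert {} (row_bumped {} w)) a \<le> count_below (row_insert {} w) a"
  using assms
proof (induction w arbitrary: a rule: rev_induct)
  case (snoc x w)
  define C where "C = row_insert {} w"
  define D where "D = row_insert {} (row_bumped {} w)"
  have fin: "finite C" "finite D" by (simp_all add: C_def D_def finite_row)
  have sets: "C \<union> set (row_bumped {} w) = set w" "C \<inter> set (row_bumped {} w) = {}" "distinct (row_bumped {} w)"
    using row_out_sets[of "{}" w] snoc.prems by (simp_all add: C_def)
  have DS: "D \<subseteq> set (row_bumped {} w)" using row_out_sets(1)[of "{}" "row_bumped {} w"] sets by (auto simp: D_def)
  have xC: "x \<notin> C" using sets snoc.prems by auto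
  have IH: "count_below D a \<le> count_below C a" for a using snoc by (simp add: C_def D_def)
  have r: "row_insert {} (w @ [x]) = row_step C x" "row_bumped {} (w @ [x]) = row_bumped {} w @ bumped C x"
    by (simp_all add: row_append out_append C_def)
  show ?case
  proof (cases rule: bumped_cases[of C x])
    case 1
    then show ?thesis using IH[of a] count_below_insert[OF fin(1) xC, of a] by (simp add: r(2) row_append D_def[symmetric] C_def[symmetric])
  next
    case (2 y)
    have yD: "y \<notin> D" using 2(1) sets DS by auto
    have xCy: "x \<notin> C - {y}" using xC by auto
    have C': "count_below (row_step C x) a = count_below (C - {y}) a + (if x < a then 1 else 0)"
      unfolding 2(5) using fin xCy by (intro count_below_insert) auto
    have C: "count_below C a = count_below (C - {y}) a + (if y < a then 1 else 0)"
      using fin 2 by (intro count_below_remove_eq)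
    have "count_below (row_step D y) a \<le> count_below (row_step C x) a"
    proof (cases "y < a \<and> (\<forall>d\<in>D. y \<le> d \<longrightarrow> a \<le> d)")
      case True
      have "count_below D a = count_below D y" using True by (intro count_below_gap) force+
      also have "\<dots> \<le> count_below C y" by (rule IH)
      also have "\<dots> = count_below (C - {y}) y" using count_below_remove_eq[OF fin(1) 2(1), of y] by simp
      also have "\<dots> \<le> count_below (C - {y}) a" unfolding count_below_def using fin True by (intro card_mono) auto
      finally have le: "count_below D a + 1 \<le> count_below (row_step C x) a" using C' True 2(2) by simp
      have "count_below (row_step D y) a \<le> count_below (insert y D) a"
        using fin by (intro count_below_mono) (auto simp: row_step_def)
      also have "\<dots> \<le> count_below D a + 1" using count_below_insert[OF fin(2) yD, of a] by simp
      finally show ?thesis using le by simp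
    next
      case False
      have "count_below (row_step D y) a \<le> count_below D a"
      proof (cases "y < a")
        case True
        then obtain d where d: "d \<in> D" "y \<le> d" "d < a" using False by (auto simp: not_le)
        then have "y < d" using yD by (metis le_neq_implies_less)
        from bumped_some[OF d(1) this] obtain y' where
          y': "y' \<in> D" "y' \<le> d" "row_step D y = insert y (D - {y'})" by metis
        have "count_below (row_step D y) a = count_below (D - {y'}) a + 1"
          unfolding y'(3) using count_below_insert[of "D - {y'}" y a] fin yD True by simp
        also have "\<dots> = count_below D a" using count_below_remove_eq[OF fin(2) y'(1), of a] y' d by simp
        finally show ?thesis by simp
      next
        case False
        then show ?thesis unfolding count_below_def using fin by (intro card_mono) (auto simp: row_step_def)
      qed
      also have "\<dots> \<le> count_below C a" by (rule IH)
      also have "\<dots> \<le> count_below (row_step C x) a" using C C' 2(2) by auto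
      finally show ?thesis .
    qed
    then show ?thesis using 2(4) by (simp add: r(2) row_append D_def[symmetric] C_def[symmetric])
  qed
qed simp

lemma length_out:
  assumes "distinct w" "w \<noteq> []"
  shows "length (row_bumped {} w) < length w"
proof -
  have e: "card (row_insert {} w) + length (row_bumped {} w) = length w"
    using arg_cong[OF row_out_mset[of "{}" w], of size] assms by simp
  have "row_insert C w \<noteq> {}" if "w \<noteq> []" for C and w :: "nat list"
    using that by (induction w rule: rev_induct) (auto simp: row_append row_step_def)
  then have "card (row_insert {} w) > 0" using assms finite_row[of "{}" w] by (simp add: card_gt_0_iff)
  then show ?thesis using e by simp
qed

lemma ins_rows_empty [simp]: "ins_rows [] i = {}"
  by (induction i) auto

lemma rec_rows_empty [simp]: "rec_rows [] i = {}"
  by (induction i) auto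

lemma ins_rows_Suc: "ins_rows w \<circ> Suc = ins_rows (row_bumped {} w)"
  by auto

lemma UN_Suc_split: "(\<Union>i. F i) = F 0 \<union> (\<Union>i. F (Suc i))"
  by (auto, metis not0_implies_Suc)

lemma ins_rows_Union:
  assumes "distinct w"
  shows "(\<Union>i. ins_rows w i) = set w"
  using assms
proof (induction "length w" arbitrary: w rule: less_induct)
  case less
  show ?case
  proof (cases "w = []")
    case False
    have U: "(\<Union>i. ins_rows w i) = ins_rows w 0 \<union> (\<Union>i. ins_rows w (Suc i))"
      by (rule UN_Suc_split)
    have "(\<Union>i. ins_rows (row_bumped {} w) i) = set (row_bumped {} w)"
      using less row_out_sets(3)[of "{}" w] length_out[OF less.prems False] by simp
    then show ?thesis using U row_out_sets(1)[of "{}" w] less.prems by simp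
  qed simp
qed

lemma ins_rows_subset: "distinct w \<Longrightarrow> ins_rows w i \<subseteq> set w"
  using ins_rows_Union by blast

lemma finite_ins_rows: "finite (ins_rows w i)"
  by (induction i arbitrary: w) (auto simp: finite_row)

lemma ins_rows_disjoint:
  assumes "distinct w" "i < j"
  shows "ins_rows w i \<inter> ins_rows w j = {}"
  using assms
proof (induction i arbitrary: w j)
  case 0
  then obtain k where "j = Suc k" by (cases j) auto
  then show ?case using ins_rows_subset[of "row_bumped {} w" k] row_out_sets[of "{}" w] 0 by auto
next
  case (Suc i)
  then obtain k where "j = Suc k" by (cases j) auto
  then show ?case using Suc row_out_sets(3)[of "{}" w] by simp
qed

lemma tableau_ins_rows:
  assumes "distinct w"
  shows "tableau (ins_rows w)"
  unfolding tableau_def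
proof (intro conjI allI impI)
  show "finite (ins_rows w i)" for i by (rule finite_ins_rows)
  show "ins_rows w i \<inter> ins_rows w j = {}" if "i \<noteq> j" for i j
    using ins_rows_disjoint[OF assms, of i j] ins_rows_disjoint[OF assms, of j i] that by (cases "i < j") auto
  show "count_below (ins_rows w (Suc i)) a \<le> count_below (ins_rows w i) a" for i a
    using assms
  proof (induction i arbitrary: w)
    case 0
    then show ?case by (simp add: row_dominates)
  next
    case (Suc i)
    from Suc.IH[of "row_bumped {} w"] Suc.prems row_out_sets(3)[of "{}" w] show ?case by simp
  qed
qed

definition row_word :: "nat \<Rightarrow> (nat \<Rightarrow> nat set) \<Rightarrow> nat list" where
  "row_word n R = concat (map (\<lambda>i. sorted_list_of_set (R i)) (rev [0..<n]))"

lemma row_word_Suc: "row_word (Suc n) R = row_word n (R \<circ> Suc) @ sorted_list_of_set (R 0)"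
proof -
  have "rev [0..<Suc n] = map Suc (rev [0..<n]) @ [0]"
    by (simp add: rev_map[symmetric] map_Suc_upt upt_conv_Cons del: upt_Suc)
  then show ?thesis by (simp add: row_word_def comp_def del: upt_Suc)
qed

lemma row_word_Suc_last: "row_word (Suc n) R = sorted_list_of_set (R n) @ row_word n R"
  by (simp add: row_word_def)

lemma knuth_row_word_ins_rows:
  assumes "distinct w" "\<And>i. n \<le> i \<Longrightarrow> ins_rows w i = {}"
  shows "knuth w (row_word n (ins_rows w))"
  using assms
proof (induction n arbitrary: w)
  case 0
  then show ?case using ins_rows_Union[of w] by (simp add: row_word_def)
next
  case (Suc n)
  have d: "distinct (row_bumped {} w)" using row_out_sets(3)[of "{}" w] Suc.prems by simp
  have "ins_rows (row_bumped {} w) i = {}" if "n \<le> i" for i using Suc.prems(2)[of "Suc i"] that by simp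
  then have "knuth (row_bumped {} w) (row_word n (ins_rows (row_bumped {} w)))" using Suc.IH d by blast
  moreover have "knuth w (row_bumped {} w @ sorted_list_of_set (row_insert {} w))"
    using knuth_row_out[of "{}" w] Suc.prems by simp
  ultimately show ?case unfolding row_word_Suc ins_rows_Suc by (simp add: knuth_appendR knuth_trans)
qed

lemma set_row_word:
  assumes "\<And>i. finite (R i)"
  shows "set (row_word n R) = (\<Union>i<n. R i)"
  using assms by (auto simp: row_word_def atLeast0LessThan)

lemma distinct_row_word:
  assumes "tableau R"
  shows "distinct (row_word n R)"
proof (induction n)
  case (Suc n)
  have "finite (R i)" "i < n \<Longrightarrow> R n \<inter> R i = {}" for i using assms by (auto simp: tableau_def)
  then have "R n \<inter> (\<Union>i<n. R i) = {}" "finite (R n)" "set (row_word n R) = (\<Union>i<n. R i)"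
    by (auto simp: set_row_word)
  then show ?case using Suc unfolding row_word_Suc_last by simp
qed (simp add: row_word_def)

lemma ins_rows_eq_empty: "distinct w \<Longrightarrow> length w \<le> i \<Longrightarrow> ins_rows w i = {}"
proof (induction i arbitrary: w)
  case (Suc i)
  show ?case
  proof (cases "w = []")
    case False
    then show ?thesis using Suc length_out[of w] row_out_sets(3)[of "{}" w] by simp
  qed simp
qed auto

text \<open>The last conclusion is stated for all \<open>b\<close> so that the induction on \<open>r\<close> can be applied to the word
bumped out of the first row.\<close>

lemma reverse_bump:
  assumes "tableau T" "card (T (Suc r)) < card (T r)"
  shows "\<exists>T' x. tableau T' \<and> x \<in> T 0 \<and> (\<Union>i. T' i) = (\<Union>i. T i) - {x} \<and> (\<forall>a. count_below (T' 0) a \<le> count_below (T 0) a) \<and>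
    (\<forall>i. card (T' i) = card (T i) - (if i = r then 1 else 0)) \<and>
    (\<forall>(b :: (nat \<times> nat) list) p. ins_rows (map snd b) = T' \<longrightarrow> ins_rows (map snd b @ [x]) = T \<and>
       rec_rows (b @ [(p, x)]) = (rec_rows b)(r := insert p (rec_rows b r)))"
  using assms
proof (induction r arbitrary: T)
  case 0
  define x where "x = Max (T 0)"
  define T' where "T' = T(0 := T 0 - {x})"
  have fin: "finite (T i)" for i using 0 by (auto simp: tableau_def)
  have "T 0 \<noteq> {}" using 0 by auto
  then have x: "x \<in> T 0" "\<And>c. c \<in> T 0 \<Longrightarrow> c \<le> x" using fin[of 0] by (auto simp: x_def)
  have "count_below (T (Suc 0)) a \<le> count_below (T 0 - {x}) a" for a
  proof (cases "x < a")
    case True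
    have "count_below (T (Suc 0)) a \<le> card (T (Suc 0))" by (rule count_below_le_card[OF fin])
    also have "\<dots> \<le> card (T 0 - {x})" using 0 x fin[of 0] by simp
    also have "\<dots> = count_below (T 0 - {x}) a" using x(2) True by (intro count_below_eq_card[symmetric]) (auto dest: x(2))
    finally show ?thesis .
  next
    case False
    then show ?thesis using count_below_remove_eq[OF fin x(1), of a] 0(1) unfolding tableau_def by (metis add_0_right)
  qed
  then have S0: "count_below (T' (Suc 0)) a \<le> count_below (T' 0) a" for a by (simp add: T'_def)
  have "x \<notin> T i" if "i \<noteq> 0" for i using 0(1) x(1) that unfolding tableau_def by blast
  then have T'i: "T' i = T i - {x}" for i unfolding T'_def by auto
  have "tableau T'"
    unfolding tableau_def
  proof (intro conjI allI impI)
    show "count_below (T' (Suc i)) a \<le> count_below (T' i) a" for i a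
      using S0 0(1) unfolding tableau_def by (cases i) (auto simp: T'_def)
    show "T' i \<inter> T' j = {}" if "i \<noteq> j" for i j
      unfolding T'i using 0(1) that unfolding tableau_def by blast
  qed (simp add: T'i fin)
  moreover have "(\<Union>i. T' i) = (\<Union>i. T i) - {x}"
    unfolding T'i by auto
  moreover have "\<forall>a. count_below (T' 0) a \<le> count_below (T 0) a" using fin by (auto simp: T'_def intro: count_below_mono)
  moreover have "\<forall>i. card (T' i) = card (T i) - (if i = 0 then 1 else 0)"
    using x fin by (auto simp: T'_def)
  moreover have "ins_rows (map snd b @ [x]) = T \<and> rec_rows (b @ [(p, x)]) = (rec_rows b)(0 := insert p (rec_rows b 0))"
    if b: "ins_rows (map snd b) = T'" for b p
  proof -
    have r0: "row_insert {} (map snd b) = T 0 - {x}" using fun_cong[OF b, of 0] by (simp add: T'_def)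
    have "bumped (T 0 - {x}) x = []" "row_step (T 0 - {x}) x = insert x (T 0 - {x})"
      using x(2) by (intro bump_none; auto)+
    then have bs: "bumped (T 0 - {x}) x = []" "row_step (T 0 - {x}) x = T 0" using x(1) by auto
    have "ins_rows (map snd b @ [x]) i = T i" for i
      using fun_cong[OF b, of i] bs r0 by (cases i) (auto simp: T'_def row_append out_append)
    moreover have "rec_rows (b @ [(p, x)]) i = ((rec_rows b)(0 := insert p (rec_rows b 0))) i" for i
      using bs r0 by (cases i) (auto simp: new_labels_append bumped_pairs_append)
    ultimately show ?thesis by blast
  qed
  ultimately show ?case using x(1) by blast
next
  case (Suc r)
  have fin: "finite (T i)" for i using Suc.prems by (auto simp: tableau_def)
  have "tableau (T \<circ> Suc)" using Suc.prems unfolding tableau_def by auto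
  then obtain S y where H: "tableau S \<and> y \<in> (T \<circ> Suc) 0 \<and> (\<Union>i. S i) = (\<Union>i. (T \<circ> Suc) i) - {y} \<and>
    (\<forall>a. count_below (S 0) a \<le> count_below ((T \<circ> Suc) 0) a) \<and>
    (\<forall>i. card (S i) = card ((T \<circ> Suc) i) - (if i = r then 1 else 0)) \<and>
    (\<forall>(b :: (nat \<times> nat) list) p. ins_rows (map snd b) = S \<longrightarrow> ins_rows (map snd b @ [y]) = T \<circ> Suc \<and>
       rec_rows (b @ [(p, y)]) = (rec_rows b)(r := insert p (rec_rows b r)))"
    using Suc.IH[of "T \<circ> Suc"] Suc.prems(2) unfolding comp_def by blast
  then have S: "tableau S" "y \<in> T (Suc 0)"
    "(\<Union>i. S i) = (\<Union>i. T (Suc i)) - {y}" "\<And>a. count_below (S 0) a \<le> count_below (T (Suc 0)) a"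
    "\<And>i. card (S i) = card (T (Suc i)) - (if i = r then 1 else 0)"
    and PS: "\<And>b :: (nat \<times> nat) list. ins_rows (map snd b) = S \<Longrightarrow> ins_rows (map snd b @ [y]) = T \<circ> Suc"
    and QS: "\<And>b p. ins_rows (map snd b) = S \<Longrightarrow> rec_rows (b @ [(p, y)]) = (rec_rows b)(r := insert p (rec_rows b r))"
    by simp_all
  have yT: "y \<notin> T 0" using Suc.prems(1) S(2) unfolding tableau_def by blast
  have dom: "count_below (T (Suc 0)) a \<le> count_below (T 0) a" for a using Suc.prems(1) unfolding tableau_def by blast
  define L where "L = {c \<in> T 0. c < y}"
  have "count_below (T 0) (Suc y) \<ge> 1"
    using dom[of "Suc y"] count_below_remove_eq[OF fin S(2), of "Suc y"] by simp
  then have "{c \<in> T 0. c < Suc y} \<noteq> {}" unfolding count_below_def by (metis card.empty not_one_le_zero)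
  then obtain c where "c \<in> T 0" "c < Suc y" by blast
  then have "c \<in> L" using yT unfolding L_def by (auto simp: less_Suc_eq)
  then have Lne: "L \<noteq> {}" "finite L" using fin[of 0] by (auto simp: L_def)
  define x where "x = Max L"
  have "x \<in> L" "\<And>c. c \<in> L \<Longrightarrow> c \<le> x" using Lne by (auto simp: x_def)
  then have x: "x \<in> T 0" "x < y" "\<And>c. c \<in> T 0 \<Longrightarrow> c < y \<Longrightarrow> c \<le> x" by (auto simp: L_def)
  define T0 where "T0 = insert y (T 0 - {x})"
  define T' where "T' i = (case i of 0 \<Rightarrow> T0 | Suc j \<Rightarrow> S j)" for i
  have finS: "finite (S i)" for i using S(1) by (auto simp: tableau_def)
  have c0: "count_below T0 a = count_below (T 0 - {x}) a + (if y < a then 1 else 0)" for a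
    unfolding T0_def using fin yT by (intro count_below_insert) auto
  have c1: "count_below (T 0) a = count_below (T 0 - {x}) a + (if x < a then 1 else 0)" for a
    using fin x(1) by (intro count_below_remove_eq)
  have le0: "count_below T0 a \<le> count_below (T 0) a" for a using c0[of a] c1[of a] x(2) by auto
  have S0: "count_below (S 0) a \<le> count_below T0 a" for a
  proof (cases "x < a \<and> a \<le> y")
    case True
    have "count_below (T 0) (Suc y) = count_below (T 0) a"
      using x(3) True yT by (intro count_below_gap) (metis leD le_less_trans less_SucE, simp)
    moreover have "count_below (T (Suc 0)) (Suc y) \<ge> count_below (T (Suc 0)) a + 1"
    proof -
      have "count_below (T (Suc 0)) (Suc y) = count_below (T (Suc 0) - {y}) (Suc y) + 1"
        using count_below_remove_eq[OF fin S(2), of "Suc y"] by simp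
      moreover have "count_below (T (Suc 0)) a = count_below (T (Suc 0) - {y}) a"
        using count_below_remove_eq[OF fin S(2), of a] True by simp
      moreover have "count_below (T (Suc 0) - {y}) a \<le> count_below (T (Suc 0) - {y}) (Suc y)"
        unfolding count_below_def using fin True by (intro card_mono) auto
      ultimately show ?thesis by simp
    qed
    ultimately show ?thesis using S(4)[of a] dom[of "Suc y"] c0[of a] c1[of a] True by simp
  next
    case False
    then have "(y < a) = (x < a)" using x(2) by linarith
    then have "count_below T0 a = count_below (T 0) a" by (simp only: c0 c1)
    then show ?thesis using S(4)[of a] dom[of a] by simp
  qed
  have SU: "S i \<subseteq> (\<Union>i. T (Suc i)) - {y}" for i unfolding S(3)[symmetric] by (rule UN_upper) simp
  have xS: "T 0 \<inter> T (Suc i) = {}" for i using Suc.prems(1) unfolding tableau_def by simp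
  have T0S: "T0 \<inter> S i = {}" for i
  proof -
    have "T 0 \<inter> (\<Union>i. T (Suc i)) = {}" using xS by blast
    then show ?thesis using SU[of i] unfolding T0_def by blast
  qed
  have "tableau T'"
    unfolding tableau_def
  proof (intro conjI allI impI)
    show "finite (T' i)" for i using fin finS by (cases i) (auto simp: T'_def T0_def)
    show "T' i \<inter> T' j = {}" if "i \<noteq> j" for i j
      using that T0S S(1) unfolding T'_def tableau_def by (cases i; cases j) auto
    show "count_below (T' (Suc i)) a \<le> count_below (T' i) a" for i a
      using S0 S(1) unfolding T'_def tableau_def by (cases i) auto
  qed
  moreover have "(\<Union>i. T' i) = (\<Union>i. T i) - {x}"
  proof -
    have "(\<Union>i. T' i) = T0 \<union> (\<Union>i. S i)" unfolding UN_Suc_split[of T'] by (simp add: T'_def)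
    also have "\<dots> = (T 0 \<union> (\<Union>i. T (Suc i))) - {x}"
      unfolding S(3) T0_def using x(1,2) xS S(2) by auto
    finally show ?thesis unfolding UN_Suc_split[of T] .
  qed
  moreover have "\<forall>a. count_below (T' 0) a \<le> count_below (T 0) a" using le0 by (simp add: T'_def)
  moreover have "\<forall>i. card (T' i) = card (T i) - (if i = Suc r then 1 else 0)"
  proof
    fix i
    have "card T0 = Suc (card (T 0 - {x}))" unfolding T0_def using fin[of 0] yT by simp
    also have "\<dots> = card (T 0)" using fin[of 0] x(1) by (rule card_Suc_Diff1)
    finally have "card T0 = card (T 0)" .
    then show "card (T' i) = card (T i) - (if i = Suc r then 1 else 0)"
      using S(5) by (cases i) (auto simp: T'_def)
  qed
  moreover have "ins_rows (map snd b @ [x]) = T \<and> rec_rows (b @ [(p, x)]) = (rec_rows b)(Suc r := insert p (rec_rows b (Suc r)))"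
    if b: "ins_rows (map snd b) = T'" for b p
  proof -
    have r0: "row_insert {} (map snd b) = T0" using fun_cong[OF b, of 0] by (simp add: T'_def)
    have *: "y \<le> z" if "z \<in> T0" "x < z" for z using that x(3)[of z] unfolding T0_def by force
    have y: "y \<in> T0" by (simp add: T0_def)
    have bs: "bumped T0 x = [y]" "row_step T0 x = insert x (T0 - {y})"
      using bump_at[OF y x(2) *] by blast+
    have "T0 - {y} = T 0 - {x}" unfolding T0_def using yT by auto
    then have st: "row_step T0 x = T 0" using bs x(1) by auto
    have P1: "ins_rows (map snd (bumped_pairs {} b)) = S"
    proof
      show "ins_rows (map snd (bumped_pairs {} b)) i = S i" for i
        using fun_cong[OF b, of "Suc i"] by (simp add: T'_def map_snd_bumped_pairs)
    qed
    have "ins_rows (map snd b @ [x]) i = T i" for i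
      using st r0 bs fun_cong[OF PS[OF P1]]
      by (cases i) (auto simp: row_append out_append map_snd_bumped_pairs)
    moreover have "rec_rows (b @ [(p, x)]) i = ((rec_rows b)(Suc r := insert p (rec_rows b (Suc r)))) i" for i
      using st r0 bs fun_cong[OF QS[OF P1]]
      by (cases i) (auto simp: new_labels_append bumped_pairs_append)
    ultimately show ?thesis by blast
  qed
  ultimately show ?case using x(1) by blast
qed

theorem RSK_surj:
  assumes "tableau T" "tableau U" "\<And>i. card (T i) = card (U i)" "finite (\<Union>i. U i)"
  obtains b where "biword b" "ins_rows (map snd b) = T" "rec_rows b = U" "fst ` set b = (\<Union>i. U i)"
    "snd ` set b = (\<Union>i. T i)"
proof -
  have "\<exists>b. biword b \<and> ins_rows (map snd b) = T \<and> rec_rows b = U \<and> fst ` set b = (\<Union>i. U i) \<and>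
    snd ` set b = (\<Union>i. T i)"
    using assms
  proof (induction "card (\<Union>i. U i)" arbitrary: T U)
    case 0
    then have U: "U i = {}" for i by auto
    have T: "T i = {}" for i using 0(2,4) U[of i] unfolding tableau_def by (metis card_eq_0_iff)
    have "ins_rows (map snd []) = T" "rec_rows [] = U" using T U by auto
    then show ?case using T U by (intro exI[of _ "[]"]) (auto simp: biword_def)
  next
    case (Suc n)
    have fin: "finite (U i)" for i using Suc by (auto simp: tableau_def)
    define p where "p = Max (\<Union>i. U i)"
    have "(\<Union>i. U i) \<noteq> {}" using Suc(2) by (metis card.empty nat.distinct(1))
    then have "p \<in> (\<Union>i. U i)" using Suc(6) unfolding p_def by (rule Max_in[rotated])
    then obtain r where r: "p \<in> U r" by blast
    have max: "c \<le> p" if "c \<in> U i" for c i unfolding p_def using Suc(6) that by (intro Max_ge) auto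
    have other: "p \<notin> U i" if "i \<noteq> r" for i using r Suc(4) that unfolding tableau_def by blast
    have lt: "c < p" if "c \<in> U i" "i \<noteq> r" for c i using max[OF that(1)] other[OF that(2)] that(1)
      by (metis le_neq_implies_less)
    have "card (U (Suc r)) = count_below (U (Suc r)) p" using lt by (intro count_below_eq_card[symmetric]) auto
    also have "\<dots> \<le> count_below (U r) p" using Suc(4) unfolding tableau_def by blast
    also have "\<dots> < card (U r)" unfolding count_below_def using r fin by (intro psubset_card_mono) auto
    finally have corner: "card (U (Suc r)) < card (U r)" .
    define V where "V = U(r := U r - {p})"
    have "tableau V" unfolding tableau_def
    proof (intro conjI allI impI)
      show "finite (V i)" for i using fin by (simp add: V_def)
      show "V i \<inter> V j = {}" if "i \<noteq> j" for i j using Suc(4) that unfolding V_def tableau_def by auto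
      show "count_below (V (Suc i)) a \<le> count_below (V i) a" for i a
      proof (cases "i = r")
        case True
        have d: "count_below (U (Suc r)) a \<le> count_below (U r) a" using Suc(4) unfolding tableau_def by blast
        have "count_below (U (Suc r)) a \<le> count_below (U r - {p}) a"
        proof (cases "p < a")
          case True
          have "count_below (U r - {p}) a = card (U r - {p})" using max[of _ r] True
            by (intro count_below_eq_card) (meson DiffD1 le_less_trans)
          moreover have "card (U r - {p}) \<ge> card (U (Suc r))" using corner r fin by simp
          ultimately show ?thesis using count_below_le_card[OF fin, of "Suc r" a] by simp
        next
          case False
          then show ?thesis using d count_below_remove_eq[OF fin r, of a] by simp
        qed
        then show ?thesis using True by (simp add: V_def)
      next
        case False
        have "count_below (V (Suc i)) a \<le> count_below (U (Suc i)) a" using fin by (intro count_below_mono) (auto simp: V_def)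
        also have "\<dots> \<le> count_below (U i) a" using Suc(4) unfolding tableau_def by blast
        finally show ?thesis using False by (simp add: V_def)
      qed
    qed
    have "V i = U i - {p}" for i using other unfolding V_def by auto
    then have UV: "(\<Union>i. V i) = (\<Union>i. U i) - {p}" by auto
    have Tc: "card (T (Suc r)) < card (T r)" using corner Suc(5) by simp
    from reverse_bump[OF Suc(3) Tc] obtain T' x where T': "tableau T'" "x \<in> T 0" "(\<Union>i. T' i) = (\<Union>i. T i) - {x}"
      "\<And>i. card (T' i) = card (T i) - (if i = r then 1 else 0)"
      and PQ: "\<And>b p. ins_rows (map snd b) = T' \<Longrightarrow> ins_rows (map snd b @ [x]) = T \<and>
         rec_rows (b @ [(p, x)]) = (rec_rows b)(r := insert p (rec_rows b r))" by blast
    have "n = card (\<Union>i. V i)" unfolding UV using Suc(2,6) \<open>p \<in> (\<Union>i. U i)\<close> by simp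
    moreover have "card (T' i) = card (V i)" for i
      using T'(4) Suc(5)[of i] r fin by (auto simp: V_def)
    moreover have "finite (\<Union>i. V i)" unfolding UV using Suc(6) by blast
    ultimately obtain b where b: "biword b" "ins_rows (map snd b) = T'" "rec_rows b = V" "fst ` set b = (\<Union>i. V i)"
      "snd ` set b = (\<Union>i. T' i)"
      using Suc(1)[OF _ T'(1) \<open>tableau V\<close>] by blast
    have "c < p" if "c \<in> fst ` set b" for c using that max unfolding b(4) UV
      by (metis DiffE UN_E insertI1 le_neq_implies_less)
    moreover have "x \<notin> snd ` set b" unfolding b(5) T'(3) by blast
    ultimately have "biword (b @ [(p, x)])" using b(1) by (auto simp: biword_def sorted_wrt_append)
    moreover have "ins_rows (map snd (b @ [(p, x)])) = T" "rec_rows (b @ [(p, x)]) = U"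
      using PQ[OF b(2)] b(3) r by (auto simp: V_def insert_absorb)
    moreover have "fst ` set (b @ [(p, x)]) = (\<Union>i. U i)" using b(4) UV r by auto
    moreover have "snd ` set (b @ [(p, x)]) = (\<Union>i. T i)" using b(5) T'(2,3) by auto
    ultimately show ?case by blast
  qed
  then show ?thesis using that by blast
qed


section \<open>Standard skew fillings and their column readings\<close>

lemma ins_rows_row_word:
  assumes "tableau T" "\<And>i. n \<le> i \<Longrightarrow> T i = {}"
  shows "ins_rows (row_word n T) = T"
proof -
  have "(\<Union>i. T i) = (\<Union>i<n. T i)" using assms(2) by (force simp: not_less[symmetric])
  then have "finite (\<Union>i. T i)" using assms(1) by (auto simp: tableau_def)
  from RSK_surj[OF assms(1) assms(1) HOL.refl this] obtain b where b: "biword b" "ins_rows (map snd b) = T" by metis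
  then have "distinct (map snd b)" by (simp add: biword_def)
  from knuth_row_word_ins_rows[OF this, of n] ins_rows_knuth[of "map snd b" "row_word n T"] b(2) assms(2) this show ?thesis by metis
qed

lemma tableau_eqI:
  assumes "tableau T" "\<And>i. n \<le> i \<Longrightarrow> T i = {}" "tableau U" "\<And>i. m \<le> i \<Longrightarrow> U i = {}" "knuth (row_word n T) (row_word m U)"
  shows "T = U"
  using ins_rows_row_word[of T n] ins_rows_row_word[of U m] ins_rows_knuth[OF assms(5) distinct_row_word] assms by metis

lemma
  assumes "biword b"
  shows tableau_rec_rows: "tableau (rec_rows b)" and rec_rows_Union: "(\<Union>i. rec_rows b i) = fst ` set b"
    and rec_rows_eq_empty: "length b \<le> i \<Longrightarrow> rec_rows b i = {}"
proof -
  obtain c where c: "inverse_biwords b c" using inverse_biword_exists[OF assms] by metis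
  then have d: "distinct (map snd c)" "set c = prod.swap ` set b" by (auto simp: inverse_biwords_def biword_def)
  have "length b = length c"
    using c biword_distinct_fst[of b] biword_distinct_fst[of c] unfolding inverse_biwords_def
    by (metis card_image distinct_card distinct_map inj_swap inj_on_subset subset_UNIV)
  then show "length b \<le> i \<Longrightarrow> rec_rows b i = {}" using ins_rows_eq_empty[OF d(1), of i] by (simp add: rec_rows_eq_ins_rows_inverse[OF c])
  show "tableau (rec_rows b)" using tableau_ins_rows[OF d(1)] by (simp add: rec_rows_eq_ins_rows_inverse[OF c])
  have "snd ` set c = fst ` set b" using d(2) by (force simp: image_iff)
  then show "(\<Union>i. rec_rows b i) = fst ` set b" using ins_rows_Union[OF d(1)] by (simp add: rec_rows_eq_ins_rows_inverse[OF c])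
qed

lemma knuth_row_word_rec_rows:
  assumes "inverse_biwords b c" "\<And>i. n \<le> i \<Longrightarrow> rec_rows b i = {}"
  shows "knuth (map snd c) (row_word n (rec_rows b))"
  using knuth_row_word_ins_rows[of "map snd c" n] assms
  by (simp add: rec_rows_eq_ins_rows_inverse[OF assms(1)] inverse_biwords_def biword_def)

lemma row_stage_inj:
  assumes "biword b" "biword b'" "row_insert {} (map snd b) = row_insert {} (map snd b')" "new_labels {} b = new_labels {} b'"
    "bumped_pairs {} b = bumped_pairs {} b'"
  shows "b = b'"
  using assms
proof (induction b arbitrary: b' rule: rev_induct)
  case Nil
  then have "fst ` set b' = {}" using fst_bumped_pairs_new_labels[of "{}" b'] by simp
  then show ?case by simp
next
  case (snoc e b)
  obtain p x where e: "e = (p, x)" by (cases e)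
  have lab: "fst ` set (b @ [e]) = fst ` set b'"
    using fst_bumped_pairs_new_labels[of "{}" "b @ [e]"] fst_bumped_pairs_new_labels[of "{}" b'] snoc.prems by simp
  then have "b' \<noteq> []" by auto
  then obtain b0 e' where b': "b' = b0 @ [e']" by (metis append_butlast_last_id)
  obtain p' x' where e': "e' = (p', x')" by (cases e')
  have bi: "biword b" "biword b0" using snoc.prems(1,2) b' by (auto simp: biword_def sorted_wrt_append)
  have mx: "q < p" if "q \<in> fst ` set b" for q
    using snoc.prems(1) that e by (auto simp: biword_def sorted_wrt_append)
  have mx': "q < p'" if "q \<in> fst ` set b0" for q
    using snoc.prems(2) that e' b' by (auto simp: biword_def sorted_wrt_append)
  have "p \<in> fst ` set b'" "p' \<in> fst ` set (b @ [e])" using lab b' e e' by auto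
  then have "p \<le> p'" "p' \<le> p" using mx mx' b' e e' by (auto dest: less_imp_le)
  then have pp: "p' = p" by simp
  define C where "C = row_insert {} (map snd b)"
  define C' where "C' = row_insert {} (map snd b0)"
  have pn: "p \<notin> new_labels {} b" "p \<notin> new_labels {} b0" "p \<notin> fst ` set (bumped_pairs {} b)" "p \<notin> fst ` set (bumped_pairs {} b0)"
    using mx[of p] mx'[of p] pp less_irrefl subsetD[OF new_labels_subset] subsetD[OF fst_bumped_pairs] by metis+
  have di: "distinct (map snd b)" "x \<notin> snd ` set b" "distinct (map snd b0)" "x' \<notin> snd ` set b0"
    using snoc.prems(1,2) e e' b' by (auto simp: biword_def)
  then have xC: "x \<notin> C" "x' \<notin> C'"
    using row_out_sets(1)[of "{}" "map snd b"] row_out_sets(1)[of "{}" "map snd b0"] by (auto simp: C_def C'_def)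
  have fin: "finite C" "finite C'" by (simp_all add: C_def C'_def finite_row)
  have R: "row_step C x = row_step C' x'" using snoc.prems(3) by (simp add: b' e e' row_append C_def C'_def)
  have B: "new_labels {} b \<union> (if bumped C x = [] then {p} else {}) = new_labels {} b0 \<union> (if bumped C' x' = [] then {p} else {})"
    using snoc.prems(4) by (simp only: b' e e' new_labels_append C_def C'_def pp new_labels.simps fst_conv snd_conv Un_empty_right)
  have O: "bumped_pairs {} b @ map (Pair p) (bumped C x) = bumped_pairs {} b0 @ map (Pair p) (bumped C' x')"
    using snoc.prems(5) by (simp add: b' e e' bumped_pairs_append C_def C'_def pp)
  have iff: "bumped C x = [] \<longleftrightarrow> bumped C' x' = []" using B pn by (auto split: if_splits)
  have bqe: "new_labels {} b = new_labels {} b0" using B iff pn by (auto split: if_splits)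
  have "x = x' \<and> C = C' \<and> bumped_pairs {} b = bumped_pairs {} b0"
  proof (cases rule: bumped_cases[of C x])
    case 1
    have "bumped C' x' = []" using iff 1 by simp
    then obtain h: "\<And>z. z \<in> C' \<Longrightarrow> z \<le> x'" "row_step C' x' = insert x' C'"
      by (cases rule: bumped_cases[of C' x']) auto
    have "x = Max (insert x C)" using 1(1) fin by (auto intro!: Max_eqI[symmetric])
    moreover have "x' = Max (insert x' C')" using h(1) fin by (auto intro!: Max_eqI[symmetric])
    ultimately have "x = x'" using R 1(3) h(2) by simp
    then show ?thesis using R 1 h xC O \<open>bumped C' x' = []\<close> by (auto simp: insert_ident)
  next
    case (2 y)
    have "bumped C' x' \<noteq> []" using iff 2 by simp
    then obtain y' where h: "y' \<in> C'" "x' < y'" "\<And>z. z \<in> C' \<Longrightarrow> x' < z \<Longrightarrow> y' \<le> z" "bumped C' x' = [y']"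
      "row_step C' x' = insert x' (C' - {y'})"
      by (cases rule: bumped_cases[of C' x']) auto
    have yy: "y' = y" "bumped_pairs {} b = bumped_pairs {} b0" using O 2(4) h(4) by auto
    have S: "insert x (C - {y}) = insert x' (C' - {y})" using R 2(5) h(5) yy by simp
    have le: "c \<le> x" if "c \<in> insert x (C - {y})" "c < y" for c using that 2(3)[of c] by force
    have le': "c \<le> x'" if "c \<in> insert x' (C' - {y})" "c < y" for c using that h(3)[of c] yy by force
    have "x \<le> x'" using le'[of x] 2(2) S by blast
    moreover have "x' \<le> x" using le[of x'] h(2) yy S by blast
    ultimately have xx: "x = x'" by simp
    have "C - {y} = C' - {y}" using S xC unfolding xx by (auto simp: insert_ident)
    then have "C = C'" using 2(1) h(1) yy by blast
    then show ?thesis using xx yy by simp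
  qed
  then show ?case using snoc.IH[OF bi] bqe by (simp add: b' e e' pp C_def C'_def)
qed

theorem RSK_inj:
  assumes "biword b" "biword b'" "ins_rows (map snd b) = ins_rows (map snd b')" "rec_rows b = rec_rows b'"
  shows "b = b'"
  using assms
proof (induction "length b" arbitrary: b b' rule: less_induct)
  case less
  note prems = less.prems
  show ?case
  proof (cases "b = []")
    case True
    then have "rec_rows b' i = {}" for i using fun_cong[OF prems(4), of i] by simp
    then have "fst ` set b' = {}" using rec_rows_Union[OF prems(2)] by simp
    then show ?thesis using True by simp
  next
    case False
    have "length (bumped_pairs {} b) < length b"
      using length_out[of "map snd b"] prems(1) False
      by (metis biword_def length_map map_snd_bumped_pairs map_is_Nil_conv)
    moreover have "ins_rows (map snd (bumped_pairs {} b)) i = ins_rows (map snd (bumped_pairs {} b')) i" "rec_rows (bumped_pairs {} b) i = rec_rows (bumped_pairs {} b') i" for i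
      using fun_cong[OF prems(3), of "Suc i"] fun_cong[OF prems(4), of "Suc i"] by (simp_all add: map_snd_bumped_pairs)
    ultimately have "bumped_pairs {} b = bumped_pairs {} b'"
      using biword_bumped_pairs prems(1,2) by (intro less.hyps) auto
    moreover have "row_insert {} (map snd b) = row_insert {} (map snd b')" using fun_cong[OF prems(3), of 0] by simp
    moreover have "new_labels {} b = new_labels {} b'" using fun_cong[OF prems(4), of 0] by simp
    ultimately show ?thesis using row_stage_inj[OF prems(1,2)] by blast
  qed
qed

lemma knuth_increasing_past_decreasing:
  assumes "sorted_wrt (<) (a # r)" "sorted_wrt (>) (a # xs)"
  shows "knuth (a # r @ xs) (a # xs @ r)"
  using assms
proof (induction xs arbitrary: a)
  case (Cons x xs)
  have "knuth (a # r @ [x]) (a # x # r)" using Cons.prems by (intro knuth_smaller_past_increasing) auto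
  from knuth_appendR[OF this, of xs] have "knuth (a # r @ x # xs) (a # x # r @ xs)" by simp
  moreover have "knuth (x # r @ xs) (x # xs @ r)" using Cons.prems by (intro Cons.IH) auto
  then have "knuth (a # x # r @ xs) (a # x # xs @ r)" by (rule knuth_Cons)
  ultimately show ?case by (auto intro: knuth_trans)
qed simp

definition std_filling :: "(nat \<Rightarrow> nat) \<Rightarrow> (nat \<Rightarrow> nat) \<Rightarrow> nat filling \<Rightarrow> bool" where
  "std_filling nu lam F \<longleftrightarrow> dom F = skew_diagram nu lam \<and> inj_on F (dom F) \<and>
     (\<forall>i j x y. F (i, j) = Some x \<longrightarrow> F (i, j + 1) = Some y \<longrightarrow> x < y) \<and>
     (\<forall>i j x y. F (i, j) = Some x \<longrightarrow> F (i + 1, j) = Some y \<longrightarrow> x < y)"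

definition filling_rows :: "nat filling \<Rightarrow> nat \<Rightarrow> nat set" where
  "filling_rows F i = {x. \<exists>j. F (i, j) = Some x}"

definition skew_tableau :: "(nat \<Rightarrow> nat) \<Rightarrow> (nat \<Rightarrow> nat) \<Rightarrow> (nat \<Rightarrow> nat set) \<Rightarrow> bool" where
  "skew_tableau nu lam R \<longleftrightarrow> (\<forall>i. finite (R i) \<and> lam i + card (R i) = nu i) \<and>
     (\<forall>i j. i \<noteq> j \<longrightarrow> R i \<inter> R j = {}) \<and>
     (\<forall>i a. lam (Suc i) + count_below (R (Suc i)) a \<le> lam i + count_below (R i) a)"

definition fill :: "(nat \<Rightarrow> nat) \<Rightarrow> (nat \<Rightarrow> nat set) \<Rightarrow> nat filling" where
  "fill lam R = (\<lambda>(i, j). if lam i \<le> j \<and> j < lam i + card (R i)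
     then Some (sorted_list_of_set (R i) ! (j - lam i)) else None)"

lemma skew_tableau_straight: "skew_tableau nu (\<lambda>_. 0) R \<longleftrightarrow> tableau R \<and> (\<forall>i. card (R i) = nu i)"
  by (auto simp: skew_tableau_def tableau_def)

lemma
  assumes "std_filling nu lam F"
  shows std_filling_Some: "F (i, j) = Some x \<Longrightarrow> lam i \<le> j \<and> j < nu i"
    and std_filling_the: "lam i \<le> j \<Longrightarrow> j < nu i \<Longrightarrow> F (i, j) = Some (the (F (i, j)))"
  using assms unfolding std_filling_def skew_diagram_def by (auto simp: dom_def set_eq_iff)

lemma std_filling_row_less:
  assumes "std_filling nu lam F" "lam i \<le> j" "j < j'" "j' < nu i"
  shows "the (F (i, j)) < the (F (i, j'))"
  using assms(3,4)
proof (induction j')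
  case (Suc k)
  have S: "F (i, k) = Some (the (F (i, k)))" "F (i, k + 1) = Some (the (F (i, k + 1)))"
    using std_filling_the[OF assms(1), of i] assms(2) Suc.prems by auto
  have "the (F (i, k)) < the (F (i, k + 1))"
    using assms(1) S unfolding std_filling_def by blast
  then show ?case using Suc by (cases "j = k") auto
qed simp

lemma std_filling_column_less:
  assumes "std_filling nu lam F" "antimono lam" "antimono nu" "lam i \<le> j" "j < nu i'" "i < i'"
  shows "the (F (i, j)) < the (F (i', j))"
  using assms(5,6)
proof (induction i')
  case (Suc k)
  have "lam k \<le> lam i" "lam (Suc k) \<le> lam i" "nu (Suc k) \<le> nu k"
    using assms(2,3) Suc.prems by (auto simp: antimono_def)
  then have S: "F (k, j) = Some (the (F (k, j)))" "F (k + 1, j) = Some (the (F (k + 1, j)))"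
    and k: "j < nu k"
    using std_filling_the[OF assms(1), of k j] std_filling_the[OF assms(1), of "k + 1" j] assms(4) Suc.prems by auto
  have "the (F (k, j)) < the (F (k + 1, j))"
    using assms(1) S unfolding std_filling_def by blast
  then show ?case using Suc k by (cases "i = k") auto
qed simp

lemma std_filling_row_list:
  assumes "std_filling nu lam F"
  shows "sorted_list_of_set (filling_rows F i) = map (\<lambda>j. the (F (i, j))) [lam i..<nu i]"
proof (rule sorted_list_of_set_eqI)
  show "sorted_wrt (<) (map (\<lambda>j. the (F (i, j))) [lam i..<nu i])"
    unfolding sorted_wrt_map
    by (rule sorted_wrt_mono_rel[of _ "(<)"]) (auto intro: std_filling_row_less[OF assms])
  show "set (map (\<lambda>j. the (F (i, j))) [lam i..<nu i]) = filling_rows F i"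
    using std_filling_Some[OF assms] std_filling_the[OF assms, of i]
    by (force simp: filling_rows_def)
qed

lemma finite_filling_rows:
  assumes "std_filling nu lam F"
  shows "finite (filling_rows F i)"
proof -
  have "filling_rows F i \<subseteq> (\<lambda>j. the (F (i, j))) ` {lam i..<nu i}"
    using std_filling_Some[OF assms] by (force simp: filling_rows_def)
  then show ?thesis by (rule finite_subset) simp
qed

lemma inj_the_row:
  assumes "std_filling nu lam F"
  shows "inj_on (\<lambda>j. the (F (i, j))) {lam i..<nu i}"
proof (rule inj_onI)
  fix j j' assume "j \<in> {lam i..<nu i}" "j' \<in> {lam i..<nu i}" "the (F (i, j)) = the (F (i, j'))"
  then show "j = j'"
    using std_filling_row_less[OF assms, of i j j'] std_filling_row_less[OF assms, of i j' j]
    by (cases j j' rule: linorder_cases) auto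
qed

lemma count_below_filling_rows:
  assumes "std_filling nu lam F"
  shows "count_below (filling_rows F i) a = card {j. lam i \<le> j \<and> j < nu i \<and> the (F (i, j)) < a}"
proof -
  have "{c \<in> filling_rows F i. c < a} = (\<lambda>j. the (F (i, j))) ` {j. lam i \<le> j \<and> j < nu i \<and> the (F (i, j)) < a}"
    using std_filling_Some[OF assms] std_filling_the[OF assms, of i]
    by (force simp: filling_rows_def)
  then show ?thesis unfolding count_below_def
    by (simp only:) (intro card_image inj_on_subset[OF inj_the_row[OF assms, of i]], auto)
qed

lemma skew_tableau_filling_rows:
  assumes "std_filling nu lam F" "antimono lam" "antimono nu" "\<And>i. lam i \<le> nu i"
  shows "skew_tableau nu lam (filling_rows F)"
  unfolding skew_tableau_def
proof (intro conjI allI impI)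
  fix i
  show "finite (filling_rows F i)" by (rule finite_filling_rows[OF assms(1)])
  have "card (filling_rows F i) = length (sorted_list_of_set (filling_rows F i))" by simp
  then show "lam i + card (filling_rows F i) = nu i"
    unfolding std_filling_row_list[OF assms(1)] using assms(4)[of i] by simp
next
  fix i j :: nat assume "i \<noteq> j"
  then show "filling_rows F i \<inter> filling_rows F j = {}"
    using assms(1) unfolding std_filling_def inj_on_def filling_rows_def by auto (metis domI old.prod.inject)
next
  fix i a
  have l: "lam (Suc i) \<le> lam i" "nu (Suc i) \<le> nu i" using assms(2,3) by (auto simp: antimono_def)
  let ?J = "\<lambda>i. {j. lam i \<le> j \<and> j < nu i \<and> the (F (i, j)) < a}"
  have "?J (Suc i) \<subseteq> {lam (Suc i)..<lam i} \<union> ?J i"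
  proof
    fix j assume j: "j \<in> ?J (Suc i)"
    show "j \<in> {lam (Suc i)..<lam i} \<union> ?J i"
    proof (cases "j < lam i")
      case False
      then have "the (F (i, j)) < the (F (Suc i, j))"
        using j by (intro std_filling_column_less[OF assms(1-3)]) auto
      then show ?thesis using j False l by auto
    qed (use j in auto)
  qed
  then have "card (?J (Suc i)) \<le> card ({lam (Suc i)..<lam i} \<union> ?J i)"
    by (intro card_mono) auto
  also have "\<dots> \<le> (lam i - lam (Suc i)) + card (?J i)"
    by (rule order_trans[OF card_Un_le]) simp
  finally show "lam (Suc i) + count_below (filling_rows F (Suc i)) a \<le> lam i + count_below (filling_rows F i) a"
    unfolding count_below_filling_rows[OF assms(1)] using l by simp
qed

lemma fill_filling_rows:
  assumes "std_filling nu lam F" "\<And>i. lam i \<le> nu i"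
  shows "fill lam (filling_rows F) = F"
proof
  fix c :: "nat \<times> nat"
  obtain i j where c: "c = (i, j)" by (cases c)
  have "card (filling_rows F i) = length (sorted_list_of_set (filling_rows F i))" by simp
  then have l: "lam i + card (filling_rows F i) = nu i"
    unfolding std_filling_row_list[OF assms(1)] using assms(2)[of i] by simp
  show "fill lam (filling_rows F) c = F c"
  proof (cases "lam i \<le> j \<and> j < nu i")
    case True
    then show ?thesis
      using std_filling_the[OF assms(1), of i j] by (auto simp: c fill_def l std_filling_row_list[OF assms(1)])
  next
    case False
    then have "F (i, j) = None" using std_filling_Some[OF assms(1)] by (metis option.exhaust)
    then show ?thesis using False by (auto simp: c fill_def l)
  qed
qed

lemma count_below_nth:
  assumes "finite S" "k < card S"
  shows "count_below S (sorted_list_of_set S ! k) = k"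
proof -
  let ?l = "sorted_list_of_set S"
  have s: "sorted_wrt (<) ?l" "set ?l = S" "length ?l = card S" using assms by auto
  have "{c \<in> S. c < ?l ! k} = set (take k ?l)"
  proof (rule subset_antisym; rule subsetI)
    fix c assume "c \<in> {c \<in> S. c < ?l ! k}"
    then obtain m where m: "m < card S" "c = ?l ! m" "c < ?l ! k" using s by (metis (mono_tags, lifting) in_set_conv_nth mem_Collect_eq)
    have "m < k"
    proof (rule ccontr)
      assume "\<not> m < k"
      then have "?l ! k \<le> ?l ! m" using s m(1) sorted_nth_mono[of ?l k m] by simp
      then show False using m by simp
    qed
    then show "c \<in> set (take k ?l)" using m s by (auto simp: in_set_conv_nth)
  next
    fix c assume "c \<in> set (take k ?l)"
    then obtain m where m: "m < k" "c = ?l ! m" using s assms by (auto simp: in_set_conv_nth)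
    then have "c < ?l ! k" using sorted_wrt_nth_less[OF s(1)] s assms by simp
    then show "c \<in> {c \<in> S. c < ?l ! k}" using m s assms by (metis (mono_tags, lifting) mem_Collect_eq nth_mem order_less_trans)
  qed
  moreover have "card (set (take k ?l)) = k" using s assms by (simp add: distinct_card)
  ultimately show ?thesis by (simp add: count_below_def)
qed

lemma
  assumes "skew_tableau nu lam R"
  shows std_filling_fill: "std_filling nu lam (fill lam R)" and filling_rows_fill: "filling_rows (fill lam R) = R"
proof -
  have fin: "finite (R i)" and card: "lam i + card (R i) = nu i" for i
    using assms by (auto simp: skew_tableau_def)
  have disj: "R i \<inter> R j = {}" if "i \<noteq> j" for i j using assms that by (auto simp: skew_tableau_def)
  have f: "fill lam R (i, j) = (if lam i \<le> j \<and> j < nu i then Some (sorted_list_of_set (R i) ! (j - lam i)) else None)" for i j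
    by (simp add: fill_def card)
  have inR: "sorted_list_of_set (R i) ! (j - lam i) \<in> R i" if "lam i \<le> j" "j < nu i" for i j
    using nth_mem[of "j - lam i" "sorted_list_of_set (R i)"] that card[of i] fin[of i] by simp
  show "filling_rows (fill lam R) = R"
  proof
    fix i
    show "filling_rows (fill lam R) i = R i"
    proof (rule subset_antisym; rule subsetI)
      fix x assume "x \<in> filling_rows (fill lam R) i"
      then show "x \<in> R i" using inR by (auto simp: filling_rows_def f split: if_splits)
    next
      fix x assume "x \<in> R i"
      then obtain k where k: "k < card (R i)" "sorted_list_of_set (R i) ! k = x"
        using fin[of i] by (metis in_set_conv_nth sorted_list_of_set.length_sorted_key_list_of_set sorted_list_of_set.set_sorted_key_list_of_set)
      then have "fill lam R (i, lam i + k) = Some x" using card[of i] by (simp add: f)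
      then show "x \<in> filling_rows (fill lam R) i" unfolding filling_rows_def by blast
    qed
  qed
  show "std_filling nu lam (fill lam R)"
    unfolding std_filling_def
  proof (intro conjI allI impI)
    show "dom (fill lam R) = skew_diagram nu lam"
      by (auto simp: f skew_diagram_def dom_def split: if_splits)
    show "x < y" if "fill lam R (i, j) = Some x" "fill lam R (i, j + 1) = Some y" for i j x y
    proof -
      have b: "lam i \<le> j" "j + 1 < nu i" "x = sorted_list_of_set (R i) ! (j - lam i)"
        "y = sorted_list_of_set (R i) ! (j + 1 - lam i)"
        using that by (auto simp: f split: if_splits)
      show ?thesis unfolding b(3,4)
        using b(1,2) card[of i] by (intro sorted_wrt_nth_less[of "(<)"]) auto
    qed
    show "inj_on (fill lam R) (dom (fill lam R))"
    proof (rule inj_onI)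
      fix c d assume cd: "c \<in> dom (fill lam R)" "d \<in> dom (fill lam R)" "fill lam R c = fill lam R d"
      obtain i j i' j' where e: "c = (i, j)" "d = (i', j')" by (cases c, cases d)
      have b: "lam i \<le> j" "j < nu i" "lam i' \<le> j'" "j' < nu i'"
        "sorted_list_of_set (R i) ! (j - lam i) = sorted_list_of_set (R i') ! (j' - lam i')"
        using cd e by (auto simp: f split: if_splits)
      then have ii: "i = i'" using inR[of i j] inR[of i' j'] disj[of i i'] by auto
      have "j - lam i = j' - lam i'"
        using b card[of i] nth_eq_iff_index_eq[of "sorted_list_of_set (R i)" "j - lam i" "j' - lam i'"]
        by (simp add: ii)
      then show "c = d" using b e ii by auto
    qed
    show "x < y" if "fill lam R (i, j) = Some x" "fill lam R (i + 1, j) = Some y" for i j x y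
    proof -
      have b: "lam i \<le> j" "j < nu i" "x = sorted_list_of_set (R i) ! (j - lam i)"
        "lam (Suc i) \<le> j" "j < nu (Suc i)" "y = sorted_list_of_set (R (Suc i)) ! (j - lam (Suc i))"
        using that by (auto simp: f split: if_splits)
      have y: "y \<in> R (Suc i)" "x \<in> R i" using inR b by auto
      have cy: "count_below (R (Suc i)) y = j - lam (Suc i)" and cx: "count_below (R i) x = j - lam i"
        using b card[of i] card[of "Suc i"] count_below_nth[OF fin] by auto
      have "count_below (R (Suc i)) (Suc y) = count_below (R (Suc i)) y + 1"
        using count_below_remove_eq[OF fin y(1), of "Suc y"] count_below_remove_eq[OF fin y(1), of y]
          count_below_gap[of "R (Suc i) - {y}" y "Suc y"] by (simp add: less_Suc_eq_le)
      moreover have "lam (Suc i) + count_below (R (Suc i)) (Suc y) \<le> lam i + count_below (R i) (Suc y)"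
        using assms unfolding skew_tableau_def by blast
      ultimately have "count_below (R i) x < count_below (R i) (Suc y)" using cx cy b(1,4) by linarith
      moreover have "count_below (R i) (Suc y) \<le> count_below (R i) x" if "Suc y \<le> x"
        unfolding count_below_def using fin that by (intro card_mono) auto
      ultimately have "x \<le> y" by (meson leD not_less_eq_eq)
      moreover have "x \<noteq> y" using y disj[of i "Suc i"] by auto
      ultimately show ?thesis by simp
    qed
  qed
qed

lemma concat_map_filter: "(\<And>x. x \<in> set xs \<Longrightarrow> \<not> p x \<Longrightarrow> f x = []) \<Longrightarrow> concat (map f (filter p xs)) = concat (map f xs)"
  by (induction xs) auto

lemma sorted_list_of_set_filter_upt: "(\<And>x. x \<in> S \<Longrightarrow> x < n) \<Longrightarrow> sorted_list_of_set S = filter (\<lambda>x. x \<in> S) [0..<n]"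
  by (rule sorted_list_of_set_eqI) (auto intro!: sorted_wrt_filter)

lemma column_reading_upt:
  assumes "dom F = skew_diagram nu lam" "antimono nu" "\<And>i. n \<le> i \<Longrightarrow> nu i = 0"
  shows "column_reading F = concat (map (\<lambda>j. map (\<lambda>i. the (F (i, j))) (rev (filter (\<lambda>i. lam i \<le> j \<and> j < nu i) [0..<n]))) [0..<nu 0])"
proof -
  have in_dom: "(i, j) \<in> dom F \<longleftrightarrow> lam i \<le> j \<and> j < nu i" for i j
    unfolding assms(1) by (simp add: skew_diagram_def)
  have n: "i < n" if "j < nu i" for i j using assms(3)[of i] that by (metis not_less not_less0)
  have col: "column_word F j = map (\<lambda>i. the (F (i, j))) (rev (filter (\<lambda>i. lam i \<le> j \<and> j < nu i) [0..<n]))" for j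
  proof -
    have "sorted_list_of_set {i. (i, j) \<in> dom F} = filter (\<lambda>i. lam i \<le> j \<and> j < nu i) [0..<n]"
      by (subst sorted_list_of_set_filter_upt[of _ n]) (use n in_dom in auto)
    then show ?thesis by (simp add: column_word_def)
  qed
  have "sorted_list_of_set (snd ` dom F) = filter (\<lambda>j. j \<in> snd ` dom F) [0..<nu 0]"
  proof (rule sorted_list_of_set_filter_upt)
    fix j assume "j \<in> snd ` dom F"
    then obtain i where "(i, j) \<in> dom F" by (metis imageE prod.collapse)
    then show "j < nu 0" using in_dom assms(2) unfolding antimono_def by (meson le0 less_le_trans)
  qed
  then have "column_reading F = concat (map (column_word F) [0..<nu 0])"
    unfolding column_reading_def
    by (simp only:) (rule concat_map_filter, force simp: col filter_empty_conv in_dom[symmetric] image_iff)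
  also have "column_word F = (\<lambda>j. map (\<lambda>i. the (F (i, j))) (rev (filter (\<lambda>i. lam i \<le> j \<and> j < nu i) [0..<n])))"
    by (rule ext) (rule col)
  finally show ?thesis .
qed

lemma knuth_column_reading:
  assumes "std_filling nu lam F" "antimono lam" "antimono nu" "\<And>i. n \<le> i \<Longrightarrow> nu i = 0"
  shows "knuth (row_word n (filling_rows F)) (column_reading F)"
proof -
  define rws where "rws j I = concat (map (\<lambda>i. map (\<lambda>j'. the (F (i, j'))) [max j (lam i)..<nu i]) (rev [0..<I]))" for j I
  define col where "col j I = map (\<lambda>i. the (F (i, j))) (rev (filter (\<lambda>i. lam i \<le> j \<and> j < nu i) [0..<I]))" for j I
  have peel: "knuth (rws j I) (col j I @ rws (Suc j) I)" for j I
  proof (induction I)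
    case (Suc I)
    let ?r = "\<lambda>j. map (\<lambda>j'. the (F (I, j'))) [max j (lam I)..<nu I]"
    have s: "rws j (Suc I) = ?r j @ rws j I" for j by (simp add: rws_def)
    have IH: "knuth (?r j @ rws j I) (?r j @ col j I @ rws (Suc j) I)" using Suc by (rule knuth_appendL)
    consider "lam I \<le> j \<and> j < nu I" | "nu I \<le> j" | "j < lam I" "j < nu I" by linarith
    then show ?case
    proof cases
      case 1
      define a where "a = the (F (I, j))"
      have r: "?r j = a # ?r (Suc j)"
      proof -
        have "max j (lam I) = j" "max (Suc j) (lam I) = Suc j" using 1 by auto
        then show ?thesis using 1 by (simp add: upt_conv_Cons a_def)
      qed
      have c: "col j (Suc I) = a # col j I" using 1 by (simp add: col_def a_def)
      have "sorted_wrt (<) (?r j)"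
        unfolding sorted_wrt_map
        by (rule sorted_wrt_mono_rel[of _ "(<)"]) (auto intro: std_filling_row_less[OF assms(1)])
      moreover have "sorted_wrt (>) (col j (Suc I))"
        unfolding col_def sorted_wrt_map sorted_wrt_rev
        by (rule sorted_wrt_mono_rel[of _ "(<)"])
          (auto intro: std_filling_column_less[OF assms(1-3)] intro!: sorted_wrt_filter simp del: upt_Suc)
      ultimately have "knuth (a # ?r (Suc j) @ col j I) (a # col j I @ ?r (Suc j))"
        unfolding r c by (rule knuth_increasing_past_decreasing)
      from knuth_appendR[OF this, of "rws (Suc j) I"] IH show ?thesis
        unfolding s c r by (auto intro: knuth_trans)
    next
      case 2
      then have e: "?r j = []" "?r (Suc j) = []" "col j (Suc I) = col j I" by (auto simp: col_def)
      show ?thesis using Suc unfolding s by (simp only: e append_Nil)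
    next
      case 3
      have "lam I \<le> lam i" if "i < I" for i using assms(2) that by (auto simp: antimono_def)
      then have "col j I = []" using 3 by (force simp: col_def filter_empty_conv)
      moreover have "col j (Suc I) = col j I" "?r j = ?r (Suc j)" using 3 by (auto simp: col_def max_def)
      ultimately show ?thesis using IH unfolding s by simp
    qed
  qed (simp add: rws_def col_def)
  have "nu i \<le> nu 0" for i using assms(3) by (auto simp: antimono_def)
  then have e: "rws (nu 0) n = []" by (auto simp: rws_def le_max_iff_disj)
  have "knuth (rws j n) (concat (map (\<lambda>j. col j n) [j..<nu 0]))" if "j \<le> nu 0" for j
    using that
  proof (induction j rule: inc_induct)
    case (step j)
    have "knuth (col j n @ rws (Suc j) n) (col j n @ concat (map (\<lambda>j. col j n) [Suc j..<nu 0]))"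
      using step by (intro knuth_appendL) auto
    then show ?case using peel[of j n] step(2) by (simp add: upt_conv_Cons knuth_trans)
  qed (simp add: e)
  from this[of 0] have "knuth (rws 0 n) (column_reading F)"
    using assms(1) column_reading_upt[of F nu lam n] assms(3,4) by (simp add: col_def std_filling_def)
  then show ?thesis by (simp add: row_word_def rws_def std_filling_row_list[OF assms(1)])
qed


section \<open>Standardization\<close>

text \<open>\<open>g\<close> sends the letters of a standard word to those of a super word. Equal even
letters are numbered from left to right, equal odd letters from right to left.\<close>

definition std_compat :: "(nat \<Rightarrow> 'a) \<Rightarrow> ('a \<Rightarrow> nat) \<Rightarrow> nat list \<Rightarrow> bool" where
  "std_compat g sg w \<longleftrightarrow> sorted_wrt (\<lambda>x y. g x = g y \<longrightarrow> (if sg (g x) = 0 then x < y else y < x)) w"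

lemma std_compat_append:
  "std_compat g sg (u @ v) \<longleftrightarrow> std_compat g sg u \<and> std_compat g sg v \<and>
    (\<forall>x\<in>set u. \<forall>y\<in>set v. g x = g y \<longrightarrow> (if sg (g x) = 0 then x < y else y < x))"
  by (auto simp: std_compat_def sorted_wrt_append)

lemma std_compat_triple:
  "std_compat g sg [a, b, c] \<longleftrightarrow>
    (g a = g b \<longrightarrow> (if sg (g a) = 0 then a < b else b < a)) \<and>
    (g a = g c \<longrightarrow> (if sg (g a) = 0 then a < c else c < a)) \<and>
    (g b = g c \<longrightarrow> (if sg (g b) = 0 then b < c else c < b))"
  unfolding std_compat_def by simp

lemma mono_less_imp_less:
  fixes g :: "nat \<Rightarrow> 'a::linorder"
  shows "mono g \<Longrightarrow> g x < g y \<Longrightarrow> x < y"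
  by (metis leD monoE not_le_imp_less)

lemma knuth_imp_plactic_cong:
  fixes g :: "nat \<Rightarrow> 'a::linorder"
  assumes "knuth v w" "mono g" "sg \<in> A \<rightarrow> {0, 1}" "g ` set v \<subseteq> A"
  shows "(std_compat g sg v \<longleftrightarrow> std_compat g sg w) \<and> (std_compat g sg v \<longrightarrow> (map g v, map g w) \<in> plactic_cong A sg)"
  using assms(1,4)
proof (induction rule: knuth.induct)
  case (knuth_refl w)
  then have "map g w \<in> lists A" by auto
  then show ?case by (auto intro: plactic_cong.refl)
next
  case (knuth_sym v w)
  have "g ` set v \<subseteq> A" using knuth_sym.prems knuth_set[OF knuth_sym.hyps] by simp
  from knuth_sym.IH[OF this] show ?case
    using plactic_cong.sym[of "map g v" "map g w" A sg] by blast
next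
  case (knuth_trans u v w)
  have "g ` set v \<subseteq> A" using knuth_trans.prems knuth_set[OF knuth_trans.hyps(1)] by simp
  from knuth_trans.IH(1)[OF knuth_trans.prems] knuth_trans.IH(2)[OF this] show ?case
    using plactic_cong.trans[of "map g u" "map g v" A sg "map g w"] by blast
next
  case (knuth_append u u' v v')
  have s: "set u' = set u" "set v' = set v" using knuth_append.hyps knuth_set by metis+
  have "g ` set u \<subseteq> A" "g ` set v \<subseteq> A" using knuth_append.prems by auto
  then show ?case using knuth_append.IH unfolding std_compat_append s map_append by (blast intro: plactic_cong.append)
next
  case (knuth_xzy x y z)
  have m: "g x \<le> g y" "g y \<le> g z" using knuth_xzy assms(2) by (auto simp: mono_def)
  have A: "g x \<in> A" "g y \<in> A" "g z \<in> A" using knuth_xzy by auto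
  then have sgA: "sg (g x) \<in> {0, 1}" "sg (g y) \<in> {0, 1}" "sg (g z) \<in> {0, 1}" using assms(3) by auto
  have iff: "std_compat g sg [x, z, y] \<longleftrightarrow> std_compat g sg [z, x, y]"
    using knuth_xzy m by (auto simp: std_compat_triple)
  have "(map g [x, z, y], map g [z, x, y]) \<in> plactic_cong A sg" if "std_compat g sg [x, z, y]"
    using that knuth_xzy(1,2) m A sgA by (auto simp: std_compat_triple intro!: plactic_cong.xzy)
  with iff show ?case by blast
next
  case (knuth_yxz x y z)
  have m: "g x \<le> g y" "g y \<le> g z" using knuth_yxz assms(2) by (auto simp: mono_def)
  have A: "g x \<in> A" "g y \<in> A" "g z \<in> A" using knuth_yxz by auto
  then have sgA: "sg (g x) \<in> {0, 1}" "sg (g y) \<in> {0, 1}" "sg (g z) \<in> {0, 1}" using assms(3) by auto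
  have iff: "std_compat g sg [y, x, z] \<longleftrightarrow> std_compat g sg [y, z, x]"
    using knuth_yxz m by (auto simp: std_compat_triple)
  have "(map g [y, x, z], map g [y, z, x]) \<in> plactic_cong A sg" if "std_compat g sg [y, x, z]"
    using that knuth_yxz(1,2) m A sgA by (auto simp: std_compat_triple intro!: plactic_cong.yxz)
  with iff show ?case by blast
qed

lemma plactic_cong_imp_knuth:
  fixes g :: "nat \<Rightarrow> 'a::linorder"
  assumes "(v, w) \<in> plactic_cong A sg" "mono g"
  shows "(\<forall>s. std_compat g sg s \<longrightarrow> map g s = v \<longrightarrow> (\<exists>t. knuth s t \<and> std_compat g sg t \<and> map g t = w)) \<and>
    (\<forall>t. std_compat g sg t \<longrightarrow> map g t = w \<longrightarrow> (\<exists>s. knuth t s \<and> std_compat g sg s \<and> map g s = v))"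
  using assms(1)
proof (induction rule: plactic_cong.induct)
  case (refl w)
  then show ?case by blast
next
  case (sym v w)
  then show ?case by blast
next
  case (trans u v w)
  have half: "\<exists>t. knuth s t \<and> std_compat g sg t \<and> map g t = c"
    if IH: "\<forall>s. std_compat g sg s \<longrightarrow> map g s = a \<longrightarrow> (\<exists>t. knuth s t \<and> std_compat g sg t \<and> map g t = b)"
      "\<forall>s. std_compat g sg s \<longrightarrow> map g s = b \<longrightarrow> (\<exists>t. knuth s t \<and> std_compat g sg t \<and> map g t = c)"
    and s: "std_compat g sg s" "map g s = a" for a b c s
  proof -
    obtain t where t: "knuth s t" "std_compat g sg t" "map g t = b" using IH(1) s by blast
    then obtain r where "knuth t r" "std_compat g sg r" "map g r = c" using IH(2) by blast
    then show ?thesis using t(1) knuth_trans by blast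
  qed
  show ?case
  proof (intro conjI allI impI)
    show "\<exists>t. knuth s t \<and> std_compat g sg t \<and> map g t = w" if "std_compat g sg s" "map g s = u" for s
      using half[of u v w s] trans.IH that by simp
    show "\<exists>s. knuth t s \<and> std_compat g sg s \<and> map g s = u" if "std_compat g sg t" "map g t = w" for t
      using half[of w v u t] trans.IH that by simp
  qed
next
  case (append u u' v v')
  have half: "\<exists>t. knuth s t \<and> std_compat g sg t \<and> map g t = u' @ v'"
    if IH: "\<forall>s. std_compat g sg s \<longrightarrow> map g s = u \<longrightarrow> (\<exists>t. knuth s t \<and> std_compat g sg t \<and> map g t = u')"
      "\<forall>s. std_compat g sg s \<longrightarrow> map g s = v \<longrightarrow> (\<exists>t. knuth s t \<and> std_compat g sg t \<and> map g t = v')"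
    and s: "std_compat g sg s" "map g s = u @ v" for s u u' v v'
  proof -
    obtain s1 s2 where s12: "s = s1 @ s2" "map g s1 = u" "map g s2 = v"
      using s(2) by (auto simp: map_eq_append_conv)
    then obtain t1 t2 where t: "knuth s1 t1" "std_compat g sg t1" "map g t1 = u'"
      "knuth s2 t2" "std_compat g sg t2" "map g t2 = v'"
      using IH s(1) std_compat_append by metis
    then have "knuth s (t1 @ t2)" "map g (t1 @ t2) = u' @ v'" using s12 knuth_append by auto
    moreover have "std_compat g sg (t1 @ t2)"
      using s(1) t knuth_set[OF t(1)] knuth_set[OF t(4)] unfolding s12 std_compat_append by simp
    ultimately show ?thesis by blast
  qed
  show ?case
  proof (intro conjI allI impI)
    show "\<exists>t. knuth s t \<and> std_compat g sg t \<and> map g t = u' @ v'"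
      if "std_compat g sg s" "map g s = u @ v" for s
      using half[of u u' v v' s] append.IH that by simp
    show "\<exists>s. knuth t s \<and> std_compat g sg s \<and> map g s = u @ v"
      if "std_compat g sg t" "map g t = u' @ v'" for t
      using half[of u' u v' v t] append.IH that by simp
  qed
next
  case (xzy x y z)
  have *: "a < c \<and> c < b" if "g a = x" "g b = z" "g c = y"
    "g a = g c \<longrightarrow> (if sg (g a) = 0 then a < c else c < a)" "g b = g c \<longrightarrow> (if sg (g b) = 0 then b < c else c < b)" for a b c
    using that xzy mono_less_imp_less[OF assms(2), of a c] mono_less_imp_less[OF assms(2), of c b]
    by (auto simp: order_le_less)
  have 1: "\<exists>t. knuth s t \<and> std_compat g sg t \<and> map g t = [z, x, y]" if s: "std_compat g sg s" "map g s = [x, z, y]" for s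
  proof -
    obtain a b c where abc: "s = [a, b, c]" "g a = x" "g b = z" "g c = y" using s(2) by auto
    have lt: "a < c" "c < b" using * [OF abc(2-4)] s(1) by (auto simp: abc(1) std_compat_triple)
    have "\<not> (g a = g b)" using s(1) lt xzy abc by (auto simp: std_compat_triple)
    then have "std_compat g sg [b, a, c]" using s(1) by (auto simp: abc(1) std_compat_triple)
    then show ?thesis using knuth_xzy[OF lt] abc by (intro exI[of _ "[b, a, c]"]) auto
  qed
  have 2: "\<exists>t. knuth s t \<and> std_compat g sg t \<and> map g t = [x, z, y]" if s: "std_compat g sg s" "map g s = [z, x, y]" for s
  proof -
    obtain a b c where abc: "s = [b, a, c]" "g a = x" "g b = z" "g c = y" using s(2) by auto
    have lt: "a < c" "c < b" using * [OF abc(2-4)] s(1) by (auto simp: abc(1) std_compat_triple)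
    have "\<not> (g a = g b)" using s(1) lt xzy abc by (auto simp: std_compat_triple)
    then have "std_compat g sg [a, b, c]" using s(1) by (auto simp: abc(1) std_compat_triple)
    then show ?thesis using knuth_sym[OF knuth_xzy[OF lt]] abc by (intro exI[of _ "[a, b, c]"]) auto
  qed
  show ?case using 1 2 by blast
next
  case (yxz x y z)
  have *: "a < c \<and> c < b" if "g a = x" "g b = z" "g c = y"
    "g c = g a \<longrightarrow> (if sg (g c) = 0 then c < a else a < c)" "g c = g b \<longrightarrow> (if sg (g c) = 0 then c < b else b < c)" for a b c
    using that yxz mono_less_imp_less[OF assms(2), of a c] mono_less_imp_less[OF assms(2), of c b]
    by (auto simp: order_le_less)
  have 1: "\<exists>t. knuth s t \<and> std_compat g sg t \<and> map g t = [y, z, x]" if s: "std_compat g sg s" "map g s = [y, x, z]" for s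
  proof -
    obtain a b c where abc: "s = [c, a, b]" "g a = x" "g b = z" "g c = y" using s(2) by auto
    have lt: "a < c" "c < b" using * [OF abc(2-4)] s(1) by (auto simp: abc(1) std_compat_triple)
    have "\<not> (g a = g b)" using s(1) lt yxz abc by (auto simp: std_compat_triple)
    then have "std_compat g sg [c, b, a]" using s(1) by (auto simp: abc(1) std_compat_triple)
    then show ?thesis using knuth_yxz[OF lt] abc by (intro exI[of _ "[c, b, a]"]) auto
  qed
  have 2: "\<exists>t. knuth s t \<and> std_compat g sg t \<and> map g t = [y, x, z]" if s: "std_compat g sg s" "map g s = [y, z, x]" for s
  proof -
    obtain a b c where abc: "s = [c, b, a]" "g a = x" "g b = z" "g c = y" using s(2) by auto
    have lt: "a < c" "c < b" using * [OF abc(2-4)] s(1) by (auto simp: abc(1) std_compat_triple)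
    have "\<not> (g a = g b)" using s(1) lt yxz abc by (auto simp: std_compat_triple)
    then have "std_compat g sg [c, a, b]" using s(1) by (auto simp: abc(1) std_compat_triple)
    then show ?thesis using knuth_sym[OF knuth_yxz[OF lt]] abc by (intro exI[of _ "[c, a, b]"]) auto
  qed
  show ?case using 1 2 by blast
qed

lemma standardization_exists:
  fixes w :: "'a::linorder list"
  obtains g s where "mono g" "distinct s" "set s = {b..<b + length w}" "map g s = w" "std_compat g sg s"
proof (cases "w = []")
  case True
  have "mono (\<lambda>_ :: nat. undefined :: 'a)" by (simp add: mono_def)
  then show ?thesis using True by (intro that[of "\<lambda>_. undefined" "[]"]) (auto simp: std_compat_def)
next
  case False
  define n where "n = length w"
  have n: "n > 0" using False by (simp add: n_def)
  define lt where "lt p q \<longleftrightarrow> w ! p < w ! q \<or> w ! p = w ! q \<and> (if sg (w ! p) = 0 then p < q else q < p)" for p q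
  have trans: "lt p r" if "lt p q" "lt q r" for p q r
    using that unfolding lt_def by (auto split: if_splits)
  have irrefl: "\<not> lt p p" for p unfolding lt_def by auto
  have total: "lt p q \<or> lt q p \<or> p = q" for p q unfolding lt_def by auto
  define rk where "rk p = card {q \<in> {..<n}. lt q p}" for p
  have rk_less: "rk p < rk q" if "lt p q" "p < n" for p q
  proof -
    have "{r \<in> {..<n}. lt r p} \<subset> {r \<in> {..<n}. lt r q}" using that trans[OF _ that(1)] irrefl by blast
    then show ?thesis unfolding rk_def by (intro psubset_card_mono) auto
  qed
  have rk_bound: "rk p < n" if "p < n" for p
  proof -
    have "rk p < card {..<n}" unfolding rk_def using that irrefl by (intro psubset_card_mono) auto
    then show ?thesis by simp
  qed
  have inj: "inj_on rk {..<n}"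
    using total rk_less by (intro inj_onI) (metis lessThan_iff less_irrefl)
  have img: "rk ` {..<n} = {..<n}"
    using rk_bound inj by (intro card_subset_eq) (auto simp: card_image)
  define g where "g k = w ! the_inv_into {..<n} rk (min (k - b) (n - 1))" for k
  have pos: "the_inv_into {..<n} rk r < n" "rk (the_inv_into {..<n} rk r) = r" if "r < n" for r
    using the_inv_into_into[OF inj, of r "{..<n}"] f_the_inv_into_f[OF inj, of r] that img by auto
  show ?thesis
  proof (rule that[of g "map (\<lambda>p. b + rk p) [0..<n]"])
    show "mono g"
    proof (rule monoI)
      fix k k' :: nat assume "k \<le> k'"
      define r where "r = min (k - b) (n - 1)"
      define r' where "r' = min (k' - b) (n - 1)"
      have r: "r \<le> r'" "r < n" "r' < n" using \<open>k \<le> k'\<close> n by (auto simp: r_def r'_def)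
      then have "\<not> lt (the_inv_into {..<n} rk r') (the_inv_into {..<n} rk r)"
        using rk_less[of "the_inv_into {..<n} rk r'" "the_inv_into {..<n} rk r"] pos by force
      then show "g k \<le> g k'" unfolding g_def r_def[symmetric] r'_def[symmetric] lt_def by auto
    qed
    show "distinct (map (\<lambda>p. b + rk p) [0..<n])"
      using inj by (auto simp: distinct_map inj_on_def)
    have "set (map (\<lambda>p. b + rk p) [0..<n]) = (+) b ` rk ` {..<n}" by (auto simp: image_image)
    also have "\<dots> = {b..<b + n}" unfolding img by (auto simp: image_iff lessThan_atLeast0 intro: le_Suc_ex)
    finally show "set (map (\<lambda>p. b + rk p) [0..<n]) = {b..<b + length w}" by (simp add: n_def)
    have g_rk: "g (b + rk p) = w ! p" if "p < n" for p
    proof -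
      have "min (rk p) (n - 1) = rk p" using rk_bound[OF that] by simp
      then show ?thesis unfolding g_def using the_inv_into_f_f[OF inj, of p] that by simp
    qed
    then have "map g (map (\<lambda>p. b + rk p) [0..<n]) = map (\<lambda>p. w ! p) [0..<n]" by simp
    then show "map g (map (\<lambda>p. b + rk p) [0..<n]) = w" by (simp add: n_def map_nth)
    show "std_compat g sg (map (\<lambda>p. b + rk p) [0..<n])"
      unfolding std_compat_def sorted_wrt_map
    proof (rule sorted_wrt_mono_rel[of _ "(<)"])
      fix p q assume pq: "p \<in> set [0..<n]" "q \<in> set [0..<n]" "p < q"
      show "g (b + rk p) = g (b + rk q) \<longrightarrow>
        (if sg (g (b + rk p)) = 0 then b + rk p < b + rk q else b + rk q < b + rk p)"
        using pq g_rk[of p] g_rk[of q] rk_less[of p q] rk_less[of q p] by (auto simp: lt_def)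
    qed simp
  qed
qed

lemma card_less_inj:
  fixes E :: "nat set"
  assumes "finite E" "x \<in> E" "y \<in> E" "count_below E x = count_below E y"
  shows "x = y"
proof -
  have "count_below E x < count_below E y" if "x < y" "x \<in> E" for x y
    unfolding count_below_def using assms(1) that by (intro psubset_card_mono) auto
  then show ?thesis using assms by (metis less_irrefl linorder_neqE_nat)
qed

lemma standardization_unique:
  fixes g :: "nat \<Rightarrow> 'a::linorder"
  assumes "mono g" "distinct s" "distinct t" "set s = set t" "map g s = map g t" "std_compat g sg s" "std_compat g sg t"
  shows "s = t"
proof -
  have len: "length s = length t" using assms(5) map_eq_imp_length_eq by blast
  have geq: "g (s ! i) = g (t ! i)" if "i < length s" for i using assms(5) that len by (metis nth_map)
  have imp: "t ! i < t ! j" if ij: "i < length s" "j < length s" "s ! i < s ! j"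
    and st: "std_compat g sg s" "std_compat g sg t" "length s = length t" "\<And>i. i < length s \<Longrightarrow> g (s ! i) = g (t ! i)" for i j s t
  proof (cases "g (s ! i) = g (s ! j)")
    case True
    have "i \<noteq> j" using ij by auto
    then consider "i < j" | "j < i" by linarith
    then show ?thesis
    proof cases
      case 1
      then show ?thesis using ij st True unfolding std_compat_def sorted_wrt_iff_nth_less
        by (metis (no_types, lifting) less_asym)
    next
      case 2
      then show ?thesis using ij st True unfolding std_compat_def sorted_wrt_iff_nth_less
        by (metis (no_types, lifting) less_asym)
    qed
  next
    case False
    then have "g (s ! i) < g (s ! j)" using assms(1) ij(3) by (meson less_imp_le monoE order_le_less)
    then show ?thesis using ij st mono_less_imp_less[OF assms(1)] by metis
  qed
  have iff: "s ! i < s ! j \<longleftrightarrow> t ! i < t ! j" if "i < length s" "j < length s" for i j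
    using imp[of i s j t] imp[of i t j s] that assms(6,7) len geq by metis
  have count_below: "count_below (set u) x = card {j. j < length u \<and> u ! j < x}" if "distinct u" for u x
  proof -
    have "{c \<in> set u. c < x} = (!) u ` {j. j < length u \<and> u ! j < x}" by (auto simp: in_set_conv_nth)
    moreover have "inj_on ((!) u) {j. j < length u \<and> u ! j < x}"
      using that by (auto simp: inj_on_def nth_eq_iff_index_eq)
    ultimately show ?thesis by (simp add: count_below_def card_image)
  qed
  show ?thesis
  proof (rule nth_equalityI[OF len])
    fix i assume i: "i < length s"
    have "{j. j < length s \<and> s ! j < s ! i} = {j. j < length t \<and> t ! j < t ! i}"
      using iff[OF _ i] len by auto
    then have "count_below (set s) (s ! i) = count_below (set s) (t ! i)"
      using count_below[OF assms(2)] count_below[OF assms(3)] assms(4) by simp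
    moreover have "s ! i \<in> set s" "t ! i \<in> set s" using i len assms(4) nth_mem[of i s] nth_mem[of i t] by metis+
    ultimately show "s ! i = t ! i" using card_less_inj[of "set s"] by blast
  qed
qed

definition cells :: "(nat \<Rightarrow> nat) \<Rightarrow> (nat \<Rightarrow> nat) \<Rightarrow> nat \<Rightarrow> (nat \<times> nat) list" where
  "cells nu lam n = concat (map (\<lambda>j. map (\<lambda>i. (i, j)) (rev (filter (\<lambda>i. lam i \<le> j \<and> j < nu i) [0..<n]))) [0..<nu 0])"

definition read_before :: "nat \<times> nat \<Rightarrow> nat \<times> nat \<Rightarrow> bool" where
  "read_before c d \<longleftrightarrow> snd c < snd d \<or> snd c = snd d \<and> fst d < fst c"

lemma sorted_cells: "sorted_wrt read_before (cells nu lam n)"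
proof -
  have *: "sorted_wrt read_before (concat (map (\<lambda>j. map (\<lambda>i. (i, j)) (f j)) [0..<k]))"
    if "\<And>j. sorted_wrt (>) (f j)" for f :: "nat \<Rightarrow> nat list" and k
  proof (induction k)
    case (Suc k)
    have "sorted_wrt read_before (map (\<lambda>i. (i, k)) (f k))"
      unfolding sorted_wrt_map by (rule sorted_wrt_mono_rel[OF _ that]) (auto simp: read_before_def)
    moreover have "read_before c d" if "c \<in> set (concat (map (\<lambda>j. map (\<lambda>i. (i, j)) (f j)) [0..<k]))"
      "d \<in> set (map (\<lambda>i. (i, k)) (f k))" for c d
      using that by (auto simp: read_before_def)
    ultimately show ?case using Suc by (simp add: sorted_wrt_append)
  qed simp
  show ?thesis
    unfolding cells_def by (rule *, unfold sorted_wrt_rev, intro sorted_wrt_filter) simp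
qed

lemma sorted_wrt_irrefl_distinct: "sorted_wrt R xs \<Longrightarrow> (\<And>x. \<not> R x x) \<Longrightarrow> distinct xs"
  by (induction xs) auto

lemma distinct_cells: "distinct (cells nu lam n)"
  by (rule sorted_wrt_irrefl_distinct[OF sorted_cells]) (simp add: read_before_def)

lemma set_cells:
  assumes "antimono nu" "\<forall>i\<ge>n. nu i = 0"
  shows "set (cells nu lam n) = skew_diagram nu lam"
proof -
  have "i < n" if "j < nu i" for i j using assms(2) that by (metis not_less not_less0)
  moreover have "j < nu 0" if "j < nu i" for i j
    using assms(1) that unfolding antimono_def by (meson le0 less_le_trans)
  ultimately show ?thesis by (fastforce simp: cells_def skew_diagram_def)
qed

lemma column_reading_cells:
  assumes "dom F = skew_diagram nu lam" "antimono nu" "\<forall>i\<ge>n. nu i = 0"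
  shows "column_reading F = map (\<lambda>c. the (F c)) (cells nu lam n)"
  using column_reading_upt[of F nu lam n] assms unfolding cells_def by (simp add: map_concat comp_def)

lemma partitionsD:
  assumes "lam \<in> partitions"
  shows "antimono lam" "\<exists>n. \<forall>i\<ge>n. lam i = 0"
proof -
  show "antimono lam" using assms by (simp add: partitions_def)
  have "finite {i. lam i \<noteq> 0}" using assms by (simp add: partitions_def)
  then obtain n where "\<forall>i\<in>{i. lam i \<noteq> 0}. i < n" using finite_nat_set_iff_bounded by blast
  then show "\<exists>n. \<forall>i\<ge>n. lam i = 0" by (intro exI[of _ n]) (metis leD mem_Collect_eq)
qed

lemma column_reading_map_option:
  assumes "dom F = skew_diagram nu lam" "nu \<in> partitions"
  shows "column_reading (map_option g \<circ> F) = map g (column_reading F)"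
proof -
  obtain n where n: "\<forall>i\<ge>n. nu i = 0" using partitionsD(2)[OF assms(2)] by blast
  have d: "dom (map_option g \<circ> F) = skew_diagram nu lam" unfolding assms(1)[symmetric] by (auto simp: dom_def)
  have "the (map_option g (F c)) = g (the (F c))" if "c \<in> set (cells nu lam n)" for c
  proof -
    have "c \<in> dom F" using that set_cells[OF partitionsD(1)[OF assms(2)] n] assms(1) by simp
    then show ?thesis by auto
  qed
  then show ?thesis
    unfolding column_reading_cells[OF d partitionsD(1)[OF assms(2)] n] column_reading_cells[OF assms(1) partitionsD(1)[OF assms(2)] n]
    by simp
qed

lemma column_reading_nth:
  assumes "dom F = skew_diagram nu lam" "nu \<in> partitions" "F c = Some x" "F d = Some y" "read_before c d"
  obtains k m where "k < m" "m < length (column_reading F)" "column_reading F ! k = x" "column_reading F ! m = y"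
proof -
  obtain n where n: "\<forall>i\<ge>n. nu i = 0" using partitionsD(2)[OF assms(2)] by blast
  note an = partitionsD(1)[OF assms(2)]
  have "c \<in> set (cells nu lam n)" "d \<in> set (cells nu lam n)" using assms(1,3,4) set_cells[OF an n] by auto
  then obtain k m where km: "k < length (cells nu lam n)" "cells nu lam n ! k = c"
    "m < length (cells nu lam n)" "cells nu lam n ! m = d" by (metis in_set_conv_nth)
  have "k < m"
  proof (rule ccontr)
    assume "\<not> k < m"
    then have "k = m \<or> m < k" by auto
    then show False
      using km assms(5) sorted_cells[of nu lam n] unfolding sorted_wrt_iff_nth_less
      by (metis (no_types, lifting) less_asym less_irrefl read_before_def)
  qed
  then show ?thesis
    using that[of k m] km assms(3,4) by (simp add: column_reading_cells[OF assms(1) an n])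
qed

lemma standard_super_skew:
  fixes g :: "nat \<Rightarrow> 'a::linorder"
  assumes "S \<in> super_skew_tableaux A sg nu lam" "nu \<in> partitions"
    "column_reading S = map g s" "mono g" "distinct s" "std_compat g sg s"
  shows "\<exists>F. std_filling nu lam F \<and> column_reading F = s \<and> S = map_option g \<circ> F"
proof -
  obtain n where n: "\<forall>i\<ge>n. nu i = 0" using partitionsD(2)[OF assms(2)] by blast
  note an = partitionsD(1)[OF assms(2)]
  have dS: "dom S = skew_diagram nu lam" using assms(1) by (simp add: super_skew_tableaux_def)
  let ?c = "cells nu lam n"
  have len: "length ?c = length s"
    using arg_cong[OF assms(3), of length] by (simp add: column_reading_cells[OF dS an n])
  define F where "F = map_of (zip ?c s)"
  have dF: "dom F = skew_diagram nu lam" using len set_cells[OF an n] by (simp add: F_def)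
  have F: "F (?c ! k) = Some (s ! k)" if "k < length s" for k
    unfolding F_def using len that distinct_cells by (intro map_of_zip_nth) auto
  have cr: "column_reading F = s"
    unfolding column_reading_cells[OF dF an n] using F len by (intro nth_equalityI) auto
  have S: "S = map_option g \<circ> F"
  proof
    fix c
    show "S c = (map_option g \<circ> F) c"
    proof (cases "c \<in> skew_diagram nu lam")
      case True
      then obtain k where k: "k < length s" "?c ! k = c" using set_cells[OF an n] len by (metis in_set_conv_nth)
      have "the (S c) = g (s ! k)"
        using arg_cong[OF assms(3), of "\<lambda>l. l ! k"] k len by (simp add: column_reading_cells[OF dS an n])
      moreover have "c \<in> dom S" using True dS by simp
      ultimately show ?thesis using F[OF k(1)] k(2) by auto
    next
      case False
      then show ?thesis using dS dF by (metis comp_apply domIff option.map_disc_iff)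
    qed
  qed
  have rel: "g x = g y \<longrightarrow> (if sg (g x) = 0 then x < y else y < x)"
    if cd: "F c = Some x" "F d = Some y" "read_before c d" for c d x y
    using column_reading_nth[OF dF assms(2) cd] assms(6) unfolding cr std_compat_def sorted_wrt_iff_nth_less
    by metis
  have "std_filling nu lam F"
    unfolding std_filling_def
  proof (intro conjI allI impI)
    show "dom F = skew_diagram nu lam" by (rule dF)
    show "inj_on F (dom F)"
    proof (rule inj_onI)
      fix c d assume cd: "c \<in> dom F" "d \<in> dom F" "F c = F d"
      then obtain k m where km: "k < length s" "?c ! k = c" "m < length s" "?c ! m = d"
        using dF set_cells[OF an n] len by (metis in_set_conv_nth)
      then have "s ! k = s ! m" using F cd(3) by (metis option.inject)
      then show "c = d" using km assms(5) by (simp add: nth_eq_iff_index_eq)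
    qed
    fix i j x y
    show "x < y" if xy: "F (i, j) = Some x" "F (i, j + 1) = Some y"
    proof -
      have "S (i, j) = Some (g x)" "S (i, j + 1) = Some (g y)" using xy S by auto
      then have "g x \<le> g y" "g x = g y \<longrightarrow> sg (g x) = 0"
        using assms(1) unfolding super_skew_tableaux_def by blast+
      then show ?thesis using rel[OF xy] mono_less_imp_less[OF assms(4), of x y]
        by (auto simp: read_before_def order_le_less)
    qed
    show "x < y" if xy: "F (i, j) = Some x" "F (i + 1, j) = Some y"
    proof -
      have "S (i, j) = Some (g x)" "S (i + 1, j) = Some (g y)" using xy S by auto
      then have "g x \<le> g y" "g x = g y \<longrightarrow> sg (g x) = 1"
        using assms(1) unfolding super_skew_tableaux_def by blast+
      then show ?thesis using rel[OF xy(2,1)] mono_less_imp_less[OF assms(4), of x y]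
        by (auto simp: read_before_def order_le_less)
    qed
  qed
  then show ?thesis using cr S by blast
qed

lemma super_skew_of_standard:
  fixes g :: "nat \<Rightarrow> 'a::linorder"
  assumes "std_filling nu lam F" "nu \<in> partitions" "mono g" "std_compat g sg (column_reading F)"
    "g ` ran F \<subseteq> A" "sg \<in> A \<rightarrow> {0, 1}"
  shows "map_option g \<circ> F \<in> super_skew_tableaux A sg nu lam"
proof -
  have dF: "dom F = skew_diagram nu lam" using assms(1) by (simp add: std_filling_def)
  have rel: "g x = g y \<longrightarrow> (if sg (g x) = 0 then x < y else y < x)"
    if cd: "F c = Some x" "F d = Some y" "read_before c d" for c d x y
    using column_reading_nth[OF dF assms(2) cd] assms(4) unfolding std_compat_def sorted_wrt_iff_nth_less
    by metis
  have sgA: "sg (g x) \<in> {0, 1}" if "F c = Some x" for c x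
  proof -
    have "g x \<in> A" using assms(5) ranI[of F c x] that by blast
    then show ?thesis using assms(6) by blast
  qed
  show ?thesis
    unfolding super_skew_tableaux_def
  proof (intro CollectI conjI allI)
    show "dom (map_option g \<circ> F) = skew_diagram nu lam" unfolding dF[symmetric] by (auto simp: dom_def)
    show "ran (map_option g \<circ> F) \<subseteq> A" using assms(5) by (auto simp: ran_def)
    fix i j u v
    show "(map_option g \<circ> F) (i, j) = Some u \<longrightarrow> (map_option g \<circ> F) (i, j + 1) = Some v \<longrightarrow>
      u \<le> v \<and> (u = v \<longrightarrow> sg u = 0)"
    proof (intro impI)
      assume "(map_option g \<circ> F) (i, j) = Some u" "(map_option g \<circ> F) (i, j + 1) = Some v"
      then obtain x y where xy: "F (i, j) = Some x" "F (i, j + 1) = Some y" "u = g x" "v = g y" by auto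
      have "x < y" using assms(1) xy unfolding std_filling_def by blast
      moreover have "g x \<le> g y" using \<open>x < y\<close> assms(3) by (simp add: mono_def)
      moreover have "g x = g y \<longrightarrow> (if sg (g x) = 0 then x < y else y < x)"
        by (rule rel[OF xy(1,2)]) (simp add: read_before_def)
      ultimately show "u \<le> v \<and> (u = v \<longrightarrow> sg u = 0)" using xy(3,4) by (auto split: if_splits)
    qed
    show "(map_option g \<circ> F) (i, j) = Some u \<longrightarrow> (map_option g \<circ> F) (i + 1, j) = Some v \<longrightarrow>
      u \<le> v \<and> (u = v \<longrightarrow> sg u = 1)"
    proof (intro impI)
      assume "(map_option g \<circ> F) (i, j) = Some u" "(map_option g \<circ> F) (i + 1, j) = Some v"
      then obtain x y where xy: "F (i, j) = Some x" "F (i + 1, j) = Some y" "u = g x" "v = g y" by auto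
      have "x < y" using assms(1) xy unfolding std_filling_def by blast
      moreover have "g x \<le> g y" using \<open>x < y\<close> assms(3) by (simp add: mono_def)
      moreover have "g y = g x \<longrightarrow> (if sg (g y) = 0 then y < x else x < y)"
        by (rule rel[OF xy(2,1)]) (simp add: read_before_def)
      ultimately show "u \<le> v \<and> (u = v \<longrightarrow> sg u = 1)" using xy(3,4) sgA[OF xy(1)] by (auto split: if_splits)
    qed
  qed
qed


section \<open>Factorizations and recording tableaux\<close>

lemma filter_ge_row_word:
  assumes "\<And>i. finite (R i)"
  shows "filter (\<lambda>x. m \<le> x) (row_word n R) = row_word n (\<lambda>i. R i \<inter> {m..})"
proof -
  have "filter (\<lambda>x. m \<le> x) (sorted_list_of_set (R i)) = sorted_list_of_set (R i \<inter> {m..})" for i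
    using assms[of i] by (intro sorted_list_of_set_eqI[symmetric]) (auto intro!: sorted_wrt_filter)
  then show ?thesis by (simp add: row_word_def filter_concat comp_def)
qed

lemma ins_rows_eq_imp_knuth:
  assumes "distinct v" "distinct w" "ins_rows v = ins_rows w"
  shows "knuth v w"
proof -
  define n where "n = max (length v) (length w)"
  have "knuth v (row_word n (ins_rows v))" by (rule knuth_row_word_ins_rows[OF assms(1) ins_rows_eq_empty[OF assms(1)]]) (simp add: n_def)
  moreover have "knuth w (row_word n (ins_rows w))" by (rule knuth_row_word_ins_rows[OF assms(2) ins_rows_eq_empty[OF assms(2)]]) (simp add: n_def)
  ultimately show ?thesis using assms(3) knuth_trans knuth_sym by metis
qed

lemma tableau_card_mono: "tableau R \<Longrightarrow> card (R (Suc i)) \<le> card (R i)"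
proof -
  assume R: "tableau R"
  then have fin: "finite (R i)" for i by (simp add: tableau_def)
  obtain a where "\<forall>c\<in>R i \<union> R (Suc i). c < a"
    using fin finite_nat_set_iff_bounded[of "R i \<union> R (Suc i)"] by auto
  then have "count_below (R i) a = card (R i)" "count_below (R (Suc i)) a = card (R (Suc i))"
    by (auto intro: count_below_eq_card)
  moreover have "count_below (R (Suc i)) a \<le> count_below (R i) a" using R by (simp add: tableau_def)
  ultimately show ?thesis by simp
qed

lemma
  assumes "std_filling nu (\<lambda>_. 0) F" "nu \<in> partitions"
  shows ins_rows_column_reading: "ins_rows (column_reading F) = filling_rows F"
    and tableau_filling_rows: "tableau (filling_rows F)"
    and card_filling_rows: "card (filling_rows F i) = nu i"
    and distinct_column_reading_straight: "distinct (column_reading F)"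
proof -
  obtain n where n: "\<forall>i\<ge>n. nu i = 0" using partitionsD(2)[OF assms(2)] by blast
  have z: "antimono (\<lambda>_ :: nat. 0 :: nat)" by (simp add: antimono_def)
  have "skew_tableau nu (\<lambda>_. 0) (filling_rows F)"
    by (rule skew_tableau_filling_rows[OF assms(1) z partitionsD(1)[OF assms(2)]]) simp
  then have T: "tableau (filling_rows F)" "\<And>i. card (filling_rows F i) = nu i" by (auto simp: skew_tableau_straight)
  then show "tableau (filling_rows F)" "card (filling_rows F i) = nu i" by auto
  have e: "filling_rows F i = {}" if "n \<le> i" for i
    using T(2)[of i] that n finite_filling_rows[OF assms(1), of i] by simp
  have k: "knuth (row_word n (filling_rows F)) (column_reading F)"
    by (rule knuth_column_reading[OF assms(1) z partitionsD(1)[OF assms(2)]]) (use n in blast)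
  show "distinct (column_reading F)" using knuth_distinct[OF k] distinct_row_word[OF T(1)] by simp
  show "ins_rows (column_reading F) = filling_rows F"
    using ins_rows_knuth[OF k distinct_row_word[OF T(1)]] ins_rows_row_word[OF T(1) e] by simp
qed

lemma
  assumes "distinct w"
  defines "nu \<equiv> \<lambda>i. card (ins_rows w i)"
  shows partition_shape_ins_rows: "nu \<in> partitions"
    and std_filling_fill_ins_rows: "std_filling nu (\<lambda>_. 0) (fill (\<lambda>_. 0) (ins_rows w))"
    and filling_rows_fill_ins_rows: "filling_rows (fill (\<lambda>_. 0) (ins_rows w)) = ins_rows w"
    and knuth_column_reading_fill_ins_rows: "knuth (column_reading (fill (\<lambda>_. 0) (ins_rows w))) w"
proof -
  have s: "nu (Suc i) \<le> nu i" for i using tableau_card_mono[OF tableau_ins_rows[OF assms(1)]] by (simp add: nu_def)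
  have "antimono nu" by (rule antimonoI) (rule lift_Suc_antimono_le[of nu, OF s])
  moreover have "finite {i. nu i \<noteq> 0}"
  proof (rule finite_subset)
    show "{i. nu i \<noteq> 0} \<subseteq> {..<length w}"
    proof
      fix i assume "i \<in> {i. nu i \<noteq> 0}"
      then show "i \<in> {..<length w}"
        using ins_rows_eq_empty[OF assms(1), of i] by (cases "length w \<le> i") (auto simp: nu_def)
    qed
  qed simp
  ultimately show p: "nu \<in> partitions" by (simp add: partitions_def)
  have "skew_tableau nu (\<lambda>_. 0) (ins_rows w)" using tableau_ins_rows[OF assms(1)] by (simp add: skew_tableau_straight nu_def)
  from std_filling_fill[OF this] filling_rows_fill[OF this]
  show f: "std_filling nu (\<lambda>_. 0) (fill (\<lambda>_. 0) (ins_rows w))" "filling_rows (fill (\<lambda>_. 0) (ins_rows w)) = ins_rows w" by auto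
  show "knuth (column_reading (fill (\<lambda>_. 0) (ins_rows w))) w"
    using ins_rows_eq_imp_knuth[OF distinct_column_reading_straight[OF f(1) p] assms(1)]
      ins_rows_column_reading[OF f(1) p] f(2) by simp
qed

lemma set_column_reading:
  assumes "dom F = skew_diagram nu lam" "nu \<in> partitions"
  shows "set (column_reading F) = ran F"
proof -
  obtain n where n: "\<forall>i\<ge>n. nu i = 0" using partitionsD(2)[OF assms(2)] by blast
  have "set (column_reading F) = (\<lambda>c. the (F c)) ` dom F"
    unfolding column_reading_cells[OF assms(1) partitionsD(1)[OF assms(2)] n]
    using set_cells[OF partitionsD(1)[OF assms(2)] n] assms(1) by simp
  also have "\<dots> = ran F" by (force simp: ran_def dom_def)
  finally show ?thesis .
qed

lemma column_reading_inj:
  assumes "dom F = skew_diagram nu lam" "dom F' = skew_diagram nu lam" "nu \<in> partitions"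
    "column_reading F = column_reading F'"
  shows "F = F'"
proof
  fix c
  obtain n where n: "\<forall>i\<ge>n. nu i = 0" using partitionsD(2)[OF assms(3)] by blast
  note an = partitionsD(1)[OF assms(3)]
  show "F c = F' c"
  proof (cases "c \<in> skew_diagram nu lam")
    case True
    have "the (F c) = the (F' c)"
      using assms(4) True set_cells[OF an n]
      unfolding column_reading_cells[OF assms(1) an n] column_reading_cells[OF assms(2) an n] by simp
    moreover have "c \<in> dom F" "c \<in> dom F'" using True assms by auto
    ultimately show ?thesis by auto
  next
    case False
    then show ?thesis using assms(1,2) by (metis domIff)
  qed
qed

lemma column_reading_in_lists:
  assumes "S \<in> super_skew_tableaux A sg nu lam" "nu \<in> partitions"
  shows "column_reading S \<in> lists A"
  using set_column_reading[of S nu lam] assms by (auto simp: super_skew_tableaux_def)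

lemma super_tableaux_dom: "t \<in> super_tableaux A sg nu \<Longrightarrow> dom t = skew_diagram nu (\<lambda>_. 0)"
  by (simp add: super_tableaux_def super_skew_tableaux_def)

lemma super_tableaux_shape_unique:
  assumes "t \<in> super_tableaux A sg nu" "t \<in> super_tableaux A sg kap"
  shows "nu = kap"
proof
  fix i
  have "skew_diagram nu (\<lambda>_. 0) = skew_diagram kap (\<lambda>_. 0)"
    using assms super_tableaux_dom by metis
  then have "j < nu i \<longleftrightarrow> j < kap i" for j by (auto simp: skew_diagram_def set_eq_iff)
  then show "nu i = kap i" by (metis linorder_neqE_nat less_irrefl)
qed

lemma super_skew_of_knuth:
  fixes g :: "nat \<Rightarrow> 'a::linorder"
  assumes "std_filling nu lam F" "nu \<in> partitions" "knuth (column_reading F) v" "mono g" "std_compat g sg v"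
    "g ` set v \<subseteq> A" "sg \<in> A \<rightarrow> {0, 1}"
  shows "map_option g \<circ> F \<in> super_skew_tableaux A sg nu lam"
    "column_reading (map_option g \<circ> F) = map g (column_reading F)"
    "(map g (column_reading F), map g v) \<in> plactic_cong A sg"
    "std_compat g sg (column_reading F)"
proof -
  have dF: "dom F = skew_diagram nu lam" using assms(1) by (simp add: std_filling_def)
  note k = knuth_imp_plactic_cong[OF knuth_sym[OF assms(3)] assms(4,7,6)]
  then show c: "std_compat g sg (column_reading F)" using assms(5) by simp
  show "(map g (column_reading F), map g v) \<in> plactic_cong A sg" using k assms(5) by (blast intro: plactic_cong.sym)
  have "ran F = set v" using set_column_reading[OF dF assms(2)] knuth_set[OF assms(3)] by simp
  then show "map_option g \<circ> F \<in> super_skew_tableaux A sg nu lam"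
    using assms by (intro super_skew_of_standard[OF assms(1,2,4) c]) auto
  show "column_reading (map_option g \<circ> F) = map g (column_reading F)"
    by (rule column_reading_map_option[OF dF assms(2)])
qed

lemma super_tableau_exists:
  assumes "w \<in> lists A" "sg \<in> A \<rightarrow> {0, 1}"
  shows "\<exists>s\<in>(\<Union>lam\<in>partitions. super_tableaux A sg lam). (column_reading s, w) \<in> plactic_cong A sg"
proof -
  obtain g v where v: "mono g" "distinct v" "map g v = w" "std_compat g sg v"
    using standardization_exists[of 0 w sg] by metis
  have A: "g ` set v \<subseteq> A" using assms(1) v(3) by auto
  note f = super_skew_of_knuth[OF std_filling_fill_ins_rows[OF v(2)] partition_shape_ins_rows[OF v(2)]
     knuth_column_reading_fill_ins_rows[OF v(2)] v(1,4) A assms(2)]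
  let ?s = "map_option g \<circ> fill (\<lambda>_. 0) (ins_rows v)"
  have "?s \<in> (\<Union>lam\<in>partitions. super_tableaux A sg lam)"
    using f(1) partition_shape_ins_rows[OF v(2)] unfolding super_tableaux_def by blast
  moreover have "(column_reading ?s, w) \<in> plactic_cong A sg" using f(2,3) v(3) by simp
  ultimately show ?thesis by blast
qed

lemma super_tableau_unique:
  assumes "s \<in> super_tableaux A sg nu" "s' \<in> super_tableaux A sg nu'" "nu \<in> partitions" "nu' \<in> partitions"
    "(column_reading s, column_reading s') \<in> plactic_cong A sg"
  shows "s = s'"
proof -
  obtain g v where v: "mono g" "distinct v" "map g v = column_reading s" "std_compat g sg v"
    using standardization_exists[of 0 "column_reading s" sg] by metis
  obtain v' where v': "knuth v v'" "std_compat g sg v'" "map g v' = column_reading s'"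
    using plactic_cong_imp_knuth[OF assms(5) v(1)] v(3,4) by blast
  obtain F where F: "std_filling nu (\<lambda>_. 0) F" "column_reading F = v" "s = map_option g \<circ> F"
    using standard_super_skew[OF _ assms(3) v(3)[symmetric] v(1,2,4)] assms(1) unfolding super_tableaux_def by metis
  have d: "distinct v'" using v'(1) v(2) knuth_distinct by metis
  obtain F' where F': "std_filling nu' (\<lambda>_. 0) F'" "column_reading F' = v'" "s' = map_option g \<circ> F'"
    using standard_super_skew[OF _ assms(4) v'(3)[symmetric] v(1) d v'(2)] assms(2) unfolding super_tableaux_def by metis
  have "filling_rows F = filling_rows F'"
    using ins_rows_column_reading[OF F(1) assms(3)] ins_rows_column_reading[OF F'(1) assms(4)] ins_rows_knuth[OF v'(1) v(2)] F(2) F'(2) by simp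
  then have "F = F'" using fill_filling_rows[OF F(1)] fill_filling_rows[OF F'(1)] by (metis le0)
  then show ?thesis using F(3) F'(3) by simp
qed

lemma tableau_product_eq_iff:
  assumes "sg \<in> A \<rightarrow> {0, 1}" "t' \<in> super_tableaux A sg lam" "t'' \<in> super_tableaux A sg mu"
    "lam \<in> partitions" "mu \<in> partitions" "s \<in> super_tableaux A sg nu" "nu \<in> partitions"
  shows "tableau_product A sg t' t'' = s \<longleftrightarrow>
    (column_reading s, column_reading t' @ column_reading t'') \<in> plactic_cong A sg"
proof -
  let ?R = "\<lambda>s. s \<in> (\<Union>lam\<in>partitions. super_tableaux A sg lam) \<and>
     (column_reading s, column_reading t' @ column_reading t'') \<in> plactic_cong A sg"
  have "column_reading t' @ column_reading t'' \<in> lists A"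
    using column_reading_in_lists[OF assms(2)[unfolded super_tableaux_def] assms(4)]
      column_reading_in_lists[OF assms(3)[unfolded super_tableaux_def] assms(5)]
    by (simp only: append_in_lists_conv)
  from super_tableau_exists[OF this assms(1)] obtain r where r: "?R r" by blast
  have u: "x = y" if xy: "?R x" "?R y" for x y
  proof -
    have "(column_reading x, column_reading y) \<in> plactic_cong A sg"
      using plactic_cong.trans[OF conjunct2[OF that(1)] plactic_cong.sym[OF conjunct2[OF that(2)]]] .
    moreover obtain nu nu' where "x \<in> super_tableaux A sg nu" "y \<in> super_tableaux A sg nu'"
      "nu \<in> partitions" "nu' \<in> partitions" using xy by blast
    ultimately show ?thesis using super_tableau_unique[of x A sg nu y nu'] by blast
  qed
  have "?R (tableau_product A sg t' t'')"
    unfolding tableau_product_def by (rule theI[of ?R, OF r]) (rule u[OF _ r])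
  moreover have "s \<in> (\<Union>lam\<in>partitions. super_tableaux A sg lam)" using assms(6,7) by blast
  ultimately show ?thesis using u by blast
qed

definition std_class :: "(nat \<Rightarrow> nat) \<Rightarrow> (nat \<Rightarrow> nat) \<Rightarrow> nat list \<Rightarrow> nat filling set" where
  "std_class nu lam v = {F. std_filling nu lam F \<and> knuth (column_reading F) v}"

lemma card_super_skew_class:
  fixes g :: "nat \<Rightarrow> 'a::linorder"
  assumes "nu \<in> partitions" "sg \<in> A \<rightarrow> {0, 1}" "mono g" "std_compat g sg v" "distinct v" "g ` set v \<subseteq> A"
  shows "card {S \<in> super_skew_tableaux A sg nu lam. (column_reading S, map g v) \<in> plactic_cong A sg} =
    card (std_class nu lam v)"
proof -
  have "bij_betw (\<lambda>F. map_option g \<circ> F) (std_class nu lam v)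
    {S \<in> super_skew_tableaux A sg nu lam. (column_reading S, map g v) \<in> plactic_cong A sg}"
  proof (rule bij_betwI')
    fix F F' assume FF: "F \<in> std_class nu lam v" "F' \<in> std_class nu lam v"
    then have F: "std_filling nu lam F" "knuth (column_reading F) v"
      and F': "std_filling nu lam F'" "knuth (column_reading F') v" by (auto simp: std_class_def)
    note f = super_skew_of_knuth[OF F(1) assms(1) F(2) assms(3,4,6,2)]
    note f' = super_skew_of_knuth[OF F'(1) assms(1) F'(2) assms(3,4,6,2)]
    have "F = F'" if e: "map_option g \<circ> F = map_option g \<circ> F'"
    proof -
      have "map g (column_reading F) = map g (column_reading F')" using e f(2) f'(2) by metis
      moreover have "distinct (column_reading F)" "distinct (column_reading F')"
        "set (column_reading F) = set (column_reading F')"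
        using knuth_distinct[OF F(2)] knuth_distinct[OF F'(2)] assms(5) knuth_set[OF F(2)] knuth_set[OF F'(2)] by auto
      ultimately have "column_reading F = column_reading F'"
        using standardization_unique[OF assms(3)] f(4) f'(4) by blast
      moreover have "dom F = skew_diagram nu lam" "dom F' = skew_diagram nu lam"
        using F(1) F'(1) by (simp_all add: std_filling_def)
      ultimately show ?thesis using column_reading_inj[OF _ _ assms(1)] by blast
    qed
    then show "(map_option g \<circ> F = map_option g \<circ> F') = (F = F')" by blast
  next
    fix F assume "F \<in> std_class nu lam v"
    then have F: "std_filling nu lam F" "knuth (column_reading F) v" by (auto simp: std_class_def)
    note f = super_skew_of_knuth[OF F(1) assms(1) F(2) assms(3,4,6,2)]
    show "map_option g \<circ> F \<in> {S \<in> super_skew_tableaux A sg nu lam. (column_reading S, map g v) \<in> plactic_cong A sg}"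
      using f by simp
  next
    fix S assume "S \<in> {S \<in> super_skew_tableaux A sg nu lam. (column_reading S, map g v) \<in> plactic_cong A sg}"
    then have S: "S \<in> super_skew_tableaux A sg nu lam" "(column_reading S, map g v) \<in> plactic_cong A sg" by auto
    then obtain u where u: "knuth v u" "std_compat g sg u" "map g u = column_reading S"
      using plactic_cong_imp_knuth[OF S(2) assms(3)] assms(4) by blast
    have d: "distinct u" using u(1) assms(5) knuth_distinct by metis
    obtain F where "std_filling nu lam F" "column_reading F = u" "S = map_option g \<circ> F"
      using standard_super_skew[OF S(1) assms(1) u(3)[symmetric] assms(3) d u(2)] by blast
    then show "\<exists>F\<in>std_class nu lam v. S = map_option g \<circ> F"
      using u(1) knuth_sym by (auto simp: std_class_def)
  qed
  then show ?thesis by (rule bij_betw_same_card[symmetric])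
qed

locale recording_split =
  fixes A :: "'a::linorder set" and sg :: "'a \<Rightarrow> nat" and g :: "nat \<Rightarrow> 'a" and s v :: "nat list"
    and nu lam mu :: "nat \<Rightarrow> nat" and T :: "nat filling" and m k :: nat and U :: "nat \<Rightarrow> nat set"
  assumes sgA: "sg \<in> A \<rightarrow> {0, 1}" and g: "mono g" "std_compat g sg s" "g ` set s \<subseteq> A"
    and T: "std_filling nu (\<lambda>_. 0) T" "column_reading T = s"
    and part: "nu \<in> partitions" "lam \<in> partitions" "mu \<in> partitions"
    and v: "distinct v" "set v = {m..<k}" "\<And>i. card (ins_rows v i) = mu i"
    and U: "tableau U" "\<And>i. card (U i) = lam i" "(\<Union>i. U i) = {..<m}"
begin

definition splits :: "((nat \<times> nat) list \<times> (nat \<times> nat) list) set" where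
  "splits = {(b, c). biword b \<and> biword c \<and> rec_rows b = U \<and> rec_rows c = ins_rows v \<and> knuth (map snd b @ map snd c) s}"

lemma distinct_s: "distinct s"
  using distinct_column_reading_straight[OF T(1) part(1)] T(2) by simp

lemma ins_rows_s: "ins_rows s = filling_rows T" "card (ins_rows s i) = nu i"
  using ins_rows_column_reading[OF T(1) part(1)] card_filling_rows[OF T(1) part(1)] T(2) by auto

lemma splitsD:
  assumes "(b, c) \<in> splits"
  shows "biword b" "biword c" "rec_rows b = U" "rec_rows c = ins_rows v" "knuth (map snd b @ map snd c) s"
    "fst ` set b = {..<m}" "fst ` set c = {m..<k}" "biword (b @ c)" "ins_rows (map snd (b @ c)) = ins_rows s"
    "rec_rows (b @ c) i \<inter> {..<m} = U i" "card (rec_rows (b @ c) i) = nu i" "length b = m"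
    "distinct (map snd b)" "distinct (map snd c)"
proof -
  show *: "biword b" "biword c" "rec_rows b = U" "rec_rows c = ins_rows v" "knuth (map snd b @ map snd c) s"
    using assms by (auto simp: splits_def)
  show l: "fst ` set b = {..<m}" "fst ` set c = {m..<k}"
    using rec_rows_Union[OF *(1)] rec_rows_Union[OF *(2)] *(3,4) U(3) ins_rows_Union[OF v(1)] v(2) by auto
  have d: "distinct (map snd (b @ c))" using knuth_distinct[OF *(5)] distinct_s by simp
  have "p < q" if "p \<in> fst ` set b" "q \<in> fst ` set c" for p q using that unfolding l by auto
  then show bc: "biword (b @ c)" using *(1,2) d by (auto simp: biword_def sorted_wrt_append)
  show "ins_rows (map snd (b @ c)) = ins_rows s" using ins_rows_knuth[OF *(5)] d by simp
  then show "card (rec_rows (b @ c) i) = nu i" using card_rec_rows[OF bc] ins_rows_s by simp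
  have "p < m" if "p \<in> fst ` set b" for p using that unfolding l by simp
  moreover have "m \<le> q" if "q \<in> fst ` set c" for q using that unfolding l by simp
  ultimately show "rec_rows (b @ c) i \<inter> {..<m} = U i" using rec_rows_append *(3) by metis
  show "length b = m" using biword_distinct_fst[OF *(1)] l(1)
    by (metis card_lessThan distinct_card length_map list.set_map)
  show "distinct (map snd b)" "distinct (map snd c)" using d by auto
qed

lemma bij_betw_factorizations:
  "bij_betw (\<lambda>(b, c). (map_option g \<circ> fill (\<lambda>_. 0) (ins_rows (map snd b)), map_option g \<circ> fill (\<lambda>_. 0) (ins_rows (map snd c))))
    splits (factorizations A sg lam mu (map_option g \<circ> T))"
proof -
  define tt where "tt = map_option g \<circ> T"
  define f where "f b = fill (\<lambda>_. 0) (ins_rows (map snd b))" for b :: "(nat \<times> nat) list"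
  have ks: "knuth (column_reading T) s" using T by simp
  note t = super_skew_of_knuth[OF T(1) part(1) ks g sgA, folded tt_def]
  have tst: "tt \<in> super_tableaux A sg nu" using t(1) by (simp add: super_tableaux_def)
  have crt: "column_reading tt = map g s" using t(2) T(2) by simp
  have pieces: "std_filling lam (\<lambda>_. 0) (f b)" "std_filling mu (\<lambda>_. 0) (f c)"
    "knuth (column_reading (f b) @ column_reading (f c)) s"
    "filling_rows (f b) = ins_rows (map snd b)" "filling_rows (f c) = ins_rows (map snd c)"
    "map_option g \<circ> f b \<in> super_tableaux A sg lam" "map_option g \<circ> f c \<in> super_tableaux A sg mu"
    "column_reading (map_option g \<circ> f b) = map g (column_reading (f b))"
    "column_reading (map_option g \<circ> f c) = map g (column_reading (f c))"
    "std_compat g sg (column_reading (f b) @ column_reading (f c))"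
    if bc: "(b, c) \<in> splits" for b c
  proof -
    note d = splitsD[OF bc]
    have "(\<lambda>i. card (ins_rows (map snd b) i)) = lam" "(\<lambda>i. card (ins_rows (map snd c) i)) = mu"
      using card_rec_rows[OF d(1)] card_rec_rows[OF d(2)] d(3,4) U(2) v(3) by auto
    with std_filling_fill_ins_rows[OF d(13)] std_filling_fill_ins_rows[OF d(14)]
    show F: "std_filling lam (\<lambda>_. 0) (f b)" "std_filling mu (\<lambda>_. 0) (f c)" by (auto simp: f_def)
    show "filling_rows (f b) = ins_rows (map snd b)" "filling_rows (f c) = ins_rows (map snd c)"
      unfolding f_def using filling_rows_fill_ins_rows[OF d(13)] filling_rows_fill_ins_rows[OF d(14)] by auto
    have kb: "knuth (column_reading (f b)) (map snd b)" and kc: "knuth (column_reading (f c)) (map snd c)"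
      unfolding f_def using knuth_column_reading_fill_ins_rows[OF d(13)] knuth_column_reading_fill_ins_rows[OF d(14)] by auto
    show kk: "knuth (column_reading (f b) @ column_reading (f c)) s"
      using knuth_append[OF kb kc] d(5) knuth_trans by blast
    have "std_compat g sg (map snd b @ map snd c)"
      using knuth_imp_plactic_cong[OF knuth_sym[OF d(5)] g(1) sgA g(3)] g(2) by simp
    then have c2: "std_compat g sg (map snd b)" "std_compat g sg (map snd c)" by (auto simp: std_compat_append)
    have "set (map snd b @ map snd c) = set s" by (rule knuth_set[OF d(5)])
    then have A2: "g ` set (map snd b) \<subseteq> A" "g ` set (map snd c) \<subseteq> A" using g(3) by auto
    from super_skew_of_knuth[OF F(1) part(2) kb g(1) c2(1) A2(1) sgA] super_skew_of_knuth[OF F(2) part(3) kc g(1) c2(2) A2(2) sgA]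
    show "map_option g \<circ> f b \<in> super_tableaux A sg lam" "map_option g \<circ> f c \<in> super_tableaux A sg mu"
      "column_reading (map_option g \<circ> f b) = map g (column_reading (f b))"
      "column_reading (map_option g \<circ> f c) = map g (column_reading (f c))"
      by (auto simp: super_tableaux_def)
    show "std_compat g sg (column_reading (f b) @ column_reading (f c))"
      using knuth_imp_plactic_cong[OF knuth_sym[OF kk] g(1) sgA g(3)] g(2) by simp
  qed
  have "bij_betw (\<lambda>(b, c). (map_option g \<circ> f b, map_option g \<circ> f c)) splits (factorizations A sg lam mu tt)"
    unfolding bij_betw_def
  proof
    show "inj_on (\<lambda>(b, c). (map_option g \<circ> f b, map_option g \<circ> f c)) splits"
    proof (rule inj_onI, clarify)
      fix b c b' c' assume bc: "(b, c) \<in> splits" and bc': "(b', c') \<in> splits"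
        and e: "map_option g \<circ> f b = map_option g \<circ> f b'" "map_option g \<circ> f c = map_option g \<circ> f c'"
      note p = pieces[OF bc] note p' = pieces[OF bc']
      note d = splitsD[OF bc] note d' = splitsD[OF bc']
      let ?w = "column_reading (f b) @ column_reading (f c)" and ?w' = "column_reading (f b') @ column_reading (f c')"
      have mg: "map g (column_reading (f b)) = map g (column_reading (f b'))"
        "map g (column_reading (f c)) = map g (column_reading (f c'))"
        using e p(8,9) p'(8,9) by metis+
      have "?w = ?w'"
      proof (rule standardization_unique[OF g(1) _ _ _ _ p(10) p'(10)])
        show "distinct ?w" "distinct ?w'" using knuth_distinct[OF p(3)] knuth_distinct[OF p'(3)] distinct_s by auto
        show "set ?w = set ?w'" using knuth_set[OF p(3)] knuth_set[OF p'(3)] by auto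
        show "map g ?w = map g ?w'" using mg by simp
      qed
      moreover have "length (column_reading (f b)) = length (column_reading (f b'))"
        using mg(1) map_eq_imp_length_eq by blast
      ultimately have cr: "column_reading (f b) = column_reading (f b')" "column_reading (f c) = column_reading (f c')" by auto
      have "ins_rows (map snd b) = ins_rows (map snd b')"
        using ins_rows_column_reading[OF p(1) part(2)] ins_rows_column_reading[OF p'(1) part(2)] cr(1) p(4) p'(4) by simp
      moreover have "ins_rows (map snd c) = ins_rows (map snd c')"
        using ins_rows_column_reading[OF p(2) part(3)] ins_rows_column_reading[OF p'(2) part(3)] cr(2) p(5) p'(5) by simp
      ultimately show "b = b' \<and> c = c'" using RSK_inj d(1-4) d'(1-4) by metis
    qed
    show "(\<lambda>(b, c). (map_option g \<circ> f b, map_option g \<circ> f c)) ` splits = factorizations A sg lam mu tt"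
    proof (rule subset_antisym; rule subsetI)
      fix x assume "x \<in> (\<lambda>(b, c). (map_option g \<circ> f b, map_option g \<circ> f c)) ` splits"
      then obtain b c where bc: "(b, c) \<in> splits" and x: "x = (map_option g \<circ> f b, map_option g \<circ> f c)" by auto
      note p = pieces[OF bc]
      have "(map g s, map g (column_reading (f b) @ column_reading (f c))) \<in> plactic_cong A sg"
        using knuth_imp_plactic_cong[OF knuth_sym[OF p(3)] g(1) sgA g(3)] g(2) by simp
      then have "tableau_product A sg (map_option g \<circ> f b) (map_option g \<circ> f c) = tt"
        using tableau_product_eq_iff[OF sgA p(6,7) part(2,3) tst part(1)] crt p(8,9) by simp
      then show "x \<in> factorizations A sg lam mu tt" using p(6,7) x by (simp add: factorizations_def)
    next
      fix x assume "x \<in> factorizations A sg lam mu tt"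
      then obtain t1 t2 where x: "x = (t1, t2)" "t1 \<in> super_tableaux A sg lam" "t2 \<in> super_tableaux A sg mu"
        "tableau_product A sg t1 t2 = tt" by (auto simp: factorizations_def)
      then have "(map g s, column_reading t1 @ column_reading t2) \<in> plactic_cong A sg"
        using tableau_product_eq_iff[OF sgA x(2,3) part(2,3) tst part(1)] crt by simp
      then obtain r where r: "knuth s r" "std_compat g sg r" "map g r = column_reading t1 @ column_reading t2"
        using plactic_cong_imp_knuth[OF _ g(1)] g(2) by metis
      then obtain r1 r2 where r12: "r = r1 @ r2" "map g r1 = column_reading t1" "map g r2 = column_reading t2"
        by (auto simp: map_eq_append_conv)
      have dr: "distinct r1" "distinct r2" using knuth_distinct[OF r(1)] distinct_s r12(1) by auto
      have cr: "std_compat g sg r1" "std_compat g sg r2" using r(2) unfolding r12(1) std_compat_append by auto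
      obtain F1 where F1: "std_filling lam (\<lambda>_. 0) F1" "column_reading F1 = r1" "t1 = map_option g \<circ> F1"
        using standard_super_skew[OF _ part(2) r12(2)[symmetric] g(1) dr(1) cr(1)] x(2)
        unfolding super_tableaux_def by metis
      obtain F2 where F2: "std_filling mu (\<lambda>_. 0) F2" "column_reading F2 = r2" "t2 = map_option g \<circ> F2"
        using standard_super_skew[OF _ part(3) r12(3)[symmetric] g(1) dr(2) cr(2)] x(3)
        unfolding super_tableaux_def by metis
      have "finite (\<Union>i. U i)" unfolding U(3) by simp
      from RSK_surj[OF tableau_filling_rows[OF F1(1) part(2)] U(1) _ this]
      obtain b where b: "biword b" "ins_rows (map snd b) = filling_rows F1" "rec_rows b = U"
        using card_filling_rows[OF F1(1) part(2)] U(2) by metis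
      have "finite (\<Union>i. ins_rows v i)" using ins_rows_Union[OF v(1)] by simp
      from RSK_surj[OF tableau_filling_rows[OF F2(1) part(3)] tableau_ins_rows[OF v(1)] _ this]
      obtain c where c: "biword c" "ins_rows (map snd c) = filling_rows F2" "rec_rows c = ins_rows v"
        using card_filling_rows[OF F2(1) part(3)] v(3) by metis
      have "knuth (map snd b) r1" "knuth (map snd c) r2"
        using ins_rows_eq_imp_knuth[of "map snd b" r1] ins_rows_eq_imp_knuth[of "map snd c" r2] b(1,2) c(1,2) dr
          ins_rows_column_reading[OF F1(1) part(2)] ins_rows_column_reading[OF F2(1) part(3)] F1(2) F2(2)
        by (auto simp: biword_def)
      then have "knuth (map snd b @ map snd c) s" using knuth_append r(1) r12(1) knuth_sym knuth_trans by metis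
      then have "(b, c) \<in> splits" using b c by (simp add: splits_def)
      moreover have "f b = F1" "f c = F2"
        unfolding f_def b(2) c(2) using fill_filling_rows[OF F1(1)] fill_filling_rows[OF F2(1)] by auto
      ultimately show "x \<in> (\<lambda>(b, c). (map_option g \<circ> f b, map_option g \<circ> f c)) ` splits"
        using x(1) F1(3) F2(3) by force
    qed
  qed
  then show ?thesis by (simp add: f_def tt_def)
qed

lemma splits_imp_contained:
  assumes "splits \<noteq> {}"
  shows "lam i \<le> nu i"
proof -
  obtain b c where bc: "(b, c) \<in> splits" using assms by auto
  note d = splitsD[OF bc]
  have "finite (rec_rows (b @ c) i)" using tableau_rec_rows[OF d(8)] by (simp add: tableau_def)
  then have "card (rec_rows (b @ c) i \<inter> {..<m}) \<le> card (rec_rows (b @ c) i)" by (intro card_mono) auto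
  then show ?thesis using d(10,11) U(2) by simp
qed

lemma bij_betw_std_class:
  assumes "\<And>i. lam i \<le> nu i"
  shows "bij_betw (\<lambda>(b, c). fill lam (\<lambda>i. rec_rows (b @ c) i \<inter> {m..})) splits (std_class nu lam v)"
proof -
  obtain n where n: "\<forall>i\<ge>n. nu i = 0" using partitionsD(2)[OF part(1)] by blast
  define N where "N = Max {n, length v, length s}"
  have N: "n \<le> N" "length v \<le> N" "length s \<le> N" by (auto simp: N_def)
  note an = partitionsD(1)[OF part(1)] note al = partitionsD(1)[OF part(2)]
  have Um: "U i \<subseteq> {..<m}" for i using U(3) by blast
  have UmD: "U i \<inter> (X \<inter> {m..}) = {}" for i X using Um[of i] by force
  have finU: "finite (U i)" for i using U(1) by (simp add: tableau_def)
  have kv: "knuth v (row_word N (ins_rows v))" using v(1) N by (intro knuth_row_word_ins_rows ins_rows_eq_empty) auto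
  have Pv: "ins_rows v i = {}" if "N \<le> i" for i using that N v(1) by (intro ins_rows_eq_empty) auto
  have tail: "knuth (row_word N (\<lambda>i. rec_rows b i \<inter> {m..})) (row_word N (rec_rows c2))"
    if b: "biword b" "b = b1 @ c2" "\<And>p. p \<in> fst ` set b1 \<Longrightarrow> p < m" "\<And>p. p \<in> fst ` set c2 \<Longrightarrow> m \<le> p" "length b \<le> N"
    for b b1 c2
  proof -
    obtain c where c: "inverse_biwords b c" using inverse_biword_exists[OF b(1)] by metis
    have e: "rec_rows b i = {}" if "N \<le> i" for i using rec_rows_eq_empty[OF b(1)] b(5) that by simp
    have c2: "biword c2" using b(1,2) by (auto simp: biword_def sorted_wrt_append)
    have e2: "rec_rows c2 i = {}" if "N \<le> i" for i using rec_rows_eq_empty[OF c2] b(2,5) that by simp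
    have "knuth (filter (\<lambda>x. m \<le> x) (map snd c)) (filter (\<lambda>x. m \<le> x) (row_word N (rec_rows b)))"
      by (rule knuth_filter_ge[OF knuth_row_word_rec_rows[OF c e]])
    moreover have "filter (\<lambda>x. m \<le> x) (map snd c) = map snd (filter (\<lambda>e. m \<le> snd e) c)"
      by (simp add: filter_map comp_def)
    moreover have "filter (\<lambda>x. m \<le> x) (row_word N (rec_rows b)) = row_word N (\<lambda>i. rec_rows b i \<inter> {m..})"
      using tableau_rec_rows[OF b(1)] by (intro filter_ge_row_word) (simp add: tableau_def)
    moreover have "inverse_biwords c2 (filter (\<lambda>e. m \<le> snd e) c)"
      using inverse_biwords_append_filter[of b1 c2 c m] c b by blast
    then have "knuth (map snd (filter (\<lambda>e. m \<le> snd e) c)) (row_word N (rec_rows c2))" using e2 by (rule knuth_row_word_rec_rows)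
    ultimately show ?thesis using knuth_sym knuth_trans by metis
  qed
  have lens: "length b \<le> N" if "knuth (map snd b) s" for b :: "(nat \<times> nat) list"
    using knuth_length[OF that] N by simp
  have skew: "skew_tableau nu lam (\<lambda>i. rec_rows (b @ c) i \<inter> {m..})" and knv: "knuth (row_word N (\<lambda>i. rec_rows (b @ c) i \<inter> {m..})) v"
    and Qd: "rec_rows (b @ c) i = U i \<union> (rec_rows (b @ c) i \<inter> {m..})"
    if bc: "(b, c) \<in> splits" for b c i
  proof -
    note d = splitsD[OF bc]
    note tQ = tableau_rec_rows[OF d(8)]
    show Qd: "rec_rows (b @ c) i = U i \<union> (rec_rows (b @ c) i \<inter> {m..})" for i
      unfolding d(10)[symmetric] Int_Un_distrib[symmetric] by auto
    have fin: "finite (rec_rows (b @ c) i)" for i using tQ by (simp add: tableau_def)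
    have "card (rec_rows (b @ c) i) = card (U i) + card (rec_rows (b @ c) i \<inter> {m..})" for i
      by (subst Qd, rule card_Un_disjoint) (use finU fin UmD in simp_all)
    then have cards: "lam i + card (rec_rows (b @ c) i \<inter> {m..}) = nu i" for i using d(11) U(2) by simp
    have count_below: "count_below (rec_rows (b @ c) i) a = lam i + count_below (rec_rows (b @ c) i \<inter> {m..}) a" if "m \<le> a" for i a
    proof -
      have "{x \<in> rec_rows (b @ c) i. x < a} = U i \<union> {x \<in> rec_rows (b @ c) i \<inter> {m..}. x < a}"
        using Qd[of i] Um[of i] that by auto
      moreover have "card (U i \<union> {x \<in> rec_rows (b @ c) i \<inter> {m..}. x < a}) = card (U i) + card {x \<in> rec_rows (b @ c) i \<inter> {m..}. x < a}"
      proof (rule card_Un_disjoint)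
        show "U i \<inter> {x \<in> rec_rows (b @ c) i \<inter> {m..}. x < a} = {}" using Um[of i] by force
      qed (use finU fin in auto)
      ultimately show ?thesis using U(2) by (simp add: count_below_def)
    qed
    show "skew_tableau nu lam (\<lambda>i. rec_rows (b @ c) i \<inter> {m..})"
      unfolding skew_tableau_def
    proof (intro conjI allI impI)
      show "finite (rec_rows (b @ c) i \<inter> {m..})" for i using fin by simp
      show "lam i + card (rec_rows (b @ c) i \<inter> {m..}) = nu i" for i by (rule cards)
      show "rec_rows (b @ c) i \<inter> {m..} \<inter> (rec_rows (b @ c) j \<inter> {m..}) = {}" if "i \<noteq> j" for i j
        using tQ that unfolding tableau_def by blast
      show "lam (Suc i) + count_below (rec_rows (b @ c) (Suc i) \<inter> {m..}) a \<le> lam i + count_below (rec_rows (b @ c) i \<inter> {m..}) a" for i a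
      proof (cases "m \<le> a")
        case True
        then show ?thesis using count_below[of a] tQ unfolding tableau_def by metis
      next
        case False
        then have "{x \<in> rec_rows (b @ c) i \<inter> {m..}. x < a} = {}" for i by auto
        then have "count_below (rec_rows (b @ c) i \<inter> {m..}) a = 0" for i unfolding count_below_def by (metis card.empty)
        then show ?thesis using al by (simp add: antimono_def del: rec_rows.simps)
      qed
    qed
    have "length (b @ c) \<le> N" using lens[of "b @ c"] d(5) by simp
    moreover have "p < m" if "p \<in> fst ` set b" for p using that unfolding d(6) by simp
    moreover have "m \<le> p" if "p \<in> fst ` set c" for p using that unfolding d(7) by simp
    ultimately have "knuth (row_word N (\<lambda>i. rec_rows (b @ c) i \<inter> {m..})) (row_word N (rec_rows c))" using tail[OF d(8) HOL.refl] by blast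
    then show "knuth (row_word N (\<lambda>i. rec_rows (b @ c) i \<inter> {m..})) v" unfolding d(4) using kv knuth_sym knuth_trans by blast
  qed
  have nuN: "nu i = 0" if "N \<le> i" for i using that N(1) n by simp
  show ?thesis
    unfolding bij_betw_def
  proof
    show "inj_on (\<lambda>(b, c). fill lam (\<lambda>i. rec_rows (b @ c) i \<inter> {m..})) splits"
    proof (rule inj_onI, clarify)
      fix b c b' c' assume bc: "(b, c) \<in> splits" and bc': "(b', c') \<in> splits"
        and e: "fill lam (\<lambda>i. rec_rows (b @ c) i \<inter> {m..}) = fill lam (\<lambda>i. rec_rows (b' @ c') i \<inter> {m..})"
      note d = splitsD[OF bc] note d' = splitsD[OF bc']
      have "(\<lambda>i. rec_rows (b @ c) i \<inter> {m..}) = (\<lambda>i. rec_rows (b' @ c') i \<inter> {m..})"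
        by (rule HOL.trans[OF filling_rows_fill[OF skew[OF bc], symmetric] HOL.trans[OF arg_cong[OF e, of filling_rows] filling_rows_fill[OF skew[OF bc']]]])
      from fun_cong[OF this] have "rec_rows (b @ c) i = rec_rows (b' @ c') i" for i
        by (subst Qd[OF bc], subst Qd[OF bc']) (simp only:)
      then have "rec_rows (b @ c) = rec_rows (b' @ c')" by (rule ext)
      then have "b @ c = b' @ c'" using RSK_inj[OF d(8) d'(8)] d(9) d'(9) by simp
      then show "b = b' \<and> c = c'" using d(12) d'(12) by simp
    qed
    show "(\<lambda>(b, c). fill lam (\<lambda>i. rec_rows (b @ c) i \<inter> {m..})) ` splits = std_class nu lam v"
    proof (rule subset_antisym; rule subsetI)
      fix F assume "F \<in> (\<lambda>(b, c). fill lam (\<lambda>i. rec_rows (b @ c) i \<inter> {m..})) ` splits"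
      then obtain b c where bc: "(b, c) \<in> splits" and F: "F = fill lam (\<lambda>i. rec_rows (b @ c) i \<inter> {m..})" by auto
      have sf: "std_filling nu lam F" "filling_rows F = (\<lambda>i. rec_rows (b @ c) i \<inter> {m..})"
        unfolding F using std_filling_fill[OF skew[OF bc]] filling_rows_fill[OF skew[OF bc]] by auto
      have "knuth (row_word N (filling_rows F)) (column_reading F)"
        using knuth_column_reading[OF sf(1) al an] nuN by blast
      then have "knuth (column_reading F) v" using knv[OF bc] sf(2) knuth_sym knuth_trans by metis
      then show "F \<in> std_class nu lam v" using sf(1) by (simp add: std_class_def)
    next
      fix F assume "F \<in> std_class nu lam v"
      then have F: "std_filling nu lam F" "knuth (column_reading F) v" by (auto simp: std_class_def)
      define S where "S = filling_rows F"
      have sk: "skew_tableau nu lam S" unfolding S_def by (rule skew_tableau_filling_rows[OF F(1) al an assms])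
      have kF: "knuth (row_word N S) (column_reading F)"
        unfolding S_def using knuth_column_reading[OF F(1) al an] nuN by blast
      have finS: "finite (S i)" for i using sk by (simp add: skew_tableau_def)
      have Se: "S i = {}" if "N \<le> i" for i
      proof -
        have "lam i + card (S i) = 0" using sk nuN[OF that] by (simp add: skew_tableau_def)
        then show ?thesis using finS[of i] by simp
      qed
      have "(\<Union>i. S i) = (\<Union>i<N. S i)" using Se by (force simp: not_less[symmetric])
      also have "\<dots> = set v" using set_row_word[OF finS, of N] knuth_set[OF kF] knuth_set[OF F(2)] by simp
      finally have SU: "(\<Union>i. S i) = {m..<k}" using v(2) by simp
      then have Sm: "S i \<subseteq> {m..<k}" for i by blast
      define R where "R i = U i \<union> S i" for i
      have US: "U i \<inter> S j = {}" for i j using Um[of i] Sm[of j] by force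
      have cR: "card (R i) = nu i" for i
        using card_Un_disjoint[OF finU[of i] finS[of i] US] sk U(2) by (simp add: R_def skew_tableau_def)
      have cntR: "count_below (R i) a = count_below (U i) a + count_below (S i) a" for i a
      proof -
        have "{x \<in> R i. x < a} = {x \<in> U i. x < a} \<union> {x \<in> S i. x < a}" by (auto simp: R_def)
        then show ?thesis unfolding count_below_def
          by (simp only:) (rule card_Un_disjoint, use finU finS US[of i i] in auto)
      qed
      have "tableau R"
        unfolding tableau_def
      proof (intro conjI allI impI)
        show "finite (R i)" for i using finU finS by (simp add: R_def)
        show "R i \<inter> R j = {}" if "i \<noteq> j" for i j
        proof -
          have "U i \<inter> U j = {}" "S i \<inter> S j = {}"
            using U(1) sk that by (simp_all add: tableau_def skew_tableau_def)
          then show ?thesis using US[of i j] US[of j i] unfolding R_def by blast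
        qed
        show "count_below (R (Suc i)) a \<le> count_below (R i) a" for i a
        proof (cases "m \<le> a")
          case True
          have "count_below (U i) a = lam i" for i
            using Um[of i] True U(2) by (subst count_below_eq_card) auto
          then show ?thesis using sk by (simp add: cntR skew_tableau_def)
        next
          case False
          have "{x \<in> S i. x < a} = {}" for i using Sm[of i] False by auto
          then have "count_below (S i) a = 0" for i unfolding count_below_def by (metis card.empty)
          then show ?thesis using U(1) by (simp add: cntR tableau_def)
        qed
      qed
      have RU: "(\<Union>i. R i) = {..<m} \<union> {m..<k}" unfolding U(3)[symmetric] SU[symmetric] R_def by auto
      then have "finite (\<Union>i. R i)" by simp
      from RSK_surj[OF tableau_ins_rows[OF distinct_s] \<open>tableau R\<close> _ this]
      obtain b where b: "biword b" "ins_rows (map snd b) = ins_rows s" "rec_rows b = R" using cR ins_rows_s(2) by metis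
      have kb: "knuth (map snd b) s" using ins_rows_eq_imp_knuth[OF _ distinct_s] b by (simp add: biword_def)
      define b1 where "b1 = filter (\<lambda>e. fst e < m) b"
      define b2 where "b2 = filter (\<lambda>e. \<not> fst e < m) b"
      have split: "x = filter (\<lambda>e. fst e < m) x @ filter (\<lambda>e. \<not> fst e < m) x"
        if "sorted_wrt (<) (map fst x)" for x :: "(nat \<times> nat) list"
        using that
      proof (induction x)
        case (Cons e x)
        show ?case
        proof (cases "fst e < m")
          case False
          then have "filter (\<lambda>e. fst e < m) x = []" using Cons.prems by (force simp: filter_empty_conv)
          then show ?thesis using Cons False by auto
        qed (use Cons in auto)
      qed simp
      have b12: "b = b1 @ b2" unfolding b1_def b2_def using b(1) split by (simp add: biword_def)
      have bi: "biword b1" "biword b2" using b(1) unfolding b12 by (auto simp: biword_def sorted_wrt_append)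
      have lab: "\<And>p. p \<in> fst ` set b1 \<Longrightarrow> p < m" "\<And>p. p \<in> fst ` set b2 \<Longrightarrow> m \<le> p"
        by (auto simp: b1_def b2_def)
      have "rec_rows b1 i = U i" for i
      proof -
        have "rec_rows b1 i = R i \<inter> {..<m}" using rec_rows_append[of b1 m b2 i] lab b(3) b12 by metis
        then show ?thesis using Um[of i] Sm[of i] unfolding R_def by force
      qed
      then have Q1: "rec_rows b1 = U" by blast
      have RS: "(\<lambda>i. rec_rows b i \<inter> {m..}) = S" using Um Sm unfolding b(3) R_def by force
      have lb: "length b \<le> N" by (rule lens[OF kb])
      have "knuth (row_word N S) (row_word N (rec_rows b2))" using tail[OF b(1) b12 lab lb] RS by simp
      then have "knuth (row_word N (rec_rows b2)) (row_word N (ins_rows v))" using kF F(2) kv knuth_sym knuth_trans by metis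
      moreover have "rec_rows b2 i = {}" if "N \<le> i" for i
        using rec_rows_eq_empty[OF bi(2)] lb that by (simp add: b12)
      ultimately have Q2: "rec_rows b2 = ins_rows v" using tableau_eqI[OF tableau_rec_rows[OF bi(2)] _ tableau_ins_rows[OF v(1)] Pv] by blast
      have "knuth (map snd b1 @ map snd b2) s" using kb unfolding b12 by simp
      then have "(b1, b2) \<in> splits" using bi Q1 Q2 by (simp add: splits_def)
      moreover have "F = fill lam (\<lambda>i. rec_rows (b1 @ b2) i \<inter> {m..})"
        using RS fill_filling_rows[OF F(1) assms] by (simp add: b12 S_def)
      ultimately show "F \<in> (\<lambda>(b, c). fill lam (\<lambda>i. rec_rows (b @ c) i \<inter> {m..})) ` splits" by force
    qed
  qed
qed

end


section \<open>The Littlewood-Richardson rule\<close>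

lemma straight_tableau_exists:
  assumes "mu \<in> partitions"
  obtains k where "\<And>b. \<exists>R. tableau R \<and> (\<forall>i. card (R i) = mu i) \<and> (\<Union>i. R i) = {b..<b + k}"
proof -
  obtain n where n: "\<forall>i\<ge>n. mu i = 0" using partitionsD(2)[OF assms] by blast
  have am: "mu (Suc i) \<le> mu i" for i using partitionsD(1)[OF assms] by (simp add: antimono_def)
  define off where "off i = sum mu {..<i}" for i
  have off: "off (Suc i) = off i + mu i" for i by (simp add: off_def)
  have off_mono: "off i \<le> off j" if "i \<le> j" for i j
    unfolding off_def using that by (intro sum_mono2) auto
  have "\<exists>R. tableau R \<and> (\<forall>i. card (R i) = mu i) \<and> (\<Union>i. R i) = {b..<b + off n}" for b
  proof -
    define R where "R i = {b + off i..<b + off i + mu i}" for i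
    have cR: "count_below (R i) a = min (b + off i + mu i) a - (b + off i)" for i a
    proof -
      have "{c \<in> R i. c < a} = {b + off i..<min (b + off i + mu i) a}" by (auto simp: R_def)
      then show ?thesis by (simp add: count_below_def)
    qed
    have disj: "R i \<inter> R j = {}" if "i < j" for i j
      using off_mono[of "Suc i" j] that by (auto simp: R_def off)
    have tR: "tableau R"
      unfolding tableau_def
    proof (intro conjI allI impI)
      show "finite (R i)" for i by (simp add: R_def)
      show "R i \<inter> R j = {}" if "i \<noteq> j" for i j
        using disj[of i j] disj[of j i] that by (cases "i < j") (auto simp: Int_commute)
      show "count_below (R (Suc i)) a \<le> count_below (R i) a" for i a
        unfolding cR off using am[of i] by linarith
    qed
    have card: "card (R i) = mu i" for i by (simp add: R_def)
    have U: "(\<Union>i<j. R i) = {b..<b + off j}" for j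
    proof (induction j)
      case (Suc j)
      then show ?case by (auto simp: R_def off lessThan_Suc)
    qed (simp add: off_def)
    have U': "(\<Union>i. R i) = (\<Union>i<n. R i)"
    proof -
      have "R i = {}" if "\<not> i < n" for i using n that by (simp add: R_def)
      then show ?thesis by force
    qed
    show ?thesis using tR card U'[unfolded U] by blast
  qed
  then show ?thesis by (rule that)
qed

lemma recording_split_exists:
  assumes "sg \<in> A \<rightarrow> {0, 1}" "t \<in> super_tableaux A sg nu" "nu \<in> partitions" "lam \<in> partitions" "mu \<in> partitions"
    "distinct v" "set v = {m..<k}" "\<And>i. card (ins_rows v i) = mu i" "tableau U" "\<And>i. card (U i) = lam i" "(\<Union>i. U i) = {..<m}"
  obtains g s T where "recording_split A sg g s v nu lam mu T m k U" "t = map_option g \<circ> T"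
proof -
  obtain g s where s: "mono g" "distinct s" "map g s = column_reading t" "std_compat g sg s"
    using standardization_exists[of 0 "column_reading t" sg] by metis
  have t: "t \<in> super_skew_tableaux A sg nu (\<lambda>_. 0)" using assms(2) by (simp add: super_tableaux_def)
  have "set (map g s) \<subseteq> A" using column_reading_in_lists[OF t assms(3)] s(3) by auto
  then have "g ` set s \<subseteq> A" by simp
  moreover obtain T where "std_filling nu (\<lambda>_. 0) T" "column_reading T = s" "t = map_option g \<circ> T"
    using standard_super_skew[OF t assms(3) s(3)[symmetric] s(1,2,4)] by blast
  ultimately show ?thesis using that[of g s T] assms s by (simp add: recording_split_def)
qed

lemma card_factorizations:
  assumes "sg \<in> A \<rightarrow> {0, 1}" "t \<in> super_tableaux A sg nu" "nu \<in> partitions" "lam \<in> partitions" "mu \<in> partitions"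
    "distinct v" "set v = {m..<k}" "\<And>i. card (ins_rows v i) = mu i" "tableau U" "\<And>i. card (U i) = lam i" "(\<Union>i. U i) = {..<m}"
    "\<And>i. lam i \<le> nu i"
  shows "card (factorizations A sg lam mu t) = card (std_class nu lam v)"
proof -
  obtain g s T where r: "recording_split A sg g s v nu lam mu T m k U" "t = map_option g \<circ> T"
    using recording_split_exists[OF assms(1-11)] by metis
  show ?thesis
    using bij_betw_same_card[OF recording_split.bij_betw_factorizations[OF r(1)]]
      bij_betw_same_card[OF recording_split.bij_betw_std_class[OF r(1) assms(12)]] r(2) by simp
qed

lemma standard_word_exists:
  assumes "mu \<in> partitions"
  obtains v k where "distinct v" "set v = {m..<k}" "\<And>i. card (ins_rows v i) = mu i"
proof -
  obtain k where "\<And>b. \<exists>R. tableau R \<and> (\<forall>i. card (R i) = mu i) \<and> (\<Union>i. R i) = {b..<b + k}"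
    using straight_tableau_exists[OF assms] by blast
  then obtain R where R: "tableau R" "\<And>i. card (R i) = mu i" "(\<Union>i. R i) = {m..<m + k}" by metis
  have "finite (\<Union>i. R i)" unfolding R(3) by simp
  then obtain b where b: "biword b" "ins_rows (map snd b) = R" "snd ` set b = (\<Union>i. R i)"
    using RSK_surj[OF R(1) R(1) HOL.refl] by metis
  show ?thesis
    using that[of "map snd b" "m + k"] b R by (simp add: biword_def)
qed

lemma recording_tableau_exists:
  assumes "lam \<in> partitions"
  obtains U m where "tableau U" "\<And>i. card (U i) = lam i" "(\<Union>i. U i) = {..<m}"
  using straight_tableau_exists[OF assms] by (metis add_0 atLeast0LessThan)

lemma factorizations_imp_contained:
  assumes "sg \<in> A \<rightarrow> {0, 1}" "t \<in> super_tableaux A sg nu" "nu \<in> partitions" "lam \<in> partitions" "mu \<in> partitions"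
    "factorizations A sg lam mu t \<noteq> {}"
  shows "lam i \<le> nu i"
proof -
  obtain U m where U: "tableau U" "\<And>i. card (U i) = lam i" "(\<Union>i. U i) = {..<m}"
    using recording_tableau_exists[OF assms(4)] by blast
  obtain v k where v: "distinct v" "set v = {m..<k}" "\<And>i. card (ins_rows v i) = mu i"
    using standard_word_exists[OF assms(5)] by blast
  obtain g s T where r: "recording_split A sg g s v nu lam mu T m k U" "t = map_option g \<circ> T"
    using recording_split_exists[OF assms(1-5) v U] by metis
  have "recording_split.splits s v U \<noteq> {}"
    using bij_betw_imp_surj_on[OF recording_split.bij_betw_factorizations[OF r(1)]] assms(6)
    unfolding r(2) by blast
  then show ?thesis by (rule recording_split.splits_imp_contained[OF r(1)])
qed

lemma card_factorizations_eq_LR_coeff: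
  assumes "sg \<in> A \<rightarrow> {0, 1}" "t \<in> super_tableaux A sg nu" "nu \<in> partitions" "lam \<in> partitions" "mu \<in> partitions"
  shows "card (factorizations A sg lam mu t) = LR_coeff A sg lam mu nu"
proof -
  define t' where "t' = (SOME t. t \<in> super_tableaux A sg nu)"
  have t': "t' \<in> super_tableaux A sg nu" unfolding t'_def by (rule someI[of "\<lambda>t. t \<in> super_tableaux A sg nu", OF assms(2)])
  have "card (factorizations A sg lam mu t) = card (factorizations A sg lam mu t')"
  proof (cases "\<forall>i. lam i \<le> nu i")
    case True
    obtain U m where U: "tableau U" "\<And>i. card (U i) = lam i" "(\<Union>i. U i) = {..<m}"
      using recording_tableau_exists[OF assms(4)] by blast
    obtain v k where v: "distinct v" "set v = {m..<k}" "\<And>i. card (ins_rows v i) = mu i"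
      using standard_word_exists[OF assms(5)] by blast
    show ?thesis
      using card_factorizations[OF assms(1,2,3,4,5) v U] card_factorizations[OF assms(1) t' assms(3,4,5) v U] True
      by metis
  next
    case False
    then have "factorizations A sg lam mu t = {}" "factorizations A sg lam mu t' = {}"
      using factorizations_imp_contained[OF assms] factorizations_imp_contained[OF assms(1) t' assms(3-5)] by blast+
    then show ?thesis by simp
  qed
  then show ?thesis by (simp add: LR_coeff_def t'_def)
qed

lemma card_rectifying_eq_LR_coeff:
  assumes "sg \<in> A \<rightarrow> {0, 1}" "super_tableaux A sg nu \<noteq> {}" "nu \<in> partitions" "lam \<in> partitions" "mu \<in> partitions"
    "\<And>i. lam i \<le> nu i" "u \<in> super_tableaux A sg mu"
  shows "card {S \<in> super_skew_tableaux A sg nu lam. (column_reading S, column_reading u) \<in> plactic_cong A sg} =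
    LR_coeff A sg lam mu nu"
proof -
  obtain t where t: "t \<in> super_tableaux A sg nu" using assms(2) by blast
  obtain U m where U: "tableau U" "\<And>i. card (U i) = lam i" "(\<Union>i. U i) = {..<m}"
    using recording_tableau_exists[OF assms(4)] by blast
  obtain g v where v: "mono g" "distinct v" "set v = {m..<m + length (column_reading u)}"
    "map g v = column_reading u" "std_compat g sg v"
    using standardization_exists[of m "column_reading u" sg] by metis
  have u: "u \<in> super_skew_tableaux A sg mu (\<lambda>_. 0)" using assms(7) by (simp add: super_tableaux_def)
  obtain F where F: "std_filling mu (\<lambda>_. 0) F" "column_reading F = v"
    using standard_super_skew[OF u assms(5) v(4)[symmetric] v(1,2,5)] by blast
  have c: "card (ins_rows v i) = mu i" for i
    using ins_rows_column_reading[OF F(1) assms(5)] card_filling_rows[OF F(1) assms(5)] F(2) by simp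
  have "set (map g v) \<subseteq> A" using column_reading_in_lists[OF u assms(5)] v(4) by auto
  then have "g ` set v \<subseteq> A" by simp
  from card_super_skew_class[OF assms(3,1) v(1,5,2) this, of lam]
  show ?thesis
    using card_factorizations[OF assms(1) t assms(3-5) v(2,3) c U assms(6)]
      card_factorizations_eq_LR_coeff[OF assms(1) t assms(3-5)] v(4) by simp
qed

lemma finite_skew_diagram:
  assumes "nu \<in> partitions"
  shows "finite (skew_diagram nu lam)"
proof -
  obtain n where n: "\<forall>i\<ge>n. nu i = 0" using partitionsD(2)[OF assms] by blast
  show ?thesis using set_cells[OF partitionsD(1)[OF assms] n, of lam] by (metis List.finite_set)
qed

lemma finite_super_skew_tableaux:
  assumes "finite A" "nu \<in> partitions"
  shows "finite (super_skew_tableaux A sg nu lam)"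
  by (rule finite_subset[OF _ finite_set_of_finite_maps[OF finite_skew_diagram[OF assms(2), of lam] assms(1)]])
    (auto simp: super_skew_tableaux_def)

lemma sum_const_frag: "(\<Sum>x\<in>X. c) = frag_cmul (int (card X)) c" if "finite X"
  using that by (induction rule: finite_induct) (simp_all add: frag_cmul_distrib)

lemma sum_by_shape:
  fixes A :: "'a::linorder set" and f :: "'b \<Rightarrow> 'a filling"
  assumes "finite A" "finite X"
    and sh: "\<And>x. x \<in> X \<Longrightarrow> \<exists>kap\<in>partitions. f x \<in> super_tableaux A sg kap"
    and K: "\<And>x kap. x \<in> X \<Longrightarrow> kap \<in> partitions \<Longrightarrow> f x \<in> super_tableaux A sg kap \<Longrightarrow> K kap"
    and c: "\<And>kap t. kap \<in> partitions \<Longrightarrow> K kap \<Longrightarrow> t \<in> super_tableaux A sg kap \<Longrightarrow> card {x \<in> X. f x = t} = c kap"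
  shows "finite {kap \<in> partitions. K kap \<and> frag_cmul (int (c kap)) (S_straight A sg kap) \<noteq> 0} \<and>
    (\<Sum>x\<in>X. frag_of (plactic_class A sg (column_reading (f x)))) =
      Sum_any (\<lambda>kap. frag_cmul (int (c kap)) (S_straight A sg kap) when kap \<in> partitions \<and> K kap)"
proof -
  define shp where "shp x = (SOME kap. kap \<in> partitions \<and> f x \<in> super_tableaux A sg kap)" for x
  have shp: "shp x \<in> partitions" "f x \<in> super_tableaux A sg (shp x)" if "x \<in> X" for x
    using someI_ex[of "\<lambda>kap. kap \<in> partitions \<and> f x \<in> super_tableaux A sg kap"] sh[OF that]
    unfolding shp_def by blast+
  have shp_eq: "shp x = kap" if "x \<in> X" "f x \<in> super_tableaux A sg kap" for x kap
    using super_tableaux_shape_unique[OF shp(2)[OF that(1)] that(2)] .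
  define Z where "Z = shp ` X"
  have finZ: "finite Z" using assms(2) by (simp add: Z_def)
  define w where "w t = frag_of (plactic_class A sg (column_reading t))" for t :: "'a filling"
  define g where "g kap = (frag_cmul (int (c kap)) (S_straight A sg kap) when kap \<in> partitions \<and> K kap)" for kap
  have ZK: "kap \<in> partitions" "K kap" if "kap \<in> Z" for kap
    using that shp K unfolding Z_def by blast+
  have term_eq: "frag_cmul (int (c kap)) (S_straight A sg kap) = (\<Sum>x | x \<in> X \<and> shp x = kap. w (f x))"
    if kap: "kap \<in> partitions" "K kap" for kap
  proof -
    let ?X = "{x. x \<in> X \<and> shp x = kap}" and ?T = "super_tableaux A sg kap"
    have finT: "finite ?T" unfolding super_tableaux_def by (rule finite_super_skew_tableaux[OF assms(1) kap(1)])
    have "f ` ?X \<subseteq> ?T" using shp(2) by blast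
    then have "(\<Sum>x\<in>?X. w (f x)) = (\<Sum>t\<in>?T. \<Sum>x | x \<in> ?X \<and> f x = t. w (f x))"
      using assms(2) finT by (intro sum.group[symmetric]) auto
    also have "\<dots> = (\<Sum>t\<in>?T. frag_cmul (int (c kap)) (w t))"
    proof (rule sum.cong[OF HOL.refl])
      fix t assume t: "t \<in> ?T"
      have e: "{x. x \<in> ?X \<and> f x = t} = {x \<in> X. f x = t}" using shp_eq t by blast
      have "(\<Sum>x | x \<in> ?X \<and> f x = t. w (f x)) = (\<Sum>x | x \<in> ?X \<and> f x = t. w t)"
        by (rule sum.cong) auto
      also have "\<dots> = frag_cmul (int (card {x \<in> X. f x = t})) (w t)"
        unfolding e using assms(2) by (intro sum_const_frag) simp
      finally show "(\<Sum>x | x \<in> ?X \<and> f x = t. w (f x)) = frag_cmul (int (c kap)) (w t)"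
        using c[OF kap t] by simp
    qed
    finally show ?thesis by (simp add: S_straight_def frag_cmul_sum w_def)
  qed
  have supp: "{kap. g kap \<noteq> 0} \<subseteq> Z"
  proof
    fix kap assume "kap \<in> {kap. g kap \<noteq> 0}"
    then have kap: "kap \<in> partitions" "K kap" "g kap \<noteq> 0" by (auto simp: g_def when_def split: if_splits)
    then have "(\<Sum>x | x \<in> X \<and> shp x = kap. w (f x)) \<noteq> 0" using term_eq by (simp add: g_def)
    then have "{x. x \<in> X \<and> shp x = kap} \<noteq> {}" by (metis sum.empty)
    then show "kap \<in> Z" by (auto simp: Z_def)
  qed
  have "Sum_any g = sum g Z" by (rule Sum_any.expand_superset[OF finZ supp])
  also have "\<dots> = (\<Sum>kap\<in>Z. \<Sum>x | x \<in> X \<and> shp x = kap. w (f x))"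
    by (rule sum.cong[OF HOL.refl]) (simp add: g_def ZK term_eq)
  also have "\<dots> = (\<Sum>x\<in>X. w (f x))"
    using assms(2) finZ by (intro sum.group) (auto simp: Z_def)
  finally have "(\<Sum>x\<in>X. w (f x)) = Sum_any g" by simp
  moreover have "finite {kap \<in> partitions. K kap \<and> frag_cmul (int (c kap)) (S_straight A sg kap) \<noteq> 0}"
    by (rule finite_subset[OF _ finZ], rule order_trans[OF _ supp]) (auto simp: g_def)
  ultimately show ?thesis by (simp add: w_def g_def[abs_def])
qed

lemma S_straight_mult:
  assumes "finite A" "lam \<in> partitions" "mu \<in> partitions"
  shows "S_straight A sg lam \<otimes>\<^bsub>super_plactic_ring A sg\<^esub> S_straight A sg mu =
    (\<Sum>(t, u)\<in>super_tableaux A sg lam \<times> super_tableaux A sg mu.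
       frag_of (plactic_class A sg (column_reading t @ column_reading u)))"
proof -
  have fin: "finite (super_tableaux A sg lam)" "finite (super_tableaux A sg mu)"
    unfolding super_tableaux_def using finite_super_skew_tableaux assms by blast+
  have l: "column_reading t \<in> lists A" if "t \<in> super_tableaux A sg kap" "kap \<in> partitions" for t kap
    using column_reading_in_lists that unfolding super_tableaux_def by blast
  have "S_straight A sg lam \<otimes>\<^bsub>super_plactic_ring A sg\<^esub> S_straight A sg mu =
    (\<Sum>t\<in>super_tableaux A sg lam. \<Sum>u\<in>super_tableaux A sg mu.
       frag_of (plactic_class A sg (column_reading t) \<otimes>\<^bsub>super_plactic_monoid A sg\<^esub> plactic_class A sg (column_reading u)))"
    unfolding super_plactic_ring_def monoid_algebra_def S_straight_def
    by (simp add: frag_extend_sum fin comp_def)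
  also have "\<dots> = (\<Sum>t\<in>super_tableaux A sg lam. \<Sum>u\<in>super_tableaux A sg mu.
       frag_of (plactic_class A sg (column_reading t @ column_reading u)))"
  proof (intro sum.cong HOL.refl)
    fix t u assume "t \<in> super_tableaux A sg lam" "u \<in> super_tableaux A sg mu"
    from mult_plactic_class[OF l[OF this(1) assms(2)] l[OF this(2) assms(3)], of sg]
    show "frag_of (plactic_class A sg (column_reading t) \<otimes>\<^bsub>super_plactic_monoid A sg\<^esub> plactic_class A sg (column_reading u))
      = frag_of (plactic_class A sg (column_reading t @ column_reading u))" by (rule arg_cong)
  qed
  finally show ?thesis by (simp add: sum.cartesian_product)
qed

lemma diagram_subset_iff: "diagram lam \<subseteq> diagram nu \<longleftrightarrow> (\<forall>i. lam i \<le> nu i)"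
proof -
  have "lam i \<le> nu i \<longleftrightarrow> (\<forall>j. j < lam i \<longrightarrow> j < nu i)" for i
    by (metis leI less_irrefl less_le_trans)
  then show ?thesis by (auto simp: diagram_def skew_diagram_def)
qed

theorem mainTheorem3:
  fixes A :: "'a::linorder set" and sg :: "'a \<Rightarrow> nat" and lam mu nu :: "nat \<Rightarrow> nat"
  assumes "finite_signed_alphabet A sg"
    and "lam \<in> partitions" and "mu \<in> partitions" and "nu \<in> partitions"
    and "diagram lam \<subseteq> diagram nu"
  shows
    "(\<forall>t \<in> super_tableaux A sg nu.
        card (factorizations A sg lam mu t) = LR_coeff A sg lam mu nu) \<and>
     (finite {kap \<in> partitions. diagram lam \<subseteq> diagram kap \<and>
          frag_cmul (int (LR_coeff A sg lam mu kap)) (S_straight A sg kap) \<noteq> 0} \<and>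
      S_straight A sg lam \<otimes>\<^bsub>super_plactic_ring A sg\<^esub> S_straight A sg mu =
        Sum_any (\<lambda>kap. frag_cmul (int (LR_coeff A sg lam mu kap)) (S_straight A sg kap)
          when kap \<in> partitions \<and> diagram lam \<subseteq> diagram kap)) \<and>
     (super_tableaux A sg nu \<noteq> {} \<longrightarrow>
        finite {kap \<in> partitions.
          frag_cmul (int (LR_coeff A sg lam kap nu)) (S_straight A sg kap) \<noteq> 0} \<and>
        S_skew A sg nu lam =
          Sum_any (\<lambda>kap. frag_cmul (int (LR_coeff A sg lam kap nu)) (S_straight A sg kap)
            when kap \<in> partitions))"
proof (intro conjI impI)
  have A: "finite A" "sg \<in> A \<rightarrow> {0, 1}" using assms(1) by (auto simp: finite_signed_alphabet_def)
  note part = assms(2-4)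
  have fin: "finite (super_tableaux A sg kap)" if "kap \<in> partitions" for kap
    unfolding super_tableaux_def by (rule finite_super_skew_tableaux[OF A(1) that])
  have clI: "plactic_class A sg v = plactic_class A sg w" if "(v, w) \<in> plactic_cong A sg" for v w
    using plactic_class_eq_iff[of v A w sg] plactic_cong_in_lists[OF that] that by blast
  show "\<forall>t \<in> super_tableaux A sg nu. card (factorizations A sg lam mu t) = LR_coeff A sg lam mu nu"
    using card_factorizations_eq_LR_coeff[OF A(2) _ part(3,1,2)] by blast
  let ?X = "super_tableaux A sg lam \<times> super_tableaux A sg mu"
  let ?f = "\<lambda>(t, u). tableau_product A sg t u"
  have prod: "\<exists>kap\<in>partitions. tableau_product A sg t u \<in> super_tableaux A sg kap \<and>
      (column_reading (tableau_product A sg t u), column_reading t @ column_reading u) \<in> plactic_cong A sg"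
    if tu: "t \<in> super_tableaux A sg lam" "u \<in> super_tableaux A sg mu" for t u
  proof -
    have "column_reading t @ column_reading u \<in> lists A"
      using column_reading_in_lists[OF tu(1)[unfolded super_tableaux_def] part(1)]
        column_reading_in_lists[OF tu(2)[unfolded super_tableaux_def] part(2)]
      by (simp only: append_in_lists_conv)
    from super_tableau_exists[OF this A(2)] obtain kap r where r: "kap \<in> partitions" "r \<in> super_tableaux A sg kap"
      "(column_reading r, column_reading t @ column_reading u) \<in> plactic_cong A sg" by blast
    then have "tableau_product A sg t u = r" using tableau_product_eq_iff[OF A(2) tu part(1,2) r(2,1)] by blast
    then show ?thesis using r by blast
  qed
  have fact: "{x \<in> ?X. ?f x = t} = factorizations A sg lam mu t" for t
    by (auto simp: factorizations_def)
  have *: "finite {kap \<in> partitions. diagram lam \<subseteq> diagram kap \<and>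
      frag_cmul (int (LR_coeff A sg lam mu kap)) (S_straight A sg kap) \<noteq> 0} \<and>
    (\<Sum>x\<in>?X. frag_of (plactic_class A sg (column_reading (?f x)))) =
      Sum_any (\<lambda>kap. frag_cmul (int (LR_coeff A sg lam mu kap)) (S_straight A sg kap)
          when kap \<in> partitions \<and> diagram lam \<subseteq> diagram kap)"
  proof (rule sum_by_shape[OF A(1)])
    show "finite ?X" using fin part by blast
    show "\<exists>kap\<in>partitions. ?f x \<in> super_tableaux A sg kap" if "x \<in> ?X" for x
      using prod that by auto
    show "diagram lam \<subseteq> diagram kap"
      if x: "x \<in> ?X" "kap \<in> partitions" "?f x \<in> super_tableaux A sg kap" for x kap
    proof -
      have "factorizations A sg lam mu (?f x) \<noteq> {}" using fact[of "?f x"] x(1) by blast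
      then show ?thesis
        using factorizations_imp_contained[OF A(2) x(3,2) part(1,2)] by (simp add: diagram_subset_iff)
    qed
    show "card {x \<in> ?X. ?f x = t} = LR_coeff A sg lam mu kap"
      if "kap \<in> partitions" "t \<in> super_tableaux A sg kap" for kap t
      unfolding fact by (rule card_factorizations_eq_LR_coeff[OF A(2) that(2,1) part(1,2)])
  qed
  then show "finite {kap \<in> partitions. diagram lam \<subseteq> diagram kap \<and>
      frag_cmul (int (LR_coeff A sg lam mu kap)) (S_straight A sg kap) \<noteq> 0}" by blast
  have "S_straight A sg lam \<otimes>\<^bsub>super_plactic_ring A sg\<^esub> S_straight A sg mu =
    (\<Sum>x\<in>?X. frag_of (plactic_class A sg (column_reading (?f x))))"
    unfolding S_straight_mult[OF A(1) part(1,2)]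
    by (rule sum.cong[OF HOL.refl]) (use prod clI plactic_cong.sym in fastforce)
  then show "S_straight A sg lam \<otimes>\<^bsub>super_plactic_ring A sg\<^esub> S_straight A sg mu =
      Sum_any (\<lambda>kap. frag_cmul (int (LR_coeff A sg lam mu kap)) (S_straight A sg kap)
        when kap \<in> partitions \<and> diagram lam \<subseteq> diagram kap)" using * by simp
  let ?Y = "super_skew_tableaux A sg nu lam"
  define rect where "rect S = (SOME r. r \<in> (\<Union>kap\<in>partitions. super_tableaux A sg kap) \<and>
    (column_reading r, column_reading S) \<in> plactic_cong A sg)" for S :: "'a filling"
  have rect: "rect S \<in> (\<Union>kap\<in>partitions. super_tableaux A sg kap) \<and>
    (column_reading (rect S), column_reading S) \<in> plactic_cong A sg" if "S \<in> ?Y" for S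
  proof -
    have "\<exists>r. r \<in> (\<Union>kap\<in>partitions. super_tableaux A sg kap) \<and>
      (column_reading r, column_reading S) \<in> plactic_cong A sg"
      using super_tableau_exists[OF column_reading_in_lists[OF that part(3)] A(2)] by blast
    then show ?thesis unfolding rect_def by (rule someI_ex)
  qed
  have "finite {kap \<in> partitions. True \<and>
      frag_cmul (int (LR_coeff A sg lam kap nu)) (S_straight A sg kap) \<noteq> 0} \<and>
    (\<Sum>S\<in>?Y. frag_of (plactic_class A sg (column_reading (rect S)))) =
      Sum_any (\<lambda>kap. frag_cmul (int (LR_coeff A sg lam kap nu)) (S_straight A sg kap)
          when kap \<in> partitions \<and> True)" if ne: "super_tableaux A sg nu \<noteq> {}"
  proof (rule sum_by_shape[OF A(1)])
    show "finite ?Y" by (rule finite_super_skew_tableaux[OF A(1) part(3)])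
    show "\<exists>kap\<in>partitions. rect S \<in> super_tableaux A sg kap" if "S \<in> ?Y" for S
      using rect[OF that] by blast
    show "card {S \<in> ?Y. rect S = t} = LR_coeff A sg lam kap nu"
      if t: "kap \<in> partitions" "t \<in> super_tableaux A sg kap" for kap t
    proof -
      have "rect S = t \<longleftrightarrow> (column_reading S, column_reading t) \<in> plactic_cong A sg" if S: "S \<in> ?Y" for S
      proof
        show "(column_reading S, column_reading t) \<in> plactic_cong A sg" if "rect S = t"
          using rect[OF S] that plactic_cong.sym by blast
        assume "(column_reading S, column_reading t) \<in> plactic_cong A sg"
        with rect[OF S] have "(column_reading (rect S), column_reading t) \<in> plactic_cong A sg"
          using plactic_cong.trans by blast
        then show "rect S = t" using super_tableau_unique[OF _ t(2) _ t(1)] rect[OF S] by blast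
      qed
      then have "{S \<in> ?Y. rect S = t} = {S \<in> ?Y. (column_reading S, column_reading t) \<in> plactic_cong A sg}" by blast
      then show ?thesis
        using card_rectifying_eq_LR_coeff[OF A(2) ne part(3,1) t(1) _ t(2)] assms(5)
        by (simp add: diagram_subset_iff)
    qed
  qed simp
  moreover have "S_skew A sg nu lam = (\<Sum>S\<in>?Y. frag_of (plactic_class A sg (column_reading (rect S))))"
    unfolding S_skew_def
    by (rule sum.cong[OF HOL.refl]) (use rect clI in metis)
  ultimately show
    "finite {kap \<in> partitions. frag_cmul (int (LR_coeff A sg lam kap nu)) (S_straight A sg kap) \<noteq> 0}"
    "S_skew A sg nu lam = Sum_any (\<lambda>kap. frag_cmul (int (LR_coeff A sg lam kap nu)) (S_straight A sg kap)
            when kap \<in> partitions)" if "super_tableaux A sg nu \<noteq> {}"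
    using that by simp_all
qed

end
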